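(* Let $\widetilde M$ be a Kählerian manifold of real dimension $2m$, and let $M$ be an $n$-dimensional ($n>1$) totally real semiparallel submanifold of $\widetilde M$ with parallel $f$-structure in the normal bundle. Suppose that $M$ is of constant (sectional) curvature $c$. Then $M$ is flat, i.e. $c=0$, or $M$ is a totally geodesic submanifold of $\widetilde M$.
   Context: $\widetilde M$ has Riemannian metric $g$, complex structure $J$ and Levi-Civita connection $\widetilde\nabla$. An $n$-dimensional submanifold $M$ (with induced metric and Levi-Civita connection $\nabla$) is totally real if $J T_pM\subset T_pM^\perp$ for every $p\in M$ (so $n\le m$). The second fundamental form $\sigma$ is defined by $\widetilde\nabla_XY=\nabla_XY+\sigma(X,Y)$ for tangent vector fields $X,Y$; $M$ is totally geodesic if $\sigma=0$. For a normal vector field $\xi$, write $\widetilde\nabla_X\xi=-A_\xi X+D_X\xi$ with $-A_\xi X$ tangential and $D_X\xi$ normal; $D$ is the normal connection. $f$-structure: for a normal field $\xi$ write $J\xi=P\xi+f\xi$ with $P\xi$ tangential and $f\xi$ normal. The $f$-structure in the normal bundle is parallel if $Df=0$, i.e. $D_X(f\xi)-f D_X\xi=0$ for all tangent $X$ and normal $\xi$ (when $n=m$, $f=0$ and this holds automatically). Semiparallel: let $R$ be the curvature tensor of $M$ and $R^\perp(X,Y)\xi=D_XD_Y\xi-D_YD_X\xi-D_{[X,Y]}\xi$. $M$ is semiparallel if $R^\perp(X,Y)\sigma(Z,U)-\sigma(R(X,Y)Z,U)-\sigma(Z,R(X,Y)U)=0$ for all tangent $X,Y,Z,U$. *)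

theory Defs
  imports "HOL-Analysis.Analysis" "HOL-Library.Function_Algebras"
begin

section \<open>Smooth maps between Euclidean spaces\<close>

text \<open>Only used on open sets of finite-dimensional spaces.\<close>

primrec Ck_on :: "nat \<Rightarrow> ('e::real_normed_vector \<Rightarrow> 'f::real_normed_vector) \<Rightarrow> 'e set \<Rightarrow> bool" where
  "Ck_on 0 f S \<longleftrightarrow> continuous_on S f"
| "Ck_on (Suc k) f S \<longleftrightarrow>
     (\<forall>x\<in>S. f differentiable (at x)) \<and> (\<forall>v. Ck_on k (\<lambda>x. frechet_derivative f (at x) v) S)"

definition smooth_on :: "'e::real_normed_vector set \<Rightarrow> ('e \<Rightarrow> 'f::real_normed_vector) \<Rightarrow> bool" where
  "smooth_on S f \<longleftrightarrow> (\<forall>k. Ck_on k f S)"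


section \<open>Smooth manifolds\<close>

text \<open>A chart is a pair of its domain and a map that is relevant on this domain only.  The
  underlying set of a manifold is a whole type; its dimension is the dimension of the model
  space \<open>'e\<close>.\<close>

type_synonym ('a, 'e) chart = "'a set \<times> ('a \<Rightarrow> 'e)"

definition is_chart :: "('a::topological_space, 'e::euclidean_space) chart \<Rightarrow> bool" where
  "is_chart = (\<lambda>(U, \<phi>). open U \<and> open (\<phi> ` U) \<and> homeomorphism U (\<phi> ` U) \<phi> (inv_into U \<phi>))"

definition compatible ::
  "('a::topological_space, 'e::euclidean_space) chart \<Rightarrow> ('a, 'e) chart \<Rightarrow> bool" where
  "compatible = (\<lambda>(U, \<phi>) (V, \<psi>).
     smooth_on (\<phi> ` (U \<inter> V)) (\<psi> \<circ> inv_into U \<phi>) \<and>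
     smooth_on (\<psi> ` (U \<inter> V)) (\<phi> \<circ> inv_into V \<psi>))"

definition smooth_manifold ::
  "('a::{t2_space,second_countable_topology}, 'e::euclidean_space) chart set \<Rightarrow> bool" where
  "smooth_manifold A \<longleftrightarrow>
     (\<forall>c\<in>A. is_chart c) \<and> (\<Union>c\<in>A. fst c) = UNIV \<and> (\<forall>c\<in>A. \<forall>c'\<in>A. compatible c c')"

definition maximal_atlas ::
  "('a::topological_space, 'e::euclidean_space) chart set \<Rightarrow> ('a, 'e) chart set" where
  "maximal_atlas A = {c. is_chart c \<and> (\<forall>c'\<in>A. compatible c c')}"

definition std_atlas :: "('e::euclidean_space, 'e) chart set" where
  "std_atlas = {(UNIV, \<lambda>x. x)}"

definition smooth_map_on ::
  "('a::topological_space, 'e::euclidean_space) chart set \<Rightarrow>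
   ('b::topological_space, 'f::euclidean_space) chart set \<Rightarrow> 'a set \<Rightarrow> ('a \<Rightarrow> 'b) \<Rightarrow> bool" where
  "smooth_map_on A B S f \<longleftrightarrow> open S \<and> continuous_on S f \<and>
     (\<forall>(U, \<phi>)\<in>A. \<forall>(V, \<psi>)\<in>B. smooth_on (\<phi> ` (S \<inter> U \<inter> f -` V)) (\<psi> \<circ> f \<circ> inv_into U \<phi>))"

definition smooth_fun_on ::
  "('a::topological_space, 'e::euclidean_space) chart set \<Rightarrow> 'a set \<Rightarrow> ('a \<Rightarrow> real) \<Rightarrow> bool" where
  "smooth_fun_on A S h \<longleftrightarrow> smooth_map_on A std_atlas S h"

definition smooth_near ::
  "('a::topological_space, 'e::euclidean_space) chart set \<Rightarrow> 'a \<Rightarrow> ('a \<Rightarrow> real) \<Rightarrow> bool" where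
  "smooth_near A p h \<longleftrightarrow> (\<exists>S. p \<in> S \<and> smooth_fun_on A S h)"


section \<open>Tangent vectors and vector fields\<close>

instantiation "fun" :: (type, real_vector) real_vector
begin

definition scaleR_fun :: "real \<Rightarrow> ('a \<Rightarrow> 'b) \<Rightarrow> 'a \<Rightarrow> 'b" where
  "scaleR_fun r f = (\<lambda>x. r *\<^sub>R f x)"

instance
  by standard (auto simp: scaleR_fun_def fun_eq_iff scaleR_add_right scaleR_add_left)

end

text \<open>A tangent vector at \<open>p\<close> is the velocity of a smooth curve through \<open>p\<close>, that is, the
  directional derivative of functions smooth near \<open>p\<close> along this curve.  It is \<open>0\<close> by convention
  on functions that are not smooth near \<open>p\<close>, so that tangent vectors are equal iff they agree on
  functions smooth near \<open>p\<close>.\<close>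

type_synonym 'a tangent = "('a \<Rightarrow> real) \<Rightarrow> real"

definition velocity ::
  "('a::topological_space, 'e::euclidean_space) chart set \<Rightarrow> (real \<Rightarrow> 'a) \<Rightarrow> 'a tangent" where
  "velocity A \<gamma> = (\<lambda>h. if smooth_near A (\<gamma> 0) h then deriv (h \<circ> \<gamma>) 0 else 0)"

definition tangent_space ::
  "('a::topological_space, 'e::euclidean_space) chart set \<Rightarrow> 'a \<Rightarrow> 'a tangent set" where
  "tangent_space A p =
     {velocity A \<gamma> |\<gamma>. \<gamma> 0 = p \<and> (\<exists>\<epsilon>>0. smooth_map_on std_atlas A {-\<epsilon><..<\<epsilon>} \<gamma>)}"

text \<open>Differential at \<open>p\<close> of a map \<open>\<iota>\<close> into the manifold with atlas \<open>B\<close>.\<close>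

definition push ::
  "('b::topological_space, 'f::euclidean_space) chart set \<Rightarrow> ('a \<Rightarrow> 'b) \<Rightarrow> 'a \<Rightarrow>
   'a tangent \<Rightarrow> 'b tangent" where
  "push B \<iota> p v = (\<lambda>h. if smooth_near B (\<iota> p) h then v (h \<circ> \<iota>) else 0)"

text \<open>Smooth vector fields along \<open>\<iota>\<close>, that is, sections over \<open>S\<close> of the pullback under \<open>\<iota>\<close> of the
  tangent bundle.  Fields are total functions; their values outside \<open>S\<close> are irrelevant.\<close>

definition field_along ::
  "('a::topological_space, 'e::euclidean_space) chart set \<Rightarrow>
   ('b::topological_space, 'f::euclidean_space) chart set \<Rightarrow> ('a \<Rightarrow> 'b) \<Rightarrow>
   'a set \<Rightarrow> ('a \<Rightarrow> 'b tangent) \<Rightarrow> bool" where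
  "field_along A B \<iota> S \<xi> \<longleftrightarrow> open S \<and> (\<forall>p\<in>S. \<xi> p \<in> tangent_space B (\<iota> p)) \<and>
     (\<forall>T h. smooth_fun_on B T h \<longrightarrow> smooth_fun_on A (S \<inter> \<iota> -` T) (\<lambda>p. \<xi> p h))"

definition vector_field ::
  "('a::topological_space, 'e::euclidean_space) chart set \<Rightarrow> 'a set \<Rightarrow>
   ('a \<Rightarrow> 'a tangent) \<Rightarrow> bool" where
  "vector_field A S X \<longleftrightarrow> field_along A A (\<lambda>p. p) S X"

definition lie_bracket ::
  "('a::topological_space, 'e::euclidean_space) chart set \<Rightarrow> ('a \<Rightarrow> 'a tangent) \<Rightarrow>
   ('a \<Rightarrow> 'a tangent) \<Rightarrow> 'a \<Rightarrow> 'a tangent" where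
  "lie_bracket A X Y p =
     (\<lambda>h. if smooth_near A p h then X p (\<lambda>q. Y q h) - Y p (\<lambda>q. X q h) else 0)"


section \<open>Connections\<close>

text \<open>\<open>D p v \<xi>\<close> is the derivative in direction \<open>v \<in> T\<^sub>pM\<close> of the field \<open>\<xi>\<close> along \<open>\<iota>\<close>, which has to be
  defined and smooth near \<open>p\<close> only.  Since the Leibniz rule is required for all functions
  \<open>h\<close> smooth near \<open>p\<close>, in particular for the indicator function of a neighbourhood of \<open>p\<close>,
  \<open>D p v \<xi>\<close> depends only on the germ of \<open>\<xi>\<close> at \<open>p\<close>.\<close>

type_synonym ('a, 'b) derivation_op =
  "'a \<Rightarrow> 'a tangent \<Rightarrow> ('a \<Rightarrow> 'b tangent) \<Rightarrow> 'b tangent"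

definition connection_along ::
  "('a::topological_space, 'e::euclidean_space) chart set \<Rightarrow>
   ('b::topological_space, 'f::euclidean_space) chart set \<Rightarrow> ('a \<Rightarrow> 'b) \<Rightarrow>
   ('a, 'b) derivation_op \<Rightarrow> bool" where
  "connection_along A B \<iota> D \<longleftrightarrow>
     (\<forall>S X \<xi>. vector_field A S X \<and> field_along A B \<iota> S \<xi> \<longrightarrow>
        field_along A B \<iota> S (\<lambda>p. D p (X p) \<xi>)) \<and>
     (\<forall>S \<xi>. field_along A B \<iota> S \<xi> \<longrightarrow>
        (\<forall>p\<in>S. \<forall>v\<in>tangent_space A p.
           D p v \<xi> \<in> tangent_space B (\<iota> p) \<and>
           (\<forall>w\<in>tangent_space A p. \<forall>a b. D p (a *\<^sub>R v + b *\<^sub>R w) \<xi> = a *\<^sub>R D p v \<xi> + b *\<^sub>R D p w \<xi>) \<and>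
           (\<forall>\<eta>. field_along A B \<iota> S \<eta> \<longrightarrow> D p v (\<xi> + \<eta>) = D p v \<xi> + D p v \<eta>) \<and>
           (\<forall>h. smooth_near A p h \<longrightarrow>
              D p v (\<lambda>q. h q *\<^sub>R \<xi> q) = v h *\<^sub>R \<xi> p + h p *\<^sub>R D p v \<xi>)))"

definition affine_connection ::
  "('a::topological_space, 'e::euclidean_space) chart set \<Rightarrow> ('a, 'a) derivation_op \<Rightarrow> bool" where
  "affine_connection A nabla \<longleftrightarrow> connection_along A A (\<lambda>p. p) nabla"

text \<open>The pullback under \<open>\<iota>\<close> of an affine connection \<open>nabla\<close> on the target is the unique
  connection along \<open>\<iota>\<close> that extends \<open>(v, Y \<circ> \<iota>) \<mapsto> nabla\<^bsub>d\<iota>(v)\<^esub> Y\<close>.  It is the meaning of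
  \<open>nabla\<^sub>X \<xi>\<close> for \<open>X\<close> tangent to a submanifold and \<open>\<xi>\<close> defined on the submanifold only.\<close>

definition pullback_connection ::
  "('a::topological_space, 'e::euclidean_space) chart set \<Rightarrow>
   ('b::topological_space, 'f::euclidean_space) chart set \<Rightarrow> ('a \<Rightarrow> 'b) \<Rightarrow>
   ('b, 'b) derivation_op \<Rightarrow> ('a, 'b) derivation_op \<Rightarrow> bool" where
  "pullback_connection A B \<iota> nabla D \<longleftrightarrow> connection_along A B \<iota> D \<and>
     (\<forall>T Y. vector_field B T Y \<longrightarrow>
        (\<forall>p v. \<iota> p \<in> T \<and> v \<in> tangent_space A p \<longrightarrow>
           D p v (Y \<circ> \<iota>) = nabla (\<iota> p) (push B \<iota> p v) Y))"

text \<open>Curvature \<open>D\<^sub>X D\<^sub>Y \<xi> - D\<^sub>Y D\<^sub>X \<xi> - D\<^bsub>[X,Y]\<^esub> \<xi>\<close>.\<close>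

definition curvature ::
  "('a::topological_space, 'e::euclidean_space) chart set \<Rightarrow> ('a, 'b) derivation_op \<Rightarrow>
   ('a \<Rightarrow> 'a tangent) \<Rightarrow> ('a \<Rightarrow> 'a tangent) \<Rightarrow> ('a \<Rightarrow> 'b tangent) \<Rightarrow> 'a \<Rightarrow> 'b tangent" where
  "curvature A D X Y \<xi> p =
     D p (X p) (\<lambda>q. D q (Y q) \<xi>) - D p (Y p) (\<lambda>q. D q (X q) \<xi>) - D p (lie_bracket A X Y p) \<xi>"


section \<open>Riemannian and Kaehlerian manifolds\<close>

type_synonym 'a metric_field = "'a \<Rightarrow> 'a tangent \<Rightarrow> 'a tangent \<Rightarrow> real"

definition riemannian_metric ::
  "('a::topological_space, 'e::euclidean_space) chart set \<Rightarrow> 'a metric_field \<Rightarrow> bool" where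
  "riemannian_metric A g \<longleftrightarrow>
     (\<forall>p. \<forall>u\<in>tangent_space A p. \<forall>v\<in>tangent_space A p.
        g p u v = g p v u \<and> (u \<noteq> 0 \<longrightarrow> g p u u > 0) \<and>
        (\<forall>w\<in>tangent_space A p. \<forall>a b. g p (a *\<^sub>R u + b *\<^sub>R v) w = a * g p u w + b * g p v w)) \<and>
     (\<forall>S X Y. vector_field A S X \<and> vector_field A S Y \<longrightarrow>
        smooth_fun_on A S (\<lambda>p. g p (X p) (Y p)))"

definition levi_civita ::
  "('a::topological_space, 'e::euclidean_space) chart set \<Rightarrow> 'a metric_field \<Rightarrow>
   ('a, 'a) derivation_op \<Rightarrow> bool" where
  "levi_civita A g nabla \<longleftrightarrow> affine_connection A nabla \<and>
     (\<forall>S X Y. vector_field A S X \<and> vector_field A S Y \<longrightarrow>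
        (\<forall>p\<in>S. nabla p (X p) Y - nabla p (Y p) X = lie_bracket A X Y p \<and>
           (\<forall>v\<in>tangent_space A p.
              v (\<lambda>q. g q (X q) (Y q)) = g p (nabla p v X) (Y p) + g p (X p) (nabla p v Y))))"

definition sectional_curvature ::
  "('a::topological_space, 'e::euclidean_space) chart set \<Rightarrow> 'a metric_field \<Rightarrow>
   ('a, 'a) derivation_op \<Rightarrow> ('a \<Rightarrow> 'a tangent) \<Rightarrow> ('a \<Rightarrow> 'a tangent) \<Rightarrow> 'a \<Rightarrow> real" where
  "sectional_curvature A g nabla X Y p =
     g p (curvature A nabla X Y Y p) (X p) /
     (g p (X p) (X p) * g p (Y p) (Y p) - (g p (X p) (Y p))\<^sup>2)"

definition constant_sectional_curvature ::
  "('a::topological_space, 'e::euclidean_space) chart set \<Rightarrow> 'a metric_field \<Rightarrow>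
   ('a, 'a) derivation_op \<Rightarrow> real \<Rightarrow> bool" where
  "constant_sectional_curvature A g nabla c \<longleftrightarrow>
     (\<forall>S X Y. vector_field A S X \<and> vector_field A S Y \<longrightarrow>
        (\<forall>p\<in>S. X p \<noteq> Y p \<and> independent {X p, Y p} \<longrightarrow> sectional_curvature A g nabla X Y p = c))"

type_synonym 'a endo_field = "'a \<Rightarrow> 'a tangent \<Rightarrow> 'a tangent"

definition almost_complex_structure ::
  "('a::topological_space, 'e::euclidean_space) chart set \<Rightarrow> 'a endo_field \<Rightarrow> bool" where
  "almost_complex_structure A J \<longleftrightarrow>
     (\<forall>p. \<forall>u\<in>tangent_space A p. J p u \<in> tangent_space A p \<and> J p (J p u) = - u \<and>
        (\<forall>v\<in>tangent_space A p. \<forall>a b. J p (a *\<^sub>R u + b *\<^sub>R v) = a *\<^sub>R J p u + b *\<^sub>R J p v)) \<and>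
     (\<forall>S X. vector_field A S X \<longrightarrow> vector_field A S (\<lambda>p. J p (X p)))"

text \<open>Coordinate vector of a tangent vector in a chart.\<close>

definition coords :: "('a \<Rightarrow> 'e::euclidean_space) \<Rightarrow> 'a tangent \<Rightarrow> 'e" where
  "coords \<phi> v = (\<Sum>b\<in>Basis. v (\<lambda>x. \<phi> x \<bullet> b) *\<^sub>R b)"

text \<open>\<open>J\<close> comes from a holomorphic atlas: near every point there is a chart that identifies \<open>J\<close> with
  a constant linear complex structure \<open>J0\<close> of the model space.  Transition maps between such charts
  are then holomorphic.\<close>

definition complex_structure ::
  "('a::topological_space, 'e::euclidean_space) chart set \<Rightarrow> 'a endo_field \<Rightarrow> bool" where
  "complex_structure A J \<longleftrightarrow> almost_complex_structure A J \<and>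
     (\<forall>p. \<exists>(U, \<phi>)\<in>maximal_atlas A. p \<in> U \<and>
        (\<exists>J0. linear J0 \<and> (\<forall>x. J0 (J0 x) = - x) \<and>
           (\<forall>q\<in>U. \<forall>v\<in>tangent_space A q. coords \<phi> (J q v) = J0 (coords \<phi> v))))"

definition kaehler_manifold ::
  "('a::{t2_space,second_countable_topology}, 'e::euclidean_space) chart set \<Rightarrow>
   'a metric_field \<Rightarrow> 'a endo_field \<Rightarrow> ('a, 'a) derivation_op \<Rightarrow> bool" where
  "kaehler_manifold A g J nabla \<longleftrightarrow>
     smooth_manifold A \<and> riemannian_metric A g \<and> complex_structure A J \<and>
     (\<forall>p. \<forall>u\<in>tangent_space A p. \<forall>v\<in>tangent_space A p. g p (J p u) (J p v) = g p u v) \<and>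
     levi_civita A g nabla \<and>
     (\<forall>S Y. vector_field A S Y \<longrightarrow>
        (\<forall>p\<in>S. \<forall>v\<in>tangent_space A p. nabla p v (\<lambda>q. J q (Y q)) = J p (nabla p v Y)))"


section \<open>Submanifolds\<close>

text \<open>A submanifold of the manifold with atlas \<open>B\<close> is given by an immersion \<open>\<iota>\<close> of a manifold with
  atlas \<open>A\<close>; inclusions of embedded submanifolds are a special case.  In this section \<open>g\<close>, \<open>J\<close>
  belong to the ambient manifold, \<open>nabla\<close> is the Levi-Civita connection of the submanifold and
  \<open>D\<close> the pullback of that of the ambient manifold.\<close>

definition immersion ::
  "('a::topological_space, 'e::euclidean_space) chart set \<Rightarrow>
   ('b::topological_space, 'f::euclidean_space) chart set \<Rightarrow> ('a \<Rightarrow> 'b) \<Rightarrow> bool" where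
  "immersion A B \<iota> \<longleftrightarrow> smooth_map_on A B UNIV \<iota> \<and> (\<forall>p. inj_on (push B \<iota> p) (tangent_space A p))"

definition induced_metric ::
  "('b::topological_space, 'f::euclidean_space) chart set \<Rightarrow> ('a \<Rightarrow> 'b) \<Rightarrow> 'b metric_field \<Rightarrow>
   'a metric_field" where
  "induced_metric B \<iota> g p v w = g (\<iota> p) (push B \<iota> p v) (push B \<iota> p w)"

definition normal_space ::
  "('a::topological_space, 'e::euclidean_space) chart set \<Rightarrow>
   ('b::topological_space, 'f::euclidean_space) chart set \<Rightarrow> ('a \<Rightarrow> 'b) \<Rightarrow> 'b metric_field \<Rightarrow>
   'a \<Rightarrow> 'b tangent set" where
  "normal_space A B \<iota> g p =
     {\<xi>\<in>tangent_space B (\<iota> p). \<forall>v\<in>tangent_space A p. g (\<iota> p) \<xi> (push B \<iota> p v) = 0}"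

definition normal_part ::
  "('a::topological_space, 'e::euclidean_space) chart set \<Rightarrow>
   ('b::topological_space, 'f::euclidean_space) chart set \<Rightarrow> ('a \<Rightarrow> 'b) \<Rightarrow> 'b metric_field \<Rightarrow>
   'a \<Rightarrow> 'b tangent \<Rightarrow> 'b tangent" where
  "normal_part A B \<iota> g p w =
     (THE \<xi>. \<xi> \<in> normal_space A B \<iota> g p \<and> w - \<xi> \<in> push B \<iota> p ` tangent_space A p)"

definition normal_field ::
  "('a::topological_space, 'e::euclidean_space) chart set \<Rightarrow>
   ('b::topological_space, 'f::euclidean_space) chart set \<Rightarrow> ('a \<Rightarrow> 'b) \<Rightarrow> 'b metric_field \<Rightarrow>
   'a set \<Rightarrow> ('a \<Rightarrow> 'b tangent) \<Rightarrow> bool" where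
  "normal_field A B \<iota> g S \<xi> \<longleftrightarrow>
     field_along A B \<iota> S \<xi> \<and> (\<forall>p\<in>S. \<xi> p \<in> normal_space A B \<iota> g p)"

definition normal_connection ::
  "('a::topological_space, 'e::euclidean_space) chart set \<Rightarrow>
   ('b::topological_space, 'f::euclidean_space) chart set \<Rightarrow> ('a \<Rightarrow> 'b) \<Rightarrow> 'b metric_field \<Rightarrow>
   ('a, 'b) derivation_op \<Rightarrow> ('a, 'b) derivation_op" where
  "normal_connection A B \<iota> g D p v \<xi> = normal_part A B \<iota> g p (D p v \<xi>)"

definition second_fundamental_form ::
  "('b::topological_space, 'f::euclidean_space) chart set \<Rightarrow> ('a \<Rightarrow> 'b) \<Rightarrow>
   ('a, 'a) derivation_op \<Rightarrow> ('a, 'b) derivation_op \<Rightarrow>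
   ('a \<Rightarrow> 'a tangent) \<Rightarrow> ('a \<Rightarrow> 'a tangent) \<Rightarrow> 'a \<Rightarrow> 'b tangent" where
  "second_fundamental_form B \<iota> nabla D X Y p =
     D p (X p) (\<lambda>q. push B \<iota> q (Y q)) - push B \<iota> p (nabla p (X p) Y)"

definition totally_geodesic ::
  "('a::topological_space, 'e::euclidean_space) chart set \<Rightarrow>
   ('b::topological_space, 'f::euclidean_space) chart set \<Rightarrow> ('a \<Rightarrow> 'b) \<Rightarrow>
   ('a, 'a) derivation_op \<Rightarrow> ('a, 'b) derivation_op \<Rightarrow> bool" where
  "totally_geodesic A B \<iota> nabla D \<longleftrightarrow>
     (\<forall>S X Y. vector_field A S X \<and> vector_field A S Y \<longrightarrow>
        (\<forall>p\<in>S. second_fundamental_form B \<iota> nabla D X Y p = 0))"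

definition totally_real ::
  "('a::topological_space, 'e::euclidean_space) chart set \<Rightarrow>
   ('b::topological_space, 'f::euclidean_space) chart set \<Rightarrow> ('a \<Rightarrow> 'b) \<Rightarrow> 'b metric_field \<Rightarrow>
   'b endo_field \<Rightarrow> bool" where
  "totally_real A B \<iota> g J \<longleftrightarrow>
     (\<forall>p. \<forall>v\<in>tangent_space A p. J (\<iota> p) (push B \<iota> p v) \<in> normal_space A B \<iota> g p)"

definition f_structure ::
  "('a::topological_space, 'e::euclidean_space) chart set \<Rightarrow>
   ('b::topological_space, 'f::euclidean_space) chart set \<Rightarrow> ('a \<Rightarrow> 'b) \<Rightarrow> 'b metric_field \<Rightarrow>
   'b endo_field \<Rightarrow> 'a \<Rightarrow> 'b tangent \<Rightarrow> 'b tangent" where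
  "f_structure A B \<iota> g J p \<xi> = normal_part A B \<iota> g p (J (\<iota> p) \<xi>)"

definition parallel_f_structure ::
  "('a::topological_space, 'e::euclidean_space) chart set \<Rightarrow>
   ('b::topological_space, 'f::euclidean_space) chart set \<Rightarrow> ('a \<Rightarrow> 'b) \<Rightarrow> 'b metric_field \<Rightarrow>
   'b endo_field \<Rightarrow> ('a, 'b) derivation_op \<Rightarrow> bool" where
  "parallel_f_structure A B \<iota> g J D \<longleftrightarrow>
     (\<forall>S X \<xi>. vector_field A S X \<and> normal_field A B \<iota> g S \<xi> \<longrightarrow>
        (\<forall>p\<in>S. normal_connection A B \<iota> g D p (X p) (\<lambda>q. f_structure A B \<iota> g J q (\<xi> q)) -
                f_structure A B \<iota> g J p (normal_connection A B \<iota> g D p (X p) \<xi>) = 0))"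

definition semiparallel ::
  "('a::topological_space, 'e::euclidean_space) chart set \<Rightarrow>
   ('b::topological_space, 'f::euclidean_space) chart set \<Rightarrow> ('a \<Rightarrow> 'b) \<Rightarrow> 'b metric_field \<Rightarrow>
   ('a, 'a) derivation_op \<Rightarrow> ('a, 'b) derivation_op \<Rightarrow> bool" where
  "semiparallel A B \<iota> g nabla D \<longleftrightarrow>
     (\<forall>S X Y Z U.
        vector_field A S X \<and> vector_field A S Y \<and> vector_field A S Z \<and> vector_field A S U \<longrightarrow>
        (\<forall>p\<in>S.
           curvature A (normal_connection A B \<iota> g D) X Y
             (second_fundamental_form B \<iota> nabla D Z U) p -
           second_fundamental_form B \<iota> nabla D (curvature A nabla X Y Z) U p -
           second_fundamental_form B \<iota> nabla D Z (curvature A nabla X Y U) p = 0))"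

end

theory Submission
  imports Defs
begin

text \<open>Since \<open>J\<close> is parallel, the normal part of \<open>D\<^sub>X (J Y)\<close> is \<open>J \<nabla>\<^sub>X Y + f \<sigma>(X, Y)\<close>.  As \<open>f (J Y) = 0\<close> and
  \<open>f\<close> is parallel, \<open>f\<^sup>2 \<sigma> = 0\<close>, and \<open>f \<sigma> = 0\<close> because \<open>f\<close> is skew.  Hence \<open>\<sigma> = J h\<close> for a tangential
  tensor \<open>h\<close>, the cubic form \<open>C(X, Y, Z) = \<langle>h(X, Y), Z\<rangle>\<close> is totally symmetric, and
  \<open>R\<^sup>\<bottom> (X, Y) J Z = J R(X, Y) Z\<close>, so that semiparallelism says that the curvature operators \<open>R(X, Y)\<close>
  act trivially on \<open>h\<close>.  For constant curvature \<open>c \<noteq> 0\<close> and orthogonal \<open>X, Y \<noteq> 0\<close> this gives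
  \<open>3 c |X|\<^sup>2 C(X, X, Y) = 0\<close> and \<open>|X|\<^sup>2 C(Y, Y, Y) = 2 |Y|\<^sup>2 C(X, X, Y)\<close>; hence \<open>C(Y, Y, Y) = 0\<close> for all
  \<open>Y\<close> and \<open>C = 0\<close>.  All identities are proved for vector fields on open sets, so that tensoriality of
  the curvature is not needed.\<close>

section \<open>Calculus of smooth maps\<close>

text \<open>The obstacle is that \<open>D\<close> is prescribed only on restrictions of ambient
  fields, whereas the argument differentiates fields living on the submanifold alone, such as
  \<open>push Y\<close>, \<open>J push Y\<close> and the second fundamental form. So the
  compatibility of \<open>D\<close> with \<open>J\<close> and with the metric, and its torsion
  identity, are first carried over from the ambient connection: locally every field along the
  immersion is a combination of restricted coordinate fields with smooth coefficients.

  Skewness of f is used thus: for \<open>n = f sigma\<close> one has |n|^2 = <J sigma, n> = -<sigma,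
  J n>, and J n is tangential once f n = 0.

  Curvature operators are applied to h(X, Y), so h has to yield smooth vector fields; orthogonal
  frames provide the smoothness.

  For orthogonal X, Y the operator R(X, Y) is an infinitesimal rotation, sending X to -c |X|^2 Y and
  Y to c |Y|^2 X. Letting it act on h(X, X) and h(Y, Y) and pairing with X gives the two relations.
  The factor 3 is 1 + 2: one from shifting R(X, Y) onto X by skewness, two from the derivation rule
  in two equal slots.\<close>

lemma frechet_derivative_cong_open:
  assumes "open S" "x \<in> S" "\<And>y. y \<in> S \<Longrightarrow> f y = g y"
  shows "frechet_derivative f (at x) = frechet_derivative g (at x)"
proof -
  have "(f has_derivative F) (at x) \<longleftrightarrow> (g has_derivative F) (at x)" for F
    using assms has_derivative_transform_within_open[of _ F x UNIV S] by (metis)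
  then show ?thesis by (simp add: frechet_derivative_def)
qed

lemma differentiable_cong_open:
  assumes "open S" "x \<in> S" "\<And>y. y \<in> S \<Longrightarrow> f y = g y"
  shows "f differentiable (at x) \<longleftrightarrow> g differentiable (at x)"
  unfolding differentiable_def
  using assms has_derivative_transform_within_open[of _ _ x UNIV S] by metis

lemma Ck_on_cong:
  assumes "open S" "\<And>x. x \<in> S \<Longrightarrow> f x = g x"
  shows "Ck_on k f S \<longleftrightarrow> Ck_on k g S"
  using assms(2)
proof (induction k arbitrary: f g)
  case 0
  then show ?case by (simp cong: continuous_on_cong)
next
  case (Suc k)
  have "Ck_on k (\<lambda>x. frechet_derivative f (at x) v) S \<longleftrightarrow> Ck_on k (\<lambda>x. frechet_derivative g (at x) v) S" for v
    by (rule Suc.IH) (use frechet_derivative_cong_open[OF assms(1) _ Suc.prems] in simp)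
  moreover have "f differentiable (at x) \<longleftrightarrow> g differentiable (at x)" if "x \<in> S" for x
    by (rule differentiable_cong_open[OF assms(1) that Suc.prems])
  ultimately show ?case by simp
qed

lemma Ck_on_transfer:
  assumes "Ck_on k g S" "open S" "\<And>x. x \<in> S \<Longrightarrow> f x = g x"
  shows "Ck_on k f S"
  using Ck_on_cong[of S f g k] assms by simp

lemma Ck_on_subset: "Ck_on k f S \<Longrightarrow> T \<subseteq> S \<Longrightarrow> Ck_on k f T"
  by (induction k arbitrary: f) (auto intro: continuous_on_subset)

text \<open>\<open>S\<close> may be arbitrary: derivatives in \<open>Ck_on\<close> are taken at
  \<open>x\<close> in the full space, so an open neighbourhood of each point decides everything,
  including continuity at level 0.\<close>

lemma Ck_on_local:
  assumes "\<And>x. x \<in> S \<Longrightarrow> \<exists>N. open N \<and> x \<in> N \<and> Ck_on k f N"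
  shows "Ck_on k f S"
  using assms
proof (induction k arbitrary: f)
  case 0
  then have "isCont f x" if "x \<in> S" for x
    using that by (meson Ck_on.simps(1) continuous_on_eq_continuous_at)
  then show ?case by (simp add: continuous_at_imp_continuous_on)
next
  case (Suc k)
  have "Ck_on k (\<lambda>x. frechet_derivative f (at x) v) S" for v
    by (rule Suc.IH) (use Suc.prems in force)
  with Suc.prems show ?case by force
qed

lemma Ck_on_lower: "Ck_on (Suc k) f S \<Longrightarrow> Ck_on k f S"
proof (induction k arbitrary: f)
  case 0
  then show ?case
    by (auto simp: continuous_at_imp_continuous_on differentiable_imp_continuous_within)
next
  case (Suc k)
  then show ?case by (metis Ck_on.simps(2))
qed

lemma Ck_on_const: "Ck_on k (\<lambda>x. c) S"
proof (induction k arbitrary: c)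
  case 0
  then show ?case by simp
next
  case (Suc k)
  then show ?case by simp
qed

lemma Ck_on_bounded_linear: "bounded_linear L \<Longrightarrow> Ck_on k L S"
proof (cases k)
  case 0
  assume "bounded_linear L" then show ?thesis by (simp add: 0 linear_continuous_on)
next
  case (Suc j)
  assume L: "bounded_linear L"
  have "frechet_derivative L (at x) = L" for x
    using L bounded_linear_imp_has_derivative frechet_derivative_at by metis
  then show ?thesis
    using L by (simp add: Suc Ck_on_const bounded_linear_imp_differentiable)
qed

lemma frechet_derivative_eqI:
  "(f has_derivative f') (at x) \<Longrightarrow> frechet_derivative f (at x) v = f' v"
  by (metis frechet_derivative_at)

lemma Ck_on_add:
  assumes "open S" "Ck_on k f S" "Ck_on k g S"
  shows "Ck_on k (\<lambda>x. f x + g x) S"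
  using assms(2,3)
proof (induction k arbitrary: f g)
  case 0
  then show ?case by (simp add: continuous_on_add)
next
  case (Suc k)
  have "Ck_on k (\<lambda>x. frechet_derivative (\<lambda>x. f x + g x) (at x) v) S" for v
  proof -
    have "Ck_on k (\<lambda>x. frechet_derivative f (at x) v + frechet_derivative g (at x) v) S"
      using Suc by auto
    moreover have "frechet_derivative (\<lambda>x. f x + g x) (at x) v
        = frechet_derivative f (at x) v + frechet_derivative g (at x) v" if "x \<in> S" for x
      using Suc.prems that
      by (intro frechet_derivative_eqI has_derivative_add)
         (auto simp: frechet_derivative_works[symmetric])
    ultimately show ?thesis by (rule Ck_on_transfer[OF _ assms(1)])
  qed
  then show ?case using Suc.prems by auto
qed

lemma Ck_on_scaleR:
  assumes "open S" "Ck_on k h S" "Ck_on k f S"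
  shows "Ck_on k (\<lambda>x. h x *\<^sub>R f x) S"
  using assms(2,3)
proof (induction k arbitrary: f h)
  case 0
  then show ?case by (simp add: continuous_on_scaleR)
next
  case (Suc k)
  have "Ck_on k (\<lambda>x. frechet_derivative (\<lambda>x. h x *\<^sub>R f x) (at x) v) S" for v
  proof -
    have "Ck_on k (\<lambda>x. h x *\<^sub>R frechet_derivative f (at x) v + frechet_derivative h (at x) v *\<^sub>R f x) S"
      using Suc.prems Suc.prems[THEN Ck_on_lower] by (intro Ck_on_add assms(1) Suc.IH) simp_all
    moreover have "frechet_derivative (\<lambda>x. h x *\<^sub>R f x) (at x) v
        = h x *\<^sub>R frechet_derivative f (at x) v + frechet_derivative h (at x) v *\<^sub>R f x" if "x \<in> S" for x
      using Suc.prems that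
      by (intro frechet_derivative_eqI has_derivative_scaleR)
         (auto simp: frechet_derivative_works[symmetric])
    ultimately show ?thesis by (rule Ck_on_transfer[OF _ assms(1)])
  qed
  then show ?case using Suc.prems by (auto intro!: differentiable_scaleR)
qed

lemma Ck_on_sum:
  assumes "open S" "\<And>i. i \<in> I \<Longrightarrow> Ck_on k (f i) S"
  shows "Ck_on k (\<lambda>x. \<Sum>i\<in>I. f i x) S"
  using assms(2)
  by (induction I rule: infinite_finite_induct) (auto simp: Ck_on_const Ck_on_add assms(1))

text \<open>The derivative of 1/h is -h'/h^2, which contains 1/h again; the induction supplies this
  factor one class lower.\<close>

lemma Ck_on_inverse:
  fixes h :: "'e::real_normed_vector \<Rightarrow> real"
  assumes "open S" "Ck_on k h S" "\<And>x. x \<in> S \<Longrightarrow> h x \<noteq> 0"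
  shows "Ck_on k (\<lambda>x. inverse (h x)) S"
  using assms(2)
proof (induction k)
  case 0
  then show ?case using assms(3) by (simp add: continuous_on_inverse)
next
  case (Suc k)
  have "Ck_on k (\<lambda>x. frechet_derivative (\<lambda>x. inverse (h x)) (at x) v) S" for v
  proof -
    have *: "Ck_on k (\<lambda>x. inverse (h x)) S"
      using Suc Ck_on_lower by blast
    have "Ck_on k (\<lambda>x. -1 *\<^sub>R (inverse (h x) *\<^sub>R frechet_derivative h (at x) v *\<^sub>R inverse (h x))) S"
      using Suc.prems * by (intro Ck_on_scaleR assms(1) Ck_on_const) auto
    moreover have "frechet_derivative (\<lambda>x. inverse (h x)) (at x) v
        = -1 *\<^sub>R (inverse (h x) *\<^sub>R frechet_derivative h (at x) v *\<^sub>R inverse (h x))" if "x \<in> S" for x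
    proof -
      have "(h has_derivative frechet_derivative h (at x)) (at x)"
        using Suc.prems that by (auto simp: frechet_derivative_works[symmetric])
      from Deriv.has_derivative_inverse[OF assms(3)[OF that] this]
      show ?thesis by (subst frechet_derivative_eqI) (auto simp: mult.assoc)
    qed
    ultimately show ?thesis by (rule Ck_on_transfer[OF _ assms(1)])
  qed
  then show ?case using Suc.prems assms(3) by (auto intro: differentiable_inverse)
qed

text \<open>\<open>Ck_on\<close> speaks of derivatives in a fixed direction, while the chain rule
  differentiates \<open>g\<close> in a direction that moves with \<open>x\<close>. Expanding that
  direction in \<open>Basis\<close> leaves fixed directions with variable coefficients, the form
  that the induction in \<open>Ck_on_compose\<close> can use.\<close>

lemma frechet_derivative_compose_sum:
  fixes f :: "'e::real_normed_vector \<Rightarrow> 'f::euclidean_space" and g :: "'f \<Rightarrow> 'g::real_normed_vector"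
  assumes "f differentiable (at x)" "g differentiable (at (f x))"
  shows "frechet_derivative (g \<circ> f) (at x) v
    = (\<Sum>b\<in>Basis. (frechet_derivative f (at x) v \<bullet> b) *\<^sub>R frechet_derivative g (at (f x)) b)"
proof -
  let ?y = "frechet_derivative f (at x) v"
  have lin: "linear (frechet_derivative g (at (f x)))"
    using assms(2) by (simp add: linear_frechet_derivative)
  have "frechet_derivative (g \<circ> f) (at x) v
      = frechet_derivative g (at (f x)) (\<Sum>b\<in>Basis. (?y \<bullet> b) *\<^sub>R b)"
    unfolding frechet_derivative_compose[OF assms] euclidean_representation by simp
  then show ?thesis
    by (simp only: linear_sum[OF lin] linear_scale[OF lin])
qed

lemma Ck_on_inner:
  fixes f :: "'e::real_normed_vector \<Rightarrow> 'f::euclidean_space"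
  assumes "open S" "Ck_on k f S"
  shows "Ck_on k (\<lambda>x. f x \<bullet> b) S"
  using assms(2)
proof (induction k arbitrary: f)
  case 0
  then show ?case by (simp add: continuous_on_inner)
next
  case (Suc k)
  have hd: "((\<lambda>x. f x \<bullet> b) has_derivative (\<lambda>w. frechet_derivative f (at x) w \<bullet> b)) (at x)"
    if "x \<in> S" for x
    by (rule has_derivative_inner_left)
       (use Suc.prems that in \<open>simp add: frechet_derivative_works[symmetric]\<close>)
  have "Ck_on k (\<lambda>x. frechet_derivative f (at x) w \<bullet> b) S" for w
    by (rule Suc.IH) (use Suc.prems in simp)
  then have "Ck_on k (\<lambda>x. frechet_derivative (\<lambda>x. f x \<bullet> b) (at x) w) S" for w
    by (rule Ck_on_transfer[OF _ assms(1)]) (rule frechet_derivative_eqI[OF hd])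
  then show ?case using hd unfolding Ck_on.simps differentiable_def by blast
qed

lemma Ck_on_compose:
  fixes f :: "'e::real_normed_vector \<Rightarrow> 'f::euclidean_space" and g :: "'f \<Rightarrow> 'g::real_normed_vector"
  assumes "open S" "Ck_on k f S" "Ck_on k g T" "f ` S \<subseteq> T"
  shows "Ck_on k (g \<circ> f) S"
  using assms(2,3)
proof (induction k arbitrary: g)
  case 0
  have "continuous_on (f ` S) g"
    using 0(2) assms(4) by (simp add: continuous_on_subset)
  then show ?case using 0(1) continuous_on_compose[of S f g] by simp
next
  case (Suc k)
  have diff: "f differentiable (at x)" "g differentiable (at (f x))" if "x \<in> S" for x
    using Suc.prems that assms(4) by (simp_all add: image_subset_iff)
  have "Ck_on k (\<lambda>x. frechet_derivative (g \<circ> f) (at x) v) S" for v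
  proof -
    have "Ck_on k (\<lambda>x. \<Sum>b\<in>Basis. (frechet_derivative f (at x) v \<bullet> b) *\<^sub>R frechet_derivative g (at (f x)) b) S"
    proof (rule Ck_on_sum[OF assms(1)], rule Ck_on_scaleR[OF assms(1)])
      fix b :: 'f
      have 1: "Ck_on k (\<lambda>x. frechet_derivative f (at x) v) S" using Suc.prems by simp
      show "Ck_on k (\<lambda>x. frechet_derivative f (at x) v \<bullet> b) S"
        by (rule Ck_on_inner[OF assms(1) 1])
      \<comment> \<open>The partial derivative of \<open>g\<close> has class \<open>k\<close>, so
        the induction hypothesis applies with it in place of \<open>g\<close>.\<close>
      have "Ck_on k ((\<lambda>y. frechet_derivative g (at y) b) \<circ> f) S"
        by (rule Suc.IH[OF Ck_on_lower[OF Suc.prems(1)]]) (use Suc.prems(2) in simp)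
      then show "Ck_on k (\<lambda>x. frechet_derivative g (at (f x)) b) S" unfolding o_def .
    qed
    then show ?thesis
      by (rule Ck_on_transfer[OF _ assms(1)]) (simp only: frechet_derivative_compose_sum[OF diff])
  qed
  then show ?case using differentiable_chain_at[OF diff] unfolding Ck_on.simps by blast
qed

lemma smooth_on_subset: "smooth_on S f \<Longrightarrow> T \<subseteq> S \<Longrightarrow> smooth_on T f"
  unfolding smooth_on_def using Ck_on_subset by blast

lemma smooth_on_cong: "open S \<Longrightarrow> (\<And>x. x \<in> S \<Longrightarrow> f x = g x) \<Longrightarrow> smooth_on S f \<longleftrightarrow> smooth_on S g"
  by (simp add: smooth_on_def Ck_on_cong[of S f g])

lemma smooth_on_local:
  assumes "\<And>x. x \<in> S \<Longrightarrow> \<exists>N. open N \<and> x \<in> N \<and> smooth_on N f"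
  shows "smooth_on S f"
  unfolding smooth_on_def
proof (intro allI Ck_on_local)
  fix k x
  assume "x \<in> S"
  then show "\<exists>N. open N \<and> x \<in> N \<and> Ck_on k f N"
    using assms[of x] by (auto simp: smooth_on_def)
qed

lemma smooth_on_const: "smooth_on S (\<lambda>x. c)"
  by (simp add: smooth_on_def Ck_on_const)

lemma smooth_on_bounded_linear: "bounded_linear L \<Longrightarrow> smooth_on S L"
  by (simp add: smooth_on_def Ck_on_bounded_linear)

lemma smooth_on_add: "open S \<Longrightarrow> smooth_on S f \<Longrightarrow> smooth_on S g \<Longrightarrow> smooth_on S (\<lambda>x. f x + g x)"
  by (simp add: smooth_on_def Ck_on_add)

lemma smooth_on_scaleR:
  "open S \<Longrightarrow> smooth_on S h \<Longrightarrow> smooth_on S f \<Longrightarrow> smooth_on S (\<lambda>x. h x *\<^sub>R f x)"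
  by (simp add: smooth_on_def Ck_on_scaleR)

lemma smooth_on_inverse:
  fixes h :: "'e::real_normed_vector \<Rightarrow> real"
  shows "open S \<Longrightarrow> smooth_on S h \<Longrightarrow> (\<And>x. x \<in> S \<Longrightarrow> h x \<noteq> 0) \<Longrightarrow> smooth_on S (\<lambda>x. inverse (h x))"
  by (simp add: smooth_on_def Ck_on_inverse)

lemma smooth_on_compose:
  fixes f :: "'e::real_normed_vector \<Rightarrow> 'f::euclidean_space" and g :: "'f \<Rightarrow> 'g::real_normed_vector"
  shows "open S \<Longrightarrow> smooth_on S f \<Longrightarrow> smooth_on T g \<Longrightarrow> f ` S \<subseteq> T \<Longrightarrow> smooth_on S (g \<circ> f)"
  by (simp add: smooth_on_def Ck_on_compose[of S _ f g T])

lemma smooth_on_derivative: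
  "smooth_on S f \<Longrightarrow> smooth_on S (\<lambda>x. frechet_derivative f (at x) v)"
  unfolding smooth_on_def
proof
  fix k
  assume "\<forall>k. Ck_on k f S"
  then have "Ck_on (Suc k) f S" ..
  then show "Ck_on k (\<lambda>x. frechet_derivative f (at x) v) S" by simp
qed

lemma smooth_on_imp_differentiable: "smooth_on S f \<Longrightarrow> x \<in> S \<Longrightarrow> f differentiable (at x)"
  unfolding smooth_on_def by (metis Ck_on.simps(2))

lemma smooth_on_imp_continuous_on: "smooth_on S f \<Longrightarrow> continuous_on S f"
  unfolding smooth_on_def by (metis Ck_on.simps(1))

section \<open>Smooth functions on manifolds\<close>

lemma frechet_derivative_add:
  assumes "f differentiable (at x)" "g differentiable (at x)"
  shows "frechet_derivative (\<lambda>x. f x + g x) (at x) v = frechet_derivative f (at x) v + frechet_derivative g (at x) v"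
  using assms by (intro frechet_derivative_eqI has_derivative_add) (simp_all add: frechet_derivative_works[symmetric])

lemma frechet_derivative_mult:
  fixes f g :: "'e::real_normed_vector \<Rightarrow> real"
  assumes "f differentiable (at x)" "g differentiable (at x)"
  shows "frechet_derivative (\<lambda>x. f x * g x) (at x) v = f x * frechet_derivative g (at x) v + frechet_derivative f (at x) v * g x"
  using assms by (intro frechet_derivative_eqI has_derivative_mult) (simp_all add: frechet_derivative_works[symmetric])

locale smooth_mfd =
  fixes A :: "('a::{t2_space,second_countable_topology}, 'e::euclidean_space) chart set"
  assumes mfd: "smooth_manifold A"
begin

lemma chart_props:
  assumes "(U, \<phi>) \<in> A"
  shows "open U" "open (\<phi> ` U)" "homeomorphism U (\<phi> ` U) \<phi> (inv_into U \<phi>)"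
    and "p \<in> U \<Longrightarrow> inv_into U \<phi> (\<phi> p) = p"
proof -
  have "is_chart (U, \<phi>)" using mfd assms by (auto simp: smooth_manifold_def)
  then show "open U" "open (\<phi> ` U)" "homeomorphism U (\<phi> ` U) \<phi> (inv_into U \<phi>)"
    by (auto simp: is_chart_def)
  then show "p \<in> U \<Longrightarrow> inv_into U \<phi> (\<phi> p) = p" by (simp add: homeomorphism_def)
qed

lemma chart_at: obtains U \<phi> where "(U, \<phi>) \<in> A" "p \<in> U"
proof -
  have "p \<in> (\<Union>c\<in>A. fst c)" using mfd by (simp add: smooth_manifold_def)
  then show ?thesis using that by force
qed

lemma open_chart_image:
  assumes "(U, \<phi>) \<in> A" "open W"
  shows "open (\<phi> ` (W \<inter> U))"
proof -
  have "openin (top_of_set (\<phi> ` U)) (\<phi> ` (W \<inter> U))"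
    using homeomorphism_imp_open_map[OF chart_props(3)[OF assms(1)]] assms(2)
      chart_props(1)[OF assms(1)] by (simp add: openin_open_eq open_Int)
  then show ?thesis using chart_props(2)[OF assms(1)] by (simp add: openin_open_eq)
qed

lemma chart_change:
  assumes "(U, \<phi>) \<in> A" "(V, \<psi>) \<in> A"
  shows "smooth_on (\<psi> ` (U \<inter> V)) (\<phi> \<circ> inv_into V \<psi>)"
proof -
  have "compatible (U, \<phi>) (V, \<psi>)" using mfd assms by (auto simp: smooth_manifold_def)
  then show ?thesis by (simp add: compatible_def)
qed

lemma smooth_fun_on_chart:
  assumes "smooth_fun_on A S h" "(U, \<phi>) \<in> A"
  shows "smooth_on (\<phi> ` (S \<inter> U)) (h \<circ> inv_into U \<phi>)"
  using assms by (auto simp: smooth_fun_on_def smooth_map_on_def std_atlas_def o_def)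

lemma smooth_fun_on_open: "smooth_fun_on A S h \<Longrightarrow> open S"
  by (simp add: smooth_fun_on_def smooth_map_on_def)

text \<open>Continuity is built into \<open>smooth_map_on\<close>. For real functions it follows
  from the chart expressions, since on a chart domain the function is its chart expression composed
  with the chart.\<close>

lemma smooth_fun_onI:
  assumes "open S"
    and "\<And>U \<phi>. (U, \<phi>) \<in> A \<Longrightarrow> smooth_on (\<phi> ` (S \<inter> U)) (h \<circ> inv_into U \<phi>)"
  shows "smooth_fun_on A S h"
proof -
  have "isCont h p" if "p \<in> S" for p
  proof -
    obtain U \<phi> where c: "(U, \<phi>) \<in> A" "p \<in> U" by (rule chart_at)
    note cp = chart_props[OF c(1)]
    have "continuous_on (\<phi> ` (S \<inter> U)) (h \<circ> inv_into U \<phi>)"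
      by (rule smooth_on_imp_continuous_on[OF assms(2)[OF c(1)]])
    moreover have "continuous_on (S \<inter> U) \<phi>"
      using cp(3) by (auto simp: homeomorphism_def intro: continuous_on_subset)
    ultimately have "continuous_on (S \<inter> U) ((h \<circ> inv_into U \<phi>) \<circ> \<phi>)"
      by (rule continuous_on_compose[rotated])
    then have "continuous_on (S \<inter> U) h"
      by (rule continuous_on_eq) (simp add: cp(4))
    then show ?thesis
      using c that assms(1) cp(1) by (simp add: continuous_on_eq_continuous_at open_Int)
  qed
  then have "continuous_on S h" by (simp add: continuous_at_imp_continuous_on)
  then show ?thesis
    using assms by (auto simp: smooth_fun_on_def smooth_map_on_def std_atlas_def o_def)
qed

lemma smooth_fun_on_subset:
  assumes "smooth_fun_on A S h" "open T" "T \<subseteq> S"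
  shows "smooth_fun_on A T h"
proof (rule smooth_fun_onI[OF assms(2)])
  fix U \<phi> assume "(U, \<phi>) \<in> A"
  from smooth_fun_on_chart[OF assms(1) this]
  show "smooth_on (\<phi> ` (T \<inter> U)) (h \<circ> inv_into U \<phi>)"
    by (rule smooth_on_subset) (use assms(3) in auto)
qed

lemma smooth_fun_on_cong:
  assumes "smooth_fun_on A S f" "\<And>p. p \<in> S \<Longrightarrow> f p = h p"
  shows "smooth_fun_on A S h"
proof (rule smooth_fun_onI)
  show "open S" using assms(1) by (rule smooth_fun_on_open)
  fix U \<phi> assume c: "(U, \<phi>) \<in> A"
  have "f (inv_into U \<phi> x) = h (inv_into U \<phi> x)" if "x \<in> \<phi> ` (S \<inter> U)" for x
    using that assms(2) chart_props(4)[OF c] by auto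
  then show "smooth_on (\<phi> ` (S \<inter> U)) (h \<circ> inv_into U \<phi>)"
    using smooth_fun_on_chart[OF assms(1) c]
      smooth_on_cong[OF open_chart_image[OF c \<open>open S\<close>], of "f \<circ> inv_into U \<phi>" "h \<circ> inv_into U \<phi>"]
    by simp
qed

lemma smooth_fun_on_local:
  assumes "open S" "\<And>p. p \<in> S \<Longrightarrow> \<exists>N. p \<in> N \<and> smooth_fun_on A N h"
  shows "smooth_fun_on A S h"
proof (rule smooth_fun_onI[OF assms(1)], rule smooth_on_local)
  fix U \<phi> x assume c: "(U, \<phi>) \<in> A" and "x \<in> \<phi> ` (S \<inter> U)"
  then obtain p where p: "p \<in> S" "p \<in> U" "x = \<phi> p" by auto
  obtain N where "p \<in> N" and N: "smooth_fun_on A N h" using assms(2) p by auto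
  then show "\<exists>N. open N \<and> x \<in> N \<and> smooth_on N (h \<circ> inv_into U \<phi>)"
    using smooth_fun_on_chart[OF N c] open_chart_image[OF c smooth_fun_on_open[OF N]] p
    by (intro exI[of _ "\<phi> ` (N \<inter> U)"]) auto
qed

lemma smooth_fun_on_const: "open S \<Longrightarrow> smooth_fun_on A S (\<lambda>p. c)"
  by (rule smooth_fun_onI) (simp_all add: o_def smooth_on_const)

lemma smooth_fun_on_add:
  assumes "smooth_fun_on A S f" "smooth_fun_on A S h"
  shows "smooth_fun_on A S (\<lambda>p. f p + h p)"
proof (rule smooth_fun_onI)
  show "open S" using assms(1) by (rule smooth_fun_on_open)
  fix U \<phi> assume c: "(U, \<phi>) \<in> A"
  show "smooth_on (\<phi> ` (S \<inter> U)) ((\<lambda>p. f p + h p) \<circ> inv_into U \<phi>)"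
    using smooth_on_add[OF open_chart_image[OF c \<open>open S\<close>] assms[THEN smooth_fun_on_chart, OF c]]
    by (simp add: o_def)
qed

lemma smooth_fun_on_mult:
  assumes "smooth_fun_on A S f" "smooth_fun_on A S h"
  shows "smooth_fun_on A S (\<lambda>p. f p * h p)"
proof (rule smooth_fun_onI)
  show "open S" using assms(1) by (rule smooth_fun_on_open)
  fix U \<phi> assume c: "(U, \<phi>) \<in> A"
  show "smooth_on (\<phi> ` (S \<inter> U)) ((\<lambda>p. f p * h p) \<circ> inv_into U \<phi>)"
    using smooth_on_scaleR[OF open_chart_image[OF c \<open>open S\<close>] assms[THEN smooth_fun_on_chart, OF c]]
    by (simp add: o_def)
qed

lemma smooth_fun_on_divide:
  assumes "smooth_fun_on A S f" "smooth_fun_on A S h" "\<And>p. p \<in> S \<Longrightarrow> h p \<noteq> 0"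
  shows "smooth_fun_on A S (\<lambda>p. f p / h p)"
proof -
  have "smooth_fun_on A S (\<lambda>p. inverse (h p))"
  proof (rule smooth_fun_onI)
    show "open S" using assms(1) by (rule smooth_fun_on_open)
    fix U \<phi> assume c: "(U, \<phi>) \<in> A"
    have "(h \<circ> inv_into U \<phi>) x \<noteq> 0" if "x \<in> \<phi> ` (S \<inter> U)" for x
      using that assms(3) chart_props(4)[OF c] by auto
    from smooth_on_inverse[OF open_chart_image[OF c \<open>open S\<close>] smooth_fun_on_chart[OF assms(2) c] this]
    show "smooth_on (\<phi> ` (S \<inter> U)) ((\<lambda>p. inverse (h p)) \<circ> inv_into U \<phi>)"
      by (simp add: o_def)
  qed
  from smooth_fun_on_mult[OF assms(1) this] show ?thesis by (simp add: divide_inverse)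
qed

lemma smooth_fun_on_coord:
  assumes "(U, \<phi>) \<in> A"
  shows "smooth_fun_on A U (\<lambda>q. \<phi> q \<bullet> b)"
proof (rule smooth_fun_onI)
  show "open U" using assms by (rule chart_props)
  fix V \<psi> assume c: "(V, \<psi>) \<in> A"
  have "smooth_on (\<psi> ` (U \<inter> V)) ((\<lambda>x. x \<bullet> b) \<circ> (\<phi> \<circ> inv_into V \<psi>))"
    by (rule smooth_on_compose[OF open_chart_image[OF c \<open>open U\<close>] chart_change[OF assms c]
        smooth_on_bounded_linear[OF bounded_linear_inner_left] subset_UNIV])
  then show "smooth_on (\<psi> ` (U \<inter> V)) ((\<lambda>q. \<phi> q \<bullet> b) \<circ> inv_into V \<psi>)" by (simp add: o_def)
qed

text \<open>These partial derivatives are what coordinate vector fields yield on \<open>h\<close>.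
  In another chart they are precomposed with the transition map.\<close>

lemma smooth_fun_on_chart_derivative:
  assumes "(U, \<phi>) \<in> A" "smooth_fun_on A T h"
  shows "smooth_fun_on A (T \<inter> U) (\<lambda>q. frechet_derivative (h \<circ> inv_into U \<phi>) (at (\<phi> q)) b)"
proof (rule smooth_fun_onI)
  show o: "open (T \<inter> U)"
    using smooth_fun_on_open[OF assms(2)] chart_props(1)[OF assms(1)] by (rule open_Int)
  let ?d = "\<lambda>x. frechet_derivative (h \<circ> inv_into U \<phi>) (at x) b"
  fix V \<psi> assume c: "(V, \<psi>) \<in> A"
  have "smooth_on (\<phi> ` (T \<inter> U)) ?d"
    by (rule smooth_on_derivative[OF smooth_fun_on_chart[OF assms(2,1)]])
  moreover have "smooth_on (\<psi> ` (T \<inter> U \<inter> V)) (\<phi> \<circ> inv_into V \<psi>)"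
    by (rule smooth_on_subset[OF chart_change[OF assms(1) c]]) auto
  moreover have "(\<phi> \<circ> inv_into V \<psi>) ` (\<psi> ` (T \<inter> U \<inter> V)) \<subseteq> \<phi> ` (T \<inter> U)"
    using chart_props(4)[OF c] by auto
  ultimately have "smooth_on (\<psi> ` (T \<inter> U \<inter> V)) (?d \<circ> (\<phi> \<circ> inv_into V \<psi>))"
    by (intro smooth_on_compose[where T = "\<phi> ` (T \<inter> U)"] open_chart_image[OF c o])
  then show "smooth_on (\<psi> ` (T \<inter> U \<inter> V)) ((\<lambda>q. ?d (\<phi> q)) \<circ> inv_into V \<psi>)"
    by (simp add: o_def)
qed

section \<open>Germs of smooth functions at a point\<close>

lemma smooth_nearI: "smooth_fun_on A S h \<Longrightarrow> p \<in> S \<Longrightarrow> smooth_near A p h"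
  by (auto simp: smooth_near_def)

lemma smooth_near_binop:
  assumes "smooth_near A p f" "smooth_near A p h"
  obtains S where "p \<in> S" "smooth_fun_on A S f" "smooth_fun_on A S h"
proof -
  obtain S where S: "p \<in> S" "smooth_fun_on A S f" using assms(1) unfolding smooth_near_def by blast
  obtain T where T: "p \<in> T" "smooth_fun_on A T h" using assms(2) unfolding smooth_near_def by blast
  have o: "open (S \<inter> T)" using S(2) T(2) smooth_fun_on_open by (simp add: open_Int)
  show ?thesis
    by (rule that[of "S \<inter> T"]) (use S T o in \<open>simp_all add: smooth_fun_on_subset[OF S(2) o] smooth_fun_on_subset[OF T(2) o]\<close>)
qed

lemma smooth_near_add: "smooth_near A p f \<Longrightarrow> smooth_near A p h \<Longrightarrow> smooth_near A p (\<lambda>q. f q + h q)"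
  by (erule (1) smooth_near_binop) (erule (1) smooth_nearI[OF smooth_fun_on_add])

lemma smooth_near_mult: "smooth_near A p f \<Longrightarrow> smooth_near A p h \<Longrightarrow> smooth_near A p (\<lambda>q. f q * h q)"
  by (erule (1) smooth_near_binop) (erule (1) smooth_nearI[OF smooth_fun_on_mult])

lemma smooth_near_const: "smooth_near A p (\<lambda>q. c)"
  using smooth_fun_on_const[OF open_UNIV] smooth_nearI by blast

lemma smooth_near_cong1:
  assumes "open N" "p \<in> N" "\<And>q. q \<in> N \<Longrightarrow> f q = h q" "smooth_near A p f"
  shows "smooth_near A p h"
proof -
  obtain S where S: "p \<in> S" "smooth_fun_on A S f" using assms(4) by (auto simp: smooth_near_def)
  have "smooth_fun_on A (S \<inter> N) f"
    using S(2) assms(1) smooth_fun_on_open[OF S(2)] by (intro smooth_fun_on_subset[OF S(2)]) auto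
  then have "smooth_fun_on A (S \<inter> N) h"
    by (rule smooth_fun_on_cong) (use assms(3) in auto)
  then show ?thesis using S assms(2) by (auto intro: smooth_nearI)
qed

lemma smooth_near_cong:
  assumes "open N" "p \<in> N" "\<And>q. q \<in> N \<Longrightarrow> f q = h q"
  shows "smooth_near A p f \<longleftrightarrow> smooth_near A p h"
  using smooth_near_cong1[OF assms(1,2), of f h] smooth_near_cong1[OF assms(1,2), of h f] assms(3)
  by auto

lemma smooth_near_differentiable:
  assumes "smooth_near A p h" "(U, \<phi>) \<in> A" "p \<in> U"
  shows "(h \<circ> inv_into U \<phi>) differentiable (at (\<phi> p))"
proof -
  obtain S where S: "p \<in> S" "smooth_fun_on A S h" using assms(1) by (auto simp: smooth_near_def)
  show ?thesis
    by (rule smooth_on_imp_differentiable[OF smooth_fun_on_chart[OF S(2) assms(2)]]) (use S assms in auto)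
qed

section \<open>Tangent vectors\<close>

text \<open>The image of the model vector \<open>w\<close> under the inverse of the chart
  differential. The convention 0 off functions smooth near \<open>p\<close> is that of
  \<open>velocity\<close>, so that the two can be equal as functions.\<close>

definition chart_vec :: "'a set \<Rightarrow> ('a \<Rightarrow> 'e) \<Rightarrow> 'a \<Rightarrow> 'e \<Rightarrow> 'a tangent" where
  "chart_vec U \<phi> p w = (\<lambda>h. if smooth_near A p h
     then frechet_derivative (h \<circ> inv_into U \<phi>) (at (\<phi> p)) w else 0)"

text \<open>On \<open>I\<close> the function \<open>h \<circ> \<gamma>\<close> is the chart
  expression of \<open>h\<close> after the coordinate curve, so by the chain rule only the
  coordinate velocity at 0 counts.\<close>

lemma velocity_eq_chart_vec:
  assumes c: "(U, \<phi>) \<in> A" "p \<in> U" and \<gamma>: "\<gamma> 0 = p" "open I" "0 \<in> I" "\<gamma> ` I \<subseteq> U"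
    and der: "((\<phi> \<circ> \<gamma>) has_vector_derivative w) (at 0)"
  shows "velocity A \<gamma> = chart_vec U \<phi> p w"
proof (rule ext)
  fix h
  show "velocity A \<gamma> h = chart_vec U \<phi> p w h"
  proof (cases "smooth_near A p h")
    case True
    let ?H = "frechet_derivative (h \<circ> inv_into U \<phi>) (at (\<phi> p))"
    have H: "((h \<circ> inv_into U \<phi>) has_derivative ?H) (at ((\<phi> \<circ> \<gamma>) 0))"
      using smooth_near_differentiable[OF True c] \<gamma>(1) by (simp add: frechet_derivative_works)
    have "((h \<circ> inv_into U \<phi>) \<circ> (\<phi> \<circ> \<gamma>) has_derivative ?H \<circ> (\<lambda>t. t *\<^sub>R w)) (at 0)"
      by (rule diff_chain_at[OF der[unfolded has_vector_derivative_def] H])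
    then have "((h \<circ> \<gamma>) has_derivative ?H \<circ> (\<lambda>t. t *\<^sub>R w)) (at 0)"
      by (rule has_derivative_transform_within_open[OF _ \<gamma>(2,3)])
         (use \<gamma>(4) chart_props(4)[OF c(1)] in auto)
    moreover have "?H \<circ> (\<lambda>t. t *\<^sub>R w) = (*) (?H w)"
      using linear_scale[OF has_derivative_linear[OF H]] by (auto simp: fun_eq_iff)
    ultimately have "(h \<circ> \<gamma> has_real_derivative ?H w) (at 0)"
      by (simp add: has_field_derivative_def)
    from DERIV_imp_deriv[OF this] show ?thesis
      using True \<gamma>(1) by (simp add: velocity_def chart_vec_def)
  next
    case False
    then show ?thesis using \<gamma>(1) by (simp add: velocity_def chart_vec_def)
  qed
qed

lemma inv_into_UNIV_id: "inv_into UNIV (\<lambda>x. x) = (\<lambda>x. x)"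
  by (simp add: inv_into_def)

lemma velocity_in_range:
  assumes c: "(U, \<phi>) \<in> A" "p \<in> U"
    and \<gamma>: "\<gamma> 0 = p" "\<epsilon> > 0" "smooth_map_on std_atlas A {-\<epsilon><..<\<epsilon>} \<gamma>"
  shows "velocity A \<gamma> \<in> range (chart_vec U \<phi> p)"
proof -
  let ?I = "{-\<epsilon><..<\<epsilon>} \<inter> \<gamma> -` U"
  have "open ?I"
    using \<gamma>(3) chart_props(1)[OF c(1)]
    by (auto simp: smooth_map_on_def intro: continuous_open_preimage)
  moreover have "0 \<in> ?I" using \<gamma> c by auto
  moreover have "smooth_on ?I (\<phi> \<circ> \<gamma>)"
    using \<gamma>(3) c(1) by (auto simp: smooth_map_on_def std_atlas_def inv_into_UNIV_id o_def)
  then have "(\<phi> \<circ> \<gamma>) differentiable (at 0)"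
    by (rule smooth_on_imp_differentiable) fact
  then have "((\<phi> \<circ> \<gamma>) has_vector_derivative vector_derivative (\<phi> \<circ> \<gamma>) (at 0)) (at 0)"
    by (simp add: vector_derivative_works)
  ultimately have "velocity A \<gamma> = chart_vec U \<phi> p (vector_derivative (\<phi> \<circ> \<gamma>) (at 0))"
    by (intro velocity_eq_chart_vec[OF c, of \<gamma> ?I] \<gamma>(1)) auto
  then show ?thesis by blast
qed

lemma chart_vec_in_tangent_space:
  assumes c: "(U, \<phi>) \<in> A" "p \<in> U"
  shows "chart_vec U \<phi> p w \<in> tangent_space A p"
proof -
  note cp = chart_props[OF c(1)]
  \<comment> \<open>The realizing curve is a straight line in the chart, restricted below to a
    parameter interval on which it stays in the chart image.\<close>
  define l where "l = (\<lambda>t::real. \<phi> p + t *\<^sub>R w)"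
  define \<gamma> where "\<gamma> = inv_into U \<phi> \<circ> l"
  have contl: "continuous_on J l" for J by (auto simp: l_def intro!: continuous_intros)
  have "open (l -` (\<phi> ` U))" using cp(2) contl[of UNIV] by (simp add: continuous_open_vimage continuous_on_eq_continuous_at)
  moreover have "0 \<in> l -` (\<phi> ` U)" using c by (simp add: l_def)
  ultimately obtain \<epsilon> where \<epsilon>: "\<epsilon> > 0" "ball 0 \<epsilon> \<subseteq> l -` (\<phi> ` U)"
    unfolding open_contains_ball by blast
  have ball: "ball 0 \<epsilon> = {-\<epsilon><..<\<epsilon>}" by (auto simp: dist_real_def)
  have lU: "l t \<in> \<phi> ` U" if "t \<in> {-\<epsilon><..<\<epsilon>}" for t using \<epsilon>(2) that ball by auto
  have \<gamma>0: "\<gamma> 0 = p" using c cp(4) by (simp add: \<gamma>_def l_def)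
  have \<gamma>U: "\<gamma> t \<in> U" "\<phi> (\<gamma> t) = l t" if "t \<in> {-\<epsilon><..<\<epsilon>}" for t
    using lU[OF that] cp(4) by (auto simp: \<gamma>_def)
  have cont: "continuous_on {-\<epsilon><..<\<epsilon>} \<gamma>"
    unfolding \<gamma>_def
    by (rule continuous_on_compose[OF contl], rule continuous_on_subset[where s = "\<phi> ` U"])
       (use cp(3) lU in \<open>auto simp: homeomorphism_def\<close>)
  \<comment> \<open>In another chart the curve is the transition map after the line.\<close>
  have "smooth_on ({-\<epsilon><..<\<epsilon>} \<inter> \<gamma> -` V) (\<psi> \<circ> \<gamma>)" if V: "(V, \<psi>) \<in> A" for V \<psi>
  proof -
    have "smooth_on UNIV l"
      unfolding l_def
      by (intro smooth_on_add smooth_on_scaleR open_UNIV smooth_on_const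
          smooth_on_bounded_linear[OF bounded_linear_ident])
    then have "smooth_on ({-\<epsilon><..<\<epsilon>} \<inter> \<gamma> -` V) l" by (rule smooth_on_subset) simp
    moreover have "open ({-\<epsilon><..<\<epsilon>} \<inter> \<gamma> -` V)"
      using cont chart_props(1)[OF V] by (intro continuous_open_preimage) auto
    moreover have "l ` ({-\<epsilon><..<\<epsilon>} \<inter> \<gamma> -` V) \<subseteq> \<phi> ` (V \<inter> U)"
    proof
      fix x assume "x \<in> l ` ({-\<epsilon><..<\<epsilon>} \<inter> \<gamma> -` V)"
      then obtain t where "t \<in> {-\<epsilon><..<\<epsilon>}" "\<gamma> t \<in> V" "x = l t" by blast
      then show "x \<in> \<phi> ` (V \<inter> U)" using \<gamma>U[of t] by (auto intro!: image_eqI[of _ _ "\<gamma> t"])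
    qed
    ultimately have "smooth_on ({-\<epsilon><..<\<epsilon>} \<inter> \<gamma> -` V) ((\<psi> \<circ> inv_into U \<phi>) \<circ> l)"
      by (intro smooth_on_compose[OF _ _ chart_change[OF V c(1)]])
    then show ?thesis by (simp add: \<gamma>_def o_assoc)
  qed
  then have "smooth_map_on std_atlas A {-\<epsilon><..<\<epsilon>} \<gamma>"
    using cont by (auto simp: smooth_map_on_def std_atlas_def inv_into_UNIV_id o_def)
  moreover have "velocity A \<gamma> = chart_vec U \<phi> p w"
  proof (rule velocity_eq_chart_vec[OF c, of \<gamma> "{-\<epsilon><..<\<epsilon>}"])
    have "(l has_vector_derivative w) (at 0)"
      unfolding l_def by (auto intro!: derivative_eq_intros)
    then show "((\<phi> \<circ> \<gamma>) has_vector_derivative w) (at 0)"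
      by (rule has_vector_derivative_transform_within_open[of _ _ _ "{-\<epsilon><..<\<epsilon>}"])
         (use \<epsilon>(1) \<gamma>U in auto)
  qed (use \<epsilon> \<gamma>U \<gamma>0 in auto)
  ultimately show ?thesis
    using \<gamma>0 \<epsilon>(1) by (auto simp: tangent_space_def intro!: exI[of _ \<gamma>])
qed

text \<open>Curves in a manifold cannot be added, so the set of velocities is not visibly a vector
  space. Its linear structure is read off from the model space by this equation.\<close>

lemma tangent_space_eq:
  assumes "(U, \<phi>) \<in> A" "p \<in> U"
  shows "tangent_space A p = range (chart_vec U \<phi> p)"
  using velocity_in_range[OF assms] chart_vec_in_tangent_space[OF assms]
  by (auto simp: tangent_space_def)

lemma chart_vec_lincomb:
  assumes "(U, \<phi>) \<in> A" "p \<in> U"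
  shows "chart_vec U \<phi> p (a *\<^sub>R v + b *\<^sub>R w) = a *\<^sub>R chart_vec U \<phi> p v + b *\<^sub>R chart_vec U \<phi> p w"
proof (rule ext)
  fix h
  have "linear (frechet_derivative (h \<circ> inv_into U \<phi>) (at (\<phi> p)))" if "smooth_near A p h"
    using smooth_near_differentiable[OF that assms] by (rule linear_frechet_derivative)
  then show "chart_vec U \<phi> p (a *\<^sub>R v + b *\<^sub>R w) h = (a *\<^sub>R chart_vec U \<phi> p v + b *\<^sub>R chart_vec U \<phi> p w) h"
    by (simp add: chart_vec_def scaleR_fun_def linear_add linear_scale)
qed

lemma chart_vec_coord:
  assumes "(U, \<phi>) \<in> A" "p \<in> U"
  shows "chart_vec U \<phi> p w (\<lambda>q. \<phi> q \<bullet> b) = w \<bullet> b"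
proof -
  have "((\<lambda>x. x \<bullet> b) has_derivative (\<lambda>x. x \<bullet> b)) (at (\<phi> p))"
    by (rule bounded_linear_imp_has_derivative[OF bounded_linear_inner_left])
  then have "((\<lambda>q. \<phi> q \<bullet> b) \<circ> inv_into U \<phi> has_derivative (\<lambda>x. x \<bullet> b)) (at (\<phi> p))"
    by (rule has_derivative_transform_within_open[OF _ chart_props(2)[OF assms(1)]])
       (use assms(2) chart_props(4)[OF assms(1)] in auto)
  from frechet_derivative_eqI[OF this] show ?thesis
    using smooth_nearI[OF smooth_fun_on_coord[OF assms(1)] assms(2)] by (simp add: chart_vec_def)
qed

lemma tangent_lincomb:
  assumes "v \<in> tangent_space A p" "w \<in> tangent_space A p"
  shows "a *\<^sub>R v + b *\<^sub>R w \<in> tangent_space A p"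
proof -
  obtain U \<phi> where c: "(U, \<phi>) \<in> A" "p \<in> U" by (rule chart_at)
  show ?thesis
    using assms chart_vec_lincomb[OF c, symmetric] unfolding tangent_space_eq[OF c] by force
qed

lemma tangent_subspace: "subspace (tangent_space A p)"
proof -
  obtain U \<phi> where c: "(U, \<phi>) \<in> A" "p \<in> U" by (rule chart_at)
  have ex: "\<exists>v. v \<in> tangent_space A p" unfolding tangent_space_eq[OF c] by blast
  show ?thesis
  proof (rule subspaceI)
    show "0 \<in> tangent_space A p" using ex tangent_lincomb[of _ _ _ 0 0] by force
    show "v + w \<in> tangent_space A p" if "v \<in> tangent_space A p" "w \<in> tangent_space A p" for v w
      using tangent_lincomb[OF that, of 1 1] by simp
    show "a *\<^sub>R v \<in> tangent_space A p" if "v \<in> tangent_space A p" for v a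
      using tangent_lincomb[OF that that, of a 0] by simp
  qed
qed

lemmas tangent_add = subspace_add[OF tangent_subspace]
lemmas tangent_diff = subspace_diff[OF tangent_subspace]
lemmas tangent_scale = subspace_scale[OF tangent_subspace]
lemmas tangent_neg = subspace_neg[OF tangent_subspace]
lemmas tangent_0 = subspace_0[OF tangent_subspace]

section \<open>Tangent vectors as derivations of germs\<close>

lemma tangent_fun_add:
  assumes "v \<in> tangent_space A p" "smooth_near A p f" "smooth_near A p h"
  shows "v (\<lambda>q. f q + h q) = v f + v h"
proof -
  obtain U \<phi> where c: "(U, \<phi>) \<in> A" "p \<in> U" by (rule chart_at)
  then obtain w where v: "v = chart_vec U \<phi> p w" using assms(1) tangent_space_eq by blast
  note frechet_derivative_add[OF assms(2,3)[THEN smooth_near_differentiable, OF c], of w]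
  then show ?thesis using smooth_near_add[OF assms(2,3)] assms(2,3) by (simp add: v chart_vec_def o_def)
qed

lemma tangent_fun_mult:
  assumes "v \<in> tangent_space A p" "smooth_near A p f" "smooth_near A p h"
  shows "v (\<lambda>q. f q * h q) = v f * h p + f p * v h"
proof -
  obtain U \<phi> where c: "(U, \<phi>) \<in> A" "p \<in> U" by (rule chart_at)
  then obtain w where v: "v = chart_vec U \<phi> p w" using assms(1) tangent_space_eq by blast
  note frechet_derivative_mult[OF assms(2,3)[THEN smooth_near_differentiable, OF c], of w]
  then show ?thesis using smooth_near_mult[OF assms(2,3)] assms(2,3) chart_props(4)[OF c]
    by (simp add: v chart_vec_def o_def)
qed

text \<open>Valid for arbitrary \<open>f\<close> and \<open>h\<close>: smoothness near
  \<open>p\<close> is itself local, so the convention 0 applies to both functions or to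
  neither.\<close>

lemma tangent_fun_cong:
  assumes "v \<in> tangent_space A p" "open N" "p \<in> N" "\<And>q. q \<in> N \<Longrightarrow> f q = h q"
  shows "v f = v h"
proof -
  obtain U \<phi> where c: "(U, \<phi>) \<in> A" "p \<in> U" by (rule chart_at)
  then obtain w where v: "v = chart_vec U \<phi> p w" using assms(1) tangent_space_eq by blast
  have "frechet_derivative (f \<circ> inv_into U \<phi>) (at (\<phi> p)) = frechet_derivative (h \<circ> inv_into U \<phi>) (at (\<phi> p))"
    by (rule frechet_derivative_cong_open[OF open_chart_image[OF c(1) assms(2)]])
       (use assms(3,4) c chart_props(4)[OF c(1)] in auto)
  then show ?thesis using smooth_near_cong[OF assms(2-4)] by (simp add: v chart_vec_def)
qed

lemma tangent_fun_const:
  assumes "v \<in> tangent_space A p"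
  shows "v (\<lambda>q. c) = 0"
proof -
  obtain U \<phi> where c: "(U, \<phi>) \<in> A" "p \<in> U" by (rule chart_at)
  then obtain w where v: "v = chart_vec U \<phi> p w" using assms(1) tangent_space_eq by blast
  then show ?thesis by (simp add: chart_vec_def o_def)
qed

lemma chart_vec_linear:
  assumes "(U, \<phi>) \<in> A" "p \<in> U"
  shows "linear (chart_vec U \<phi> p)"
  using chart_vec_lincomb[OF assms, of 1 _ 1] chart_vec_lincomb[OF assms, of _ _ 0]
  by (intro linearI) simp_all

text \<open>By \<open>chart_vec_coord\<close> the coordinate functions recover the model vector, so
  a tangent vector is determined by its values on them.\<close>

lemma tangent_chart_expansion:
  assumes c: "(U, \<phi>) \<in> A" "p \<in> U" and v: "v \<in> tangent_space A p"
  shows "v = (\<Sum>b\<in>Basis. v (\<lambda>q. \<phi> q \<bullet> b) *\<^sub>R chart_vec U \<phi> p b)"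
proof -
  obtain w where w: "v = chart_vec U \<phi> p w" using v tangent_space_eq[OF c] by blast
  note lin = chart_vec_linear[OF c]
  have "chart_vec U \<phi> p (\<Sum>b\<in>Basis. (w \<bullet> b) *\<^sub>R b) = (\<Sum>b\<in>Basis. (w \<bullet> b) *\<^sub>R chart_vec U \<phi> p b)"
    by (simp only: linear_sum[OF lin] linear_scale[OF lin])
  then show ?thesis unfolding w chart_vec_coord[OF c] euclidean_representation .
qed

lemma chart_vector_field:
  assumes "(U, \<phi>) \<in> A"
  shows "vector_field A U (\<lambda>q. chart_vec U \<phi> q w)"
proof -
  have "smooth_fun_on A (U \<inter> (\<lambda>p. p) -` T) (\<lambda>p. chart_vec U \<phi> p w h)"
    if h: "smooth_fun_on A T h" for T h
  proof -
    have "smooth_fun_on A (T \<inter> U) (\<lambda>p. chart_vec U \<phi> p w h)"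
      by (rule smooth_fun_on_cong[OF smooth_fun_on_chart_derivative[OF assms h]])
         (simp add: chart_vec_def smooth_nearI[OF h])
    moreover have "U \<inter> (\<lambda>p. p) -` T = T \<inter> U" by auto
    ultimately show ?thesis by simp
  qed
  then show ?thesis
    unfolding vector_field_def field_along_def
    using chart_props(1)[OF assms] chart_vec_in_tangent_space[OF assms] by blast
qed

text \<open>Vector fields and affine connections are fields and connections along the identity. One
  theory of fields along a map thus serves the submanifold, the ambient manifold and the
  immersion.\<close>

lemma smooth_map_id: "smooth_map_on A A UNIV (\<lambda>p. p)"
proof -
  have "smooth_on (\<phi> ` (UNIV \<inter> U \<inter> (\<lambda>p. p) -` V)) (\<psi> \<circ> (\<lambda>p. p) \<circ> inv_into U \<phi>)"
    if "(U, \<phi>) \<in> A" "(V, \<psi>) \<in> A" for U \<phi> V \<psi>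
    using chart_change[OF that(2,1)] by (simp add: o_def Int_commute)
  then show ?thesis unfolding smooth_map_on_def by auto
qed

end

section \<open>Vector fields along a smooth map\<close>

locale smooth_mfd_map = A: smooth_mfd A + B: smooth_mfd B
  for A :: "('a::{t2_space,second_countable_topology}, 'e::euclidean_space) chart set"
    and B :: "('b::{t2_space,second_countable_topology}, 'f::euclidean_space) chart set" +
  fixes \<iota> :: "'a \<Rightarrow> 'b"
  assumes map: "smooth_map_on A B UNIV \<iota>"
begin

lemma open_vimage_map: "open T \<Longrightarrow> open (\<iota> -` T)"
  using map unfolding smooth_map_on_def
  by (metis continuous_on_open_vimage open_UNIV Int_UNIV_right)

lemma map_chart:
  assumes "(U, \<phi>) \<in> A" "(V, \<psi>) \<in> B"
  shows "smooth_on (\<phi> ` (U \<inter> \<iota> -` V)) (\<psi> \<circ> \<iota> \<circ> inv_into U \<phi>)"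
proof -
  have "\<forall>(U, \<phi>)\<in>A. \<forall>(V, \<psi>)\<in>B. smooth_on (\<phi> ` (U \<inter> \<iota> -` V)) (\<psi> \<circ> \<iota> \<circ> inv_into U \<phi>)"
    using map by (simp add: smooth_map_on_def)
  from bspec[OF this assms(1)] have "\<forall>(V, \<psi>)\<in>B. smooth_on (\<phi> ` (U \<inter> \<iota> -` V)) (\<psi> \<circ> \<iota> \<circ> inv_into U \<phi>)" by simp
  from bspec[OF this assms(2)] show ?thesis by simp
qed

lemma smooth_fun_on_compose:
  assumes h: "smooth_fun_on B T h"
  shows "smooth_fun_on A (\<iota> -` T) (h \<circ> \<iota>)"
proof (rule A.smooth_fun_onI)
  show oT: "open (\<iota> -` T)" by (rule open_vimage_map[OF B.smooth_fun_on_open[OF h]])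
  fix U \<phi> assume c: "(U, \<phi>) \<in> A"
  show "smooth_on (\<phi> ` (\<iota> -` T \<inter> U)) ((h \<circ> \<iota>) \<circ> inv_into U \<phi>)"
  proof (rule smooth_on_local)
    fix x assume "x \<in> \<phi> ` (\<iota> -` T \<inter> U)"
    then obtain p where p: "\<iota> p \<in> T" "p \<in> U" "x = \<phi> p" by auto
    obtain V \<psi> where d: "(V, \<psi>) \<in> B" "\<iota> p \<in> V" by (rule B.chart_at)
    let ?W = "\<iota> -` (T \<inter> V)"
    let ?N = "\<phi> ` (?W \<inter> U)"
    have oN: "open ?N"
      by (rule A.open_chart_image[OF c open_vimage_map])
         (use B.smooth_fun_on_open[OF h] B.chart_props(1)[OF d(1)] in auto)
    have "smooth_on ?N (\<psi> \<circ> \<iota> \<circ> inv_into U \<phi>)"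
      by (rule smooth_on_subset[OF map_chart[OF c d(1)]]) auto
    moreover have "(\<psi> \<circ> \<iota> \<circ> inv_into U \<phi>) ` ?N \<subseteq> \<psi> ` (T \<inter> V)"
      using A.chart_props(4)[OF c] by auto
    ultimately have "smooth_on ?N ((h \<circ> inv_into V \<psi>) \<circ> (\<psi> \<circ> \<iota> \<circ> inv_into U \<phi>))"
      by (intro smooth_on_compose[OF oN _ B.smooth_fun_on_chart[OF h d(1)]])
    moreover have "((h \<circ> inv_into V \<psi>) \<circ> (\<psi> \<circ> \<iota> \<circ> inv_into U \<phi>)) y = ((h \<circ> \<iota>) \<circ> inv_into U \<phi>) y"
      if "y \<in> ?N" for y
      using that A.chart_props(4)[OF c] B.chart_props(4)[OF d(1)] by auto
    ultimately have "smooth_on ?N ((h \<circ> \<iota>) \<circ> inv_into U \<phi>)"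
      using smooth_on_cong[OF oN, of "(h \<circ> inv_into V \<psi>) \<circ> (\<psi> \<circ> \<iota> \<circ> inv_into U \<phi>)" "(h \<circ> \<iota>) \<circ> inv_into U \<phi>"]
      by simp
    then show "\<exists>N. open N \<and> x \<in> N \<and> smooth_on N ((h \<circ> \<iota>) \<circ> inv_into U \<phi>)"
      using oN p d(2) by (intro exI[of _ ?N]) auto
  qed
qed

lemma smooth_near_compose: "smooth_near B (\<iota> p) h \<Longrightarrow> smooth_near A p (h \<circ> \<iota>)"
  using smooth_fun_on_compose unfolding smooth_near_def by (metis vimageI)

text \<open>By the chain rule, the push-forward of \<open>chart_vec\<close> of \<open>w\<close> is
  \<open>chart_vec\<close> of the derivative of the coordinate expression of \<open>\<iota>\<close>
  in direction \<open>w\<close>.\<close>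

lemma push_tangent:
  assumes v: "v \<in> tangent_space A p"
  shows "push B \<iota> p v \<in> tangent_space B (\<iota> p)"
proof -
  obtain U \<phi> where c: "(U, \<phi>) \<in> A" "p \<in> U" by (rule A.chart_at)
  obtain V \<psi> where d: "(V, \<psi>) \<in> B" "\<iota> p \<in> V" by (rule B.chart_at)
  obtain w where w: "v = A.chart_vec U \<phi> p w" using v A.tangent_space_eq[OF c] by blast
  let ?F = "\<psi> \<circ> \<iota> \<circ> inv_into U \<phi>"
  have F: "?F differentiable (at (\<phi> p))"
    by (rule smooth_on_imp_differentiable[OF map_chart[OF c(1) d(1)]]) (use c d in auto)
  have Fp: "?F (\<phi> p) = \<psi> (\<iota> p)" using A.chart_props(4)[OF c] by simp
  have oN: "open (\<phi> ` (\<iota> -` V \<inter> U))"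
    by (rule A.open_chart_image[OF c(1) open_vimage_map[OF B.chart_props(1)[OF d(1)]]])
  have "push B \<iota> p v = B.chart_vec V \<psi> (\<iota> p) (frechet_derivative ?F (at (\<phi> p)) w)"
  proof (rule ext)
    fix h
    show "push B \<iota> p v h = B.chart_vec V \<psi> (\<iota> p) (frechet_derivative ?F (at (\<phi> p)) w) h"
    proof (cases "smooth_near B (\<iota> p) h")
      case True
      have "frechet_derivative ((h \<circ> \<iota>) \<circ> inv_into U \<phi>) (at (\<phi> p))
          = frechet_derivative ((h \<circ> inv_into V \<psi>) \<circ> ?F) (at (\<phi> p))"
        by (rule frechet_derivative_cong_open[OF oN])
           (use c d A.chart_props(4)[OF c(1)] B.chart_props(4)[OF d(1)] in auto)
      also have "\<dots> = frechet_derivative (h \<circ> inv_into V \<psi>) (at (\<psi> (\<iota> p))) \<circ> frechet_derivative ?F (at (\<phi> p))"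
        using frechet_derivative_compose[OF F, of "h \<circ> inv_into V \<psi>"]
          B.smooth_near_differentiable[OF True d] by (simp only: Fp)
      finally show ?thesis
        using True smooth_near_compose[OF True]
        by (simp add: push_def w A.chart_vec_def B.chart_vec_def)
    next
      case False
      then show ?thesis by (simp add: push_def B.chart_vec_def)
    qed
  qed
  then show ?thesis using B.chart_vec_in_tangent_space[OF d] by simp
qed

lemma push_lincomb: "push B \<iota> p (a *\<^sub>R v + b *\<^sub>R w) = a *\<^sub>R push B \<iota> p v + b *\<^sub>R push B \<iota> p w"
  by (rule ext) (simp add: push_def scaleR_fun_def)

lemma push_linear: "linear (push B \<iota> p)"
  using push_lincomb[of p 1 _ 1] push_lincomb[of p _ _ 0]
  by (intro linearI) simp_all

abbreviation field :: "'a set \<Rightarrow> ('a \<Rightarrow> 'b tangent) \<Rightarrow> bool" where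
  "field \<equiv> field_along A B \<iota>"

lemma field_open: "field S \<xi> \<Longrightarrow> open S"
  by (simp add: field_along_def)

lemma field_tangent: "field S \<xi> \<Longrightarrow> p \<in> S \<Longrightarrow> \<xi> p \<in> tangent_space B (\<iota> p)"
  by (simp add: field_along_def)

lemma field_smooth:
  "field S \<xi> \<Longrightarrow> smooth_fun_on B T h \<Longrightarrow> smooth_fun_on A (S \<inter> \<iota> -` T) (\<lambda>p. \<xi> p h)"
  by (simp add: field_along_def)

lemma fieldI:
  assumes "open S" "\<And>p. p \<in> S \<Longrightarrow> \<xi> p \<in> tangent_space B (\<iota> p)"
    "\<And>T h. smooth_fun_on B T h \<Longrightarrow> smooth_fun_on A (S \<inter> \<iota> -` T) (\<lambda>p. \<xi> p h)"
  shows "field S \<xi>"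
  using assms by (simp add: field_along_def)

lemma field_dom_open: "open S \<Longrightarrow> smooth_fun_on B T h \<Longrightarrow> open (S \<inter> \<iota> -` T)"
  using open_vimage_map B.smooth_fun_on_open by (simp add: open_Int)

lemma field_subset:
  assumes "field S \<xi>" "open T" "T \<subseteq> S"
  shows "field T \<xi>"
proof (rule fieldI[OF assms(2)])
  show "\<xi> p \<in> tangent_space B (\<iota> p)" if "p \<in> T" for p using field_tangent assms that by blast
  show "smooth_fun_on A (T \<inter> \<iota> -` W) (\<lambda>p. \<xi> p h)" if "smooth_fun_on B W h" for W h
    by (rule A.smooth_fun_on_subset[OF field_smooth[OF assms(1) that] field_dom_open[OF assms(2) that]])
       (use assms(3) in auto)
qed

lemma field_cong:
  assumes "field S \<xi>" "\<And>p. p \<in> S \<Longrightarrow> \<xi> p = \<eta> p"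
  shows "field S \<eta>"
proof (rule fieldI[OF field_open[OF assms(1)]])
  show "\<eta> p \<in> tangent_space B (\<iota> p)" if "p \<in> S" for p
    using field_tangent[OF assms(1) that] assms(2)[OF that] by simp
  show "smooth_fun_on A (S \<inter> \<iota> -` W) (\<lambda>p. \<eta> p h)" if "smooth_fun_on B W h" for W h
    by (rule A.smooth_fun_on_cong[OF field_smooth[OF assms(1) that]]) (use assms(2) in auto)
qed

lemma field_add:
  assumes "field S \<xi>" "field S \<eta>"
  shows "field S (\<lambda>p. \<xi> p + \<eta> p)"
proof (rule fieldI[OF field_open[OF assms(1)]])
  show "\<xi> p + \<eta> p \<in> tangent_space B (\<iota> p)" if "p \<in> S" for p
    using assms[THEN field_tangent, OF that] by (rule B.tangent_add)
  show "smooth_fun_on A (S \<inter> \<iota> -` W) (\<lambda>p. (\<xi> p + \<eta> p) h)" if "smooth_fun_on B W h" for W h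
    using A.smooth_fun_on_add[OF assms[THEN field_smooth, OF that]] by simp
qed

lemma field_scale:
  assumes "smooth_fun_on A S f" "field S \<xi>"
  shows "field S (\<lambda>p. f p *\<^sub>R \<xi> p)"
proof (rule fieldI[OF field_open[OF assms(2)]])
  show "f p *\<^sub>R \<xi> p \<in> tangent_space B (\<iota> p)" if "p \<in> S" for p
    using field_tangent[OF assms(2) that] by (rule B.tangent_scale)
  show "smooth_fun_on A (S \<inter> \<iota> -` W) (\<lambda>p. (f p *\<^sub>R \<xi> p) h)" if "smooth_fun_on B W h" for W h
    using A.smooth_fun_on_mult[OF A.smooth_fun_on_subset[OF assms(1)
        field_dom_open[OF field_open[OF assms(2)] that] Int_lower1] field_smooth[OF assms(2) that]]
    by (simp add: scaleR_fun_def)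
qed

lemma field_cscale: "field S \<xi> \<Longrightarrow> field S (\<lambda>p. c *\<^sub>R \<xi> p)"
  using field_scale[OF A.smooth_fun_on_const] field_open by blast

lemma field_neg: "field S \<xi> \<Longrightarrow> field S (\<lambda>p. - \<xi> p)"
  using field_cscale[of S \<xi> "-1"] by simp

lemma field_diff: "field S \<xi> \<Longrightarrow> field S \<eta> \<Longrightarrow> field S (\<lambda>p. \<xi> p - \<eta> p)"
  using field_add[OF _ field_neg] by simp

lemma field_zero: "open S \<Longrightarrow> field S (\<lambda>p. 0)"
  by (rule fieldI) (simp_all add: B.tangent_0 A.smooth_fun_on_const field_dom_open)

lemma field_sum:
  assumes "open S" "\<And>i. i \<in> I \<Longrightarrow> field S (\<xi> i)"
  shows "field S (\<lambda>p. \<Sum>i\<in>I. \<xi> i p)"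
  using assms(2) by (induction I rule: infinite_finite_induct) (simp_all add: field_zero field_add assms(1))

lemma field_compose:
  assumes "vector_field B T Y"
  shows "field (\<iota> -` T) (\<lambda>q. Y (\<iota> q))"
proof (rule fieldI)
  show "open (\<iota> -` T)" using assms by (simp add: vector_field_def field_along_def open_vimage_map)
  show "Y (\<iota> p) \<in> tangent_space B (\<iota> p)" if "p \<in> \<iota> -` T" for p
    using assms that by (simp add: vector_field_def field_along_def)
  fix W h assume "smooth_fun_on B W h"
  then have "smooth_fun_on B (T \<inter> W) (\<lambda>p. Y p h)"
    using assms by (simp add: vector_field_def field_along_def)
  from smooth_fun_on_compose[OF this]
  show "smooth_fun_on A (\<iota> -` T \<inter> \<iota> -` W) (\<lambda>p. Y (\<iota> p) h)" by (simp add: o_def)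
qed

lemma push_field:
  assumes "vector_field A S Y"
  shows "field S (\<lambda>q. push B \<iota> q (Y q))"
proof (rule fieldI)
  show "open S" using assms by (simp add: vector_field_def field_along_def)
  show "push B \<iota> p (Y p) \<in> tangent_space B (\<iota> p)" if "p \<in> S" for p
    using assms that push_tangent by (simp add: vector_field_def field_along_def)
  fix T h assume h: "smooth_fun_on B T h"
  have "smooth_fun_on A (S \<inter> \<iota> -` T) (\<lambda>p. Y p (h \<circ> \<iota>))"
    using assms smooth_fun_on_compose[OF h] by (simp add: vector_field_def field_along_def)
  then show "smooth_fun_on A (S \<inter> \<iota> -` T) (\<lambda>p. push B \<iota> p (Y p) h)"
    by (rule A.smooth_fun_on_cong) (use B.smooth_nearI[OF h] in \<open>simp add: push_def\<close>)
qed

lemma chart_field_along: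
  assumes "(V, \<psi>) \<in> B" "open S" "\<iota> ` S \<subseteq> V"
  shows "field S (\<lambda>q. B.chart_vec V \<psi> (\<iota> q) b)"
  by (rule field_subset[OF field_compose[OF B.chart_vector_field[OF assms(1)]] assms(2)])
     (use assms(3) in auto)

text \<open>If \<open>S\<close> is mapped into one chart domain of \<open>B\<close>, the restricted
  coordinate fields form a frame and all fields are combinations of them with smooth coefficients.
  The rule \<open>cong\<close> absorbs that this expansion holds on \<open>S\<close> only.\<close>

lemma field_induct:
  assumes V: "(V, \<psi>) \<in> B" "\<iota> ` S \<subseteq> V" and \<xi>: "field S \<xi>"
    and cong: "\<And>\<xi> \<eta>. field S \<xi> \<Longrightarrow> P \<xi> \<Longrightarrow> (\<And>q. q \<in> S \<Longrightarrow> \<xi> q = \<eta> q) \<Longrightarrow> P \<eta>"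
    and zero: "P (\<lambda>q. 0)"
    and frame: "\<And>b. b \<in> Basis \<Longrightarrow> P (\<lambda>q. B.chart_vec V \<psi> (\<iota> q) b)"
    and scale: "\<And>f \<xi>. smooth_fun_on A S f \<Longrightarrow> field S \<xi> \<Longrightarrow> P \<xi> \<Longrightarrow> P (\<lambda>q. f q *\<^sub>R \<xi> q)"
    and add: "\<And>\<xi> \<eta>. field S \<xi> \<Longrightarrow> field S \<eta> \<Longrightarrow> P \<xi> \<Longrightarrow> P \<eta> \<Longrightarrow> P (\<lambda>q. \<xi> q + \<eta> q)"
  shows "P \<xi>"
proof -
  note oS = field_open[OF \<xi>]
  let ?e = "\<lambda>b q. \<xi> q (\<lambda>x. \<psi> x \<bullet> b) *\<^sub>R B.chart_vec V \<psi> (\<iota> q) b"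
  have "S \<inter> \<iota> -` V = S" using V(2) by auto
  then have sm: "smooth_fun_on A S (\<lambda>q. \<xi> q (\<lambda>x. \<psi> x \<bullet> b))" for b
    using field_smooth[OF \<xi> B.smooth_fun_on_coord[OF V(1)]] by metis
  have e: "field S (?e b)" "b \<in> Basis \<Longrightarrow> P (?e b)" for b
    using field_scale[OF sm chart_field_along[OF V(1) oS V(2)]]
      scale[OF sm chart_field_along[OF V(1) oS V(2)] frame] by blast+
  have "P (\<lambda>q. \<Sum>b\<in>I. ?e b q)" if "finite I" "I \<subseteq> Basis" for I
    using that
  proof (induction I rule: finite_induct)
    case empty
    show ?case unfolding sum.empty by (rule zero)
  next
    case (insert b I)
    then have "P (\<lambda>q. ?e b q + (\<Sum>b\<in>I. ?e b q))"
      by (intro add e field_sum[OF oS]) auto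
    then show ?case unfolding sum.insert[OF insert.hyps(1,2)] .
  qed
  then have "P (\<lambda>q. \<Sum>b\<in>Basis. ?e b q)" by simp
  moreover have "(\<Sum>b\<in>Basis. ?e b q) = \<xi> q" if "q \<in> S" for q
    using B.tangent_chart_expansion[OF V(1) _ field_tangent[OF \<xi> that]] V(2) that by auto
  ultimately show ?thesis
    by (rule cong[OF field_sum[OF oS e(1)]])
qed

end

section \<open>Connections along a map\<close>

locale connection = smooth_mfd_map A B \<iota>
  for A :: "('a::{t2_space,second_countable_topology}, 'e::euclidean_space) chart set"
    and B :: "('b::{t2_space,second_countable_topology}, 'f::euclidean_space) chart set"
    and \<iota> :: "'a \<Rightarrow> 'b" +
  fixes D :: "('a, 'b) derivation_op"
  assumes conn: "connection_along A B \<iota> D"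
begin

lemma conn_field: "vector_field A S X \<Longrightarrow> field S \<xi> \<Longrightarrow> field S (\<lambda>p. D p (X p) \<xi>)"
  using conn by (simp add: connection_along_def)

lemma conn_props:
  assumes "field S \<xi>" "p \<in> S" "v \<in> tangent_space A p"
  shows conn_tangent: "D p v \<xi> \<in> tangent_space B (\<iota> p)"
    and conn_vec_lincomb: "w \<in> tangent_space A p \<Longrightarrow> D p (a *\<^sub>R v + b *\<^sub>R w) \<xi> = a *\<^sub>R D p v \<xi> + b *\<^sub>R D p w \<xi>"
    and conn_plus: "field S \<eta> \<Longrightarrow> D p v (\<xi> + \<eta>) = D p v \<xi> + D p v \<eta>"
    and conn_scale_near: "smooth_near A p h \<Longrightarrow> D p v (\<lambda>q. h q *\<^sub>R \<xi> q) = v h *\<^sub>R \<xi> p + h p *\<^sub>R D p v \<xi>"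
  using conn assms unfolding connection_along_def by blast+

lemma conn_add:
  assumes "field S \<xi>" "field S \<eta>" "p \<in> S" "v \<in> tangent_space A p"
  shows "D p v (\<lambda>q. \<xi> q + \<eta> q) = D p v \<xi> + D p v \<eta>"
  using conn_plus[OF assms(1,3,4,2)] by (simp add: plus_fun_def)

lemma conn_scale:
  assumes "field S \<xi>" "smooth_fun_on A S h" "p \<in> S" "v \<in> tangent_space A p"
  shows "D p v (\<lambda>q. h q *\<^sub>R \<xi> q) = v h *\<^sub>R \<xi> p + h p *\<^sub>R D p v \<xi>"
  by (rule conn_scale_near[OF assms(1,3,4) A.smooth_nearI[OF assms(2,3)]])

lemma conn_cscale:
  assumes "field S \<xi>" "p \<in> S" "v \<in> tangent_space A p"
  shows "D p v (\<lambda>q. c *\<^sub>R \<xi> q) = c *\<^sub>R D p v \<xi>"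
  using conn_scale[OF assms(1) A.smooth_fun_on_const[OF field_open[OF assms(1)], of c] assms(2,3)]
  by (simp add: A.tangent_fun_const[OF assms(3)])

lemma conn_neg:
  assumes "field S \<xi>" "p \<in> S" "v \<in> tangent_space A p"
  shows "D p v (\<lambda>q. - \<xi> q) = - D p v \<xi>"
  using conn_cscale[OF assms, of "-1"] by simp

lemma conn_diff:
  assumes "field S \<xi>" "field S \<eta>" "p \<in> S" "v \<in> tangent_space A p"
  shows "D p v (\<lambda>q. \<xi> q - \<eta> q) = D p v \<xi> - D p v \<eta>"
  using conn_add[OF assms(1) field_neg[OF assms(2)] assms(3,4)] conn_neg[OF assms(2-4)] by simp

lemma conn_zero:
  assumes "v \<in> tangent_space A p"
  shows "D p v (\<lambda>q. 0) = 0"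
  using conn_cscale[OF field_zero[OF open_UNIV] UNIV_I assms, of 0] by simp

text \<open>Multiplication by the indicator function of \<open>S\<close> shows that \<open>D\<close> is local.\<close>

lemma conn_cong:
  assumes "field S \<xi>" "field S \<eta>" "p \<in> S" "v \<in> tangent_space A p" "\<And>q. q \<in> S \<Longrightarrow> \<xi> q = \<eta> q"
  shows "D p v \<xi> = D p v \<eta>"
proof -
  let ?h = "\<lambda>q. if q \<in> S then 1 else 0 :: real"
  note oS = field_open[OF assms(1)]
  have "smooth_near A p ?h"
    by (rule A.smooth_near_cong1[OF oS assms(3) _ A.smooth_near_const[of p 1]]) simp
  moreover have "v ?h = 0"
    using A.tangent_fun_cong[OF assms(4) oS assms(3), of ?h "\<lambda>q. 1"] A.tangent_fun_const[OF assms(4), of 1]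
    by simp
  ultimately have "D p v (\<lambda>q. ?h q *\<^sub>R \<zeta> q) = D p v \<zeta>" if "field S \<zeta>" for \<zeta>
    using conn_scale_near[OF that assms(3,4), of ?h] assms(3) by simp
  note * = this[OF assms(1)] this[OF assms(2)]
  have "?h q *\<^sub>R \<xi> q = ?h q *\<^sub>R \<eta> q" for q using assms(5) by (cases "q \<in> S") simp_all
  then have "(\<lambda>q. ?h q *\<^sub>R \<xi> q) = (\<lambda>q. ?h q *\<^sub>R \<eta> q)" by (rule ext)
  then show ?thesis using * by (simp only:)
qed

end

text \<open>Unification eta-expands terms of the function type of tangent vectors; these rules would then
  rewrite below the abstraction and destroy sums of tangent vectors.\<close>

declare plus_fun_apply [simp del] zero_fun_apply [simp del] minus_apply [simp del] uminus_apply [simp del]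

context smooth_mfd_map
begin

lemma field_local:
  assumes "open S" "\<And>p. p \<in> S \<Longrightarrow> \<exists>N. p \<in> N \<and> field N \<xi>"
  shows "field S \<xi>"
proof (rule fieldI[OF assms(1)])
  show "\<xi> p \<in> tangent_space B (\<iota> p)" if p: "p \<in> S" for p
  proof -
    obtain N where "p \<in> N" "field N \<xi>" using assms(2)[OF p] by (elim exE conjE)
    then show ?thesis using field_tangent by simp
  qed
  fix T h assume h: "smooth_fun_on B T h"
  show "smooth_fun_on A (S \<inter> \<iota> -` T) (\<lambda>p. \<xi> p h)"
  proof (rule A.smooth_fun_on_local[OF field_dom_open[OF assms(1) h]])
    fix p assume p: "p \<in> S \<inter> \<iota> -` T"
    then have "\<exists>N. p \<in> N \<and> field N \<xi>" using assms(2)[of p] by simp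
    then obtain N where N: "p \<in> N" "field N \<xi>" by (elim exE conjE)
    show "\<exists>N. p \<in> N \<and> smooth_fun_on A N (\<lambda>p. \<xi> p h)"
      by (rule exI[of _ "N \<inter> \<iota> -` T"]) (use field_smooth[OF N(2) h] N(1) p in simp)
  qed
qed

end

context connection
begin

lemma conn_sum:
  assumes "open S" "\<And>i. i \<in> I \<Longrightarrow> field S (\<xi> i)" "p \<in> S" "v \<in> tangent_space A p"
  shows "D p v (\<lambda>q. \<Sum>i\<in>I. \<xi> i q) = (\<Sum>i\<in>I. D p v (\<xi> i))"
  using assms(2)
proof (induction I rule: infinite_finite_induct)
  case (infinite I)
  then show ?case unfolding sum.infinite[OF infinite(1)] by (intro conn_zero assms(4))
next
  case empty
  show ?case unfolding sum.empty by (intro conn_zero assms(4))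
next
  case (insert j I)
  then have "D p v (\<lambda>q. \<xi> j q + (\<Sum>i\<in>I. \<xi> i q)) = D p v (\<xi> j) + D p v (\<lambda>q. \<Sum>i\<in>I. \<xi> i q)"
    by (intro conn_add[OF _ field_sum[OF assms(1)] assms(3,4)]) auto
  with insert show ?case unfolding sum.insert[OF insert.hyps(1,2)] by simp
qed

lemma conn_vec_add:
  assumes "field S \<xi>" "p \<in> S" "v \<in> tangent_space A p" "w \<in> tangent_space A p"
  shows "D p (v + w) \<xi> = D p v \<xi> + D p w \<xi>"
  using conn_vec_lincomb[OF assms, of 1 1] by simp

lemma conn_vec_scale:
  assumes "field S \<xi>" "p \<in> S" "v \<in> tangent_space A p"
  shows "D p (a *\<^sub>R v) \<xi> = a *\<^sub>R D p v \<xi>"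
  using conn_vec_lincomb[OF assms(1-3) assms(3), of a 0] by simp

lemma conn_vec_neg:
  assumes "field S \<xi>" "p \<in> S" "v \<in> tangent_space A p"
  shows "D p (- v) \<xi> = - D p v \<xi>"
  using conn_vec_scale[OF assms, of "-1"] by simp

lemma conn_vec_sum:
  assumes "field S \<xi>" "p \<in> S" "\<And>i. i \<in> I \<Longrightarrow> v i \<in> tangent_space A p"
  shows "D p (\<Sum>i\<in>I. a i *\<^sub>R v i) \<xi> = (\<Sum>i\<in>I. a i *\<^sub>R D p (v i) \<xi>)"
proof -
  have zero: "D p 0 \<xi> = 0"
    using conn_vec_scale[OF assms(1,2) A.tangent_0, of 0] by simp
  show ?thesis
    using assms(3)
  proof (induction I rule: infinite_finite_induct)
    case (insert j I)
    then show ?case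
      using conn_vec_add[OF assms(1,2) A.tangent_scale subspace_sum[OF A.tangent_subspace A.tangent_scale], of "v j" I v "a j" a]
        conn_vec_scale[OF assms(1,2), of "v j" "a j"]
      by simp
  qed (simp_all add: zero)
qed

end

section \<open>Inner products on tangent spaces\<close>

text \<open>Only the pointwise part of a Riemannian metric, so that it applies at once to the
  induced metric, whose positivity is injectivity of \<open>push\<close>. Smoothness of products
  along the immersion is established separately in \<open>g_smooth\<close>.\<close>

locale inner_mfd = smooth_mfd A
  for A :: "('a::{t2_space,second_countable_topology}, 'e::euclidean_space) chart set" +
  fixes g :: "'a metric_field"
  assumes sym: "u \<in> tangent_space A p \<Longrightarrow> v \<in> tangent_space A p \<Longrightarrow> g p u v = g p v u"
    and pos: "u \<in> tangent_space A p \<Longrightarrow> u \<noteq> 0 \<Longrightarrow> g p u u > 0"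
    and lincomb: "u \<in> tangent_space A p \<Longrightarrow> v \<in> tangent_space A p \<Longrightarrow> w \<in> tangent_space A p \<Longrightarrow>
      g p (a *\<^sub>R u + b *\<^sub>R v) w = a * g p u w + b * g p v w"
begin

lemma add_left: "u \<in> tangent_space A p \<Longrightarrow> v \<in> tangent_space A p \<Longrightarrow> w \<in> tangent_space A p \<Longrightarrow>
    g p (u + v) w = g p u w + g p v w"
  using lincomb[of u p v w 1 1] by simp

lemma diff_left: "u \<in> tangent_space A p \<Longrightarrow> v \<in> tangent_space A p \<Longrightarrow> w \<in> tangent_space A p \<Longrightarrow>
    g p (u - v) w = g p u w - g p v w"
  using lincomb[of u p v w 1 "-1"] by simp

lemma scale_left: "u \<in> tangent_space A p \<Longrightarrow> w \<in> tangent_space A p \<Longrightarrow> g p (a *\<^sub>R u) w = a * g p u w"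
  using lincomb[of u p u w a 0] by simp

lemma neg_left: "u \<in> tangent_space A p \<Longrightarrow> w \<in> tangent_space A p \<Longrightarrow> g p (- u) w = - g p u w"
  using scale_left[of u p w "-1"] by simp

lemma zero_left: "w \<in> tangent_space A p \<Longrightarrow> g p 0 w = 0"
  using scale_left[of 0 p w 0] tangent_0 by simp

lemma add_right: "u \<in> tangent_space A p \<Longrightarrow> v \<in> tangent_space A p \<Longrightarrow> w \<in> tangent_space A p \<Longrightarrow>
    g p w (u + v) = g p w u + g p w v"
  using add_left sym tangent_add by simp

lemma diff_right: "u \<in> tangent_space A p \<Longrightarrow> v \<in> tangent_space A p \<Longrightarrow> w \<in> tangent_space A p \<Longrightarrow>
    g p w (u - v) = g p w u - g p w v"
  using diff_left sym tangent_diff by simp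

lemma scale_right: "u \<in> tangent_space A p \<Longrightarrow> w \<in> tangent_space A p \<Longrightarrow> g p w (a *\<^sub>R u) = a * g p w u"
  using scale_left sym tangent_scale by simp

lemma neg_right: "u \<in> tangent_space A p \<Longrightarrow> w \<in> tangent_space A p \<Longrightarrow> g p w (- u) = - g p w u"
  using neg_left sym tangent_neg by simp

lemma zero_right: "w \<in> tangent_space A p \<Longrightarrow> g p w 0 = 0"
  using zero_left[of w p] sym[OF tangent_0] by simp

lemma sum_left:
  assumes "\<And>i. i \<in> I \<Longrightarrow> u i \<in> tangent_space A p" "w \<in> tangent_space A p"
  shows "g p (\<Sum>i\<in>I. a i *\<^sub>R u i) w = (\<Sum>i\<in>I. a i * g p (u i) w)"
  using assms(1)
proof (induction I rule: infinite_finite_induct)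
  case (insert j I)
  then have "g p (a j *\<^sub>R u j + (\<Sum>i\<in>I. a i *\<^sub>R u i)) w = a j * g p (u j) w + g p (\<Sum>i\<in>I. a i *\<^sub>R u i) w"
    using subspace_sum[OF tangent_subspace tangent_scale, of I u p a] assms(2)
    by (simp add: add_left scale_left tangent_scale)
  with insert show ?case by simp
qed (simp_all add: zero_left[OF assms(2)])

lemma eq_0I: "u \<in> tangent_space A p \<Longrightarrow> g p u u = 0 \<Longrightarrow> u = 0"
  using pos[of u p] by force

lemma orthogonal_span:
  assumes "u \<in> tangent_space A p" "\<And>v. v \<in> F \<Longrightarrow> v \<in> tangent_space A p" "\<And>v. v \<in> F \<Longrightarrow> g p u v = 0"
    and "w \<in> span F"
  shows "g p u w = 0"
proof -
  have "w \<in> tangent_space A p \<and> g p u w = 0"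
    using assms(4)
    by (induction rule: span_induct_alt)
       (use assms(1-3) in \<open>auto simp: tangent_0 zero_right tangent_add tangent_scale add_right scale_right\<close>)
  then show ?thesis ..
qed

text \<open>\<open>L\<close> consists of fields evaluated at \<open>p\<close>, so that the same sum
  gives a projection at one point and, with \<open>p\<close> varying, a candidate for a smooth
  field.\<close>

lemma orthogonal_coeff:
  assumes fin: "finite L" and L: "\<And>E. E \<in> L \<Longrightarrow> E p \<in> tangent_space A p" "\<And>E. E \<in> L \<Longrightarrow> E p \<noteq> 0"
    and orth: "\<And>E F. E \<in> L \<Longrightarrow> F \<in> L \<Longrightarrow> E \<noteq> F \<Longrightarrow> g p (E p) (F p) = 0"
    and F: "F \<in> L"
  shows "g p (\<Sum>E\<in>L. (c E / g p (E p) (E p)) *\<^sub>R E p) (F p) = c F"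
proof -
  have "g p (\<Sum>E\<in>L. (c E / g p (E p) (E p)) *\<^sub>R E p) (F p)
      = (\<Sum>E\<in>L. c E / g p (E p) (E p) * g p (E p) (F p))"
    by (rule sum_left[OF L(1) L(1)[OF F]])
  also have "\<dots> = c F / g p (F p) (F p) * g p (F p) (F p)"
    using sum.remove[OF fin F, of "\<lambda>E. c E / g p (E p) (E p) * g p (E p) (F p)"] orth F
    by simp
  also have "\<dots> = c F" using pos[OF L(1)[OF F] L(2)[OF F]] by simp
  finally show ?thesis .
qed

end

section \<open>Submanifolds of Kaehler manifolds\<close>

locale kaehler_submanifold = connection A B \<iota> D
  for A :: "('a::{t2_space,second_countable_topology}, 'e::euclidean_space) chart set"
    and B :: "('b::{t2_space,second_countable_topology}, 'f::euclidean_space) chart set"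
    and \<iota> :: "'a \<Rightarrow> 'b" and D :: "('a, 'b) derivation_op" +
  fixes g :: "'b metric_field" and J :: "'b endo_field" and nablaB :: "('b, 'b) derivation_op"
    and nablaA :: "('a, 'a) derivation_op"
  assumes kaehler: "kaehler_manifold B g J nablaB"
    and imm: "immersion A B \<iota>"
    and lc: "levi_civita A (induced_metric B \<iota> g) nablaA"
    and pull: "pullback_connection A B \<iota> nablaB D"
begin

abbreviation gA :: "'a metric_field" where "gA \<equiv> induced_metric B \<iota> g"

text \<open>The two Levi-Civita connections are connections along the identity maps of
  \<open>B\<close> and \<open>A\<close>; \<open>N\<close> and \<open>M\<close> make the locality and
  linearity rules available for them.\<close>

sublocale N: connection B B "\<lambda>p. p" nablaB
  using kaehler B.smooth_map_id
  by unfold_locales (auto simp: kaehler_manifold_def levi_civita_def affine_connection_def)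

sublocale M: connection A A "\<lambda>p. p" nablaA
  using lc A.smooth_map_id
  by unfold_locales (auto simp: levi_civita_def affine_connection_def)

lemma riem: "riemannian_metric B g"
  using kaehler by (simp add: kaehler_manifold_def)

sublocale GB: inner_mfd B g
proof
  show "g p u v = g p v u" if "u \<in> tangent_space B p" "v \<in> tangent_space B p" for u v p
    using riem that by (simp add: riemannian_metric_def)
  show "g p u u > 0" if "u \<in> tangent_space B p" "u \<noteq> 0" for u p
    using riem that by (simp add: riemannian_metric_def)
  show "g p (a *\<^sub>R u + b *\<^sub>R v) w = a * g p u w + b * g p v w"
    if "u \<in> tangent_space B p" "v \<in> tangent_space B p" "w \<in> tangent_space B p" for u v w a b p
    using riem that by (simp add: riemannian_metric_def)
qed

lemma push_eq_0:
  assumes "u \<in> tangent_space A p" "push B \<iota> p u = 0"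
  shows "u = 0"
proof -
  have "inj_on (push B \<iota> p) (tangent_space A p)" using imm by (simp add: immersion_def)
  moreover have "push B \<iota> p u = push B \<iota> p 0" using assms(2) linear_0[OF push_linear] by simp
  ultimately show ?thesis using assms(1) A.tangent_0 by (rule inj_onD)
qed

sublocale GA: inner_mfd A gA
proof
  show "gA p u v = gA p v u" if "u \<in> tangent_space A p" "v \<in> tangent_space A p" for u v p
    using GB.sym that push_tangent by (simp add: induced_metric_def)
  show "gA p u u > 0" if "u \<in> tangent_space A p" "u \<noteq> 0" for u p
    unfolding induced_metric_def
    by (rule GB.pos[OF push_tangent[OF that(1)]]) (use push_eq_0[OF that(1)] that(2) in blast)
  show "gA p (a *\<^sub>R u + b *\<^sub>R v) w = a * gA p u w + b * gA p v w"
    if "u \<in> tangent_space A p" "v \<in> tangent_space A p" "w \<in> tangent_space A p" for u v w a b p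
    using GB.lincomb that push_tangent by (simp add: induced_metric_def push_lincomb)
qed

lemma vector_field_eq: "vector_field A = field_along A A (\<lambda>p. p)"
  by (intro ext) (simp add: vector_field_def)

lemma vector_field_B_eq: "vector_field B = field_along B B (\<lambda>p. p)"
  by (intro ext) (simp add: vector_field_def)

lemma acs: "almost_complex_structure B J"
  using kaehler by (simp add: kaehler_manifold_def complex_structure_def)

lemma J_tangent: "u \<in> tangent_space B p \<Longrightarrow> J p u \<in> tangent_space B p"
  and J_J: "u \<in> tangent_space B p \<Longrightarrow> J p (J p u) = - u"
  and J_lincomb: "u \<in> tangent_space B p \<Longrightarrow> v \<in> tangent_space B p \<Longrightarrow>
    J p (a *\<^sub>R u + b *\<^sub>R v) = a *\<^sub>R J p u + b *\<^sub>R J p v"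
  and J_vector_field: "vector_field B S X \<Longrightarrow> vector_field B S (\<lambda>p. J p (X p))"
  using acs by (simp_all add: almost_complex_structure_def)

lemma J_isometry: "u \<in> tangent_space B p \<Longrightarrow> v \<in> tangent_space B p \<Longrightarrow> g p (J p u) (J p v) = g p u v"
  using kaehler by (simp add: kaehler_manifold_def)

lemma nablaB_J:
  assumes "vector_field B S Y" "p \<in> S" "v \<in> tangent_space B p"
  shows "nablaB p v (\<lambda>q. J q (Y q)) = J p (nablaB p v Y)"
proof -
  have "\<forall>S Y. vector_field B S Y \<longrightarrow>
    (\<forall>p\<in>S. \<forall>v\<in>tangent_space B p. nablaB p v (\<lambda>q. J q (Y q)) = J p (nablaB p v Y))"
    using kaehler unfolding kaehler_manifold_def by (elim conjE)
  from this[rule_format, OF assms] show ?thesis .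
qed

lemma J_add: "u \<in> tangent_space B p \<Longrightarrow> v \<in> tangent_space B p \<Longrightarrow> J p (u + v) = J p u + J p v"
  using J_lincomb[of u p v 1 1] by simp

lemma J_scale: "u \<in> tangent_space B p \<Longrightarrow> J p (a *\<^sub>R u) = a *\<^sub>R J p u"
  using J_lincomb[of u p u a 0] by simp

lemma J_neg: "u \<in> tangent_space B p \<Longrightarrow> J p (- u) = - J p u"
  using J_scale[of u p "-1"] by simp

lemma J_diff: "u \<in> tangent_space B p \<Longrightarrow> v \<in> tangent_space B p \<Longrightarrow> J p (u - v) = J p u - J p v"
  using J_lincomb[of u p v 1 "-1"] by simp

lemma J_zero: "J p 0 = 0"
  using J_scale[OF B.tangent_0, of p 0] by simp

lemma J_skew:
  assumes "u \<in> tangent_space B p" "v \<in> tangent_space B p"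
  shows "g p (J p u) v = - g p u (J p v)"
  using J_isometry[OF assms(1) J_tangent[OF assms(2)]] J_J[OF assms(2)]
    GB.neg_right[OF assms(2) J_tangent[OF assms(1)]] by simp

lemma pullback:
  assumes "vector_field B T Y" "\<iota> p \<in> T" "v \<in> tangent_space A p"
  shows "D p v (\<lambda>q. Y (\<iota> q)) = nablaB (\<iota> p) (push B \<iota> p v) Y"
proof -
  have "\<forall>T Y. vector_field B T Y \<longrightarrow> (\<forall>p v. \<iota> p \<in> T \<and> v \<in> tangent_space A p \<longrightarrow>
      D p v (Y \<circ> \<iota>) = nablaB (\<iota> p) (push B \<iota> p v) Y)"
    using pull unfolding pullback_connection_def by (elim conjE)
  from this[rule_format, OF assms(1) conjI[OF assms(2,3)]] show ?thesis by (simp add: o_def)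
qed

section \<open>Transfer of ambient identities to fields along the immersion\<close>

lemma chart_restrict:
  assumes "open S" "p \<in> S"
  obtains V \<psi> S' where "(V, \<psi>) \<in> B" "open S'" "p \<in> S'" "S' \<subseteq> S" "\<iota> ` S' \<subseteq> V"
proof -
  obtain V \<psi> where d: "(V, \<psi>) \<in> B" "\<iota> p \<in> V" by (rule B.chart_at)
  show ?thesis
    by (rule that[OF d(1), of "S \<inter> \<iota> -` V"])
       (use assms d open_vimage_map[OF B.chart_props(1)[OF d(1)]] in auto)
qed

text \<open>Smoothness and commutation go through one induction, because differentiating
  \<open>f J \<xi>\<close> by the Leibniz rule presupposes that \<open>J \<xi>\<close> is a smooth
  field. The rules for functions and sums hold because \<open>J\<close> is linear at each
  point.\<close>

lemma J_field_chart:
  assumes V: "(V, \<psi>) \<in> B" "\<iota> ` S \<subseteq> V" and \<xi>: "field S \<xi>"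
  shows "field S (\<lambda>q. J (\<iota> q) (\<xi> q)) \<and>
    (\<forall>p\<in>S. \<forall>v\<in>tangent_space A p. D p v (\<lambda>q. J (\<iota> q) (\<xi> q)) = J (\<iota> p) (D p v \<xi>))"
    (is "?P \<xi>")
proof (rule field_induct[OF V \<xi>, of ?P])
  note oS = field_open[OF \<xi>]
  fix \<xi> \<eta> assume \<xi>: "field S \<xi>" and P: "?P \<xi>" and eq: "\<And>q. q \<in> S \<Longrightarrow> \<xi> q = \<eta> q"
  note \<eta> = field_cong[OF \<xi> eq]
  have J\<eta>: "field S (\<lambda>q. J (\<iota> q) (\<eta> q))" by (rule field_cong[of S "\<lambda>q. J (\<iota> q) (\<xi> q)"]) (use P eq in auto)
  have "D p v (\<lambda>q. J (\<iota> q) (\<eta> q)) = J (\<iota> p) (D p v \<eta>)" if "p \<in> S" "v \<in> tangent_space A p" for p v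
  proof -
    have "D p v (\<lambda>q. J (\<iota> q) (\<eta> q)) = D p v (\<lambda>q. J (\<iota> q) (\<xi> q))"
      by (rule conn_cong[OF J\<eta> _ that]) (use P eq in auto)
    moreover have "D p v \<eta> = D p v \<xi>" by (rule conn_cong[OF \<eta> \<xi> that]) (use eq in auto)
    ultimately show ?thesis using P that by simp
  qed
  then show "?P \<eta>" using J\<eta> by blast
next
  note oS = field_open[OF \<xi>]
  show "?P (\<lambda>q. 0)" using conn_zero by (simp add: J_zero field_zero[OF oS])
next
  note oS = field_open[OF \<xi>]
  fix b :: 'f assume "b \<in> Basis"
  let ?Y = "\<lambda>x. B.chart_vec V \<psi> x b"
  have Y: "vector_field B V ?Y" by (rule B.chart_vector_field[OF V(1)])
  have "field S (\<lambda>q. J (\<iota> q) (?Y (\<iota> q)))"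
    by (rule field_subset[OF field_compose[OF J_vector_field[OF Y]] oS]) (use V(2) in auto)
  \<comment> \<open>The frame field is the restriction of an ambient field, so
    \<open>pullback\<close> turns both sides into derivatives by \<open>nablaB\<close>, for which
    \<open>J\<close> is parallel.\<close>
  moreover have "D p v (\<lambda>q. J (\<iota> q) (?Y (\<iota> q))) = J (\<iota> p) (D p v (\<lambda>q. ?Y (\<iota> q)))"
    if p: "p \<in> S" and v: "v \<in> tangent_space A p" for p v
  proof -
    have \<iota>p: "\<iota> p \<in> V" using V(2) p by auto
    show ?thesis
      using nablaB_J[OF Y \<iota>p push_tangent[OF v]] pullback[OF J_vector_field[OF Y] \<iota>p v] pullback[OF Y \<iota>p v] push_tangent[OF v] \<iota>p by simp
  qed
  ultimately show "?P (\<lambda>q. ?Y (\<iota> q))" by blast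
next
  fix f \<xi> assume f: "smooth_fun_on A S f" and \<xi>: "field S \<xi>" and P: "?P \<xi>"
  have eq: "f q *\<^sub>R J (\<iota> q) (\<xi> q) = J (\<iota> q) (f q *\<^sub>R \<xi> q)" if "q \<in> S" for q
    using J_scale[OF field_tangent[OF \<xi> that]] by simp
  have 1: "field S (\<lambda>q. f q *\<^sub>R J (\<iota> q) (\<xi> q))" using P by (intro field_scale[OF f]) blast
  have 2: "field S (\<lambda>q. J (\<iota> q) (f q *\<^sub>R \<xi> q))" by (rule field_cong[OF 1 eq])
  have "D p v (\<lambda>q. J (\<iota> q) (f q *\<^sub>R \<xi> q)) = J (\<iota> p) (D p v (\<lambda>q. f q *\<^sub>R \<xi> q))"
    if p: "p \<in> S" and v: "v \<in> tangent_space A p" for p v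
  proof -
    have "D p v (\<lambda>q. J (\<iota> q) (f q *\<^sub>R \<xi> q)) = D p v (\<lambda>q. f q *\<^sub>R J (\<iota> q) (\<xi> q))"
      by (rule conn_cong[OF 2 1 p v]) (simp add: eq)
    also have "\<dots> = v f *\<^sub>R J (\<iota> p) (\<xi> p) + f p *\<^sub>R J (\<iota> p) (D p v \<xi>)"
      using conn_scale[OF conjunct1[OF P] f p v] P p v by simp
    also have "\<dots> = J (\<iota> p) (D p v (\<lambda>q. f q *\<^sub>R \<xi> q))"
      using conn_scale[OF \<xi> f p v] J_lincomb[OF field_tangent[OF \<xi> p] conn_tangent[OF \<xi> p v]] by simp
    finally show ?thesis .
  qed
  then show "?P (\<lambda>q. f q *\<^sub>R \<xi> q)" using 2 by blast
next
  fix \<xi> \<eta> assume \<xi>: "field S \<xi>" "field S \<eta>" and P: "?P \<xi>" "?P \<eta>"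
  have eq: "J (\<iota> q) (\<xi> q) + J (\<iota> q) (\<eta> q) = J (\<iota> q) (\<xi> q + \<eta> q)" if "q \<in> S" for q
    using J_add[OF \<xi>[THEN field_tangent, OF that]] by simp
  have 1: "field S (\<lambda>q. J (\<iota> q) (\<xi> q) + J (\<iota> q) (\<eta> q))" using P by (intro field_add) blast+
  have 2: "field S (\<lambda>q. J (\<iota> q) (\<xi> q + \<eta> q))" by (rule field_cong[OF 1 eq])
  have "D p v (\<lambda>q. J (\<iota> q) (\<xi> q + \<eta> q)) = J (\<iota> p) (D p v (\<lambda>q. \<xi> q + \<eta> q))"
    if p: "p \<in> S" and v: "v \<in> tangent_space A p" for p v
  proof -
    have "D p v (\<lambda>q. J (\<iota> q) (\<xi> q + \<eta> q)) = D p v (\<lambda>q. J (\<iota> q) (\<xi> q) + J (\<iota> q) (\<eta> q))"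
      by (rule conn_cong[OF 2 1 p v]) (simp add: eq)
    also have "\<dots> = J (\<iota> p) (D p v \<xi>) + J (\<iota> p) (D p v \<eta>)"
      using conn_add[OF conjunct1[OF P(1)] conjunct1[OF P(2)] p v] P p v by simp
    also have "\<dots> = J (\<iota> p) (D p v (\<lambda>q. \<xi> q + \<eta> q))"
      using conn_add[OF \<xi> p v] J_add[OF \<xi>[THEN conn_tangent, OF p v]] by simp
    finally show ?thesis .
  qed
  then show "?P (\<lambda>q. \<xi> q + \<eta> q)" using 2 by blast
qed

lemma J_field:
  assumes "field S \<xi>"
  shows "field S (\<lambda>q. J (\<iota> q) (\<xi> q))"
proof (rule field_local[OF field_open[OF assms]])
  fix p assume "p \<in> S"
  then obtain V \<psi> S' where *: "(V, \<psi>) \<in> B" "open S'" "p \<in> S'" "S' \<subseteq> S" "\<iota> ` S' \<subseteq> V"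
    using chart_restrict[OF field_open[OF assms]] by metis
  show "\<exists>N. p \<in> N \<and> field N (\<lambda>q. J (\<iota> q) (\<xi> q))"
    using J_field_chart[OF *(1,5) field_subset[OF assms *(2,4)]] *(3) by blast
qed

lemma conn_J:
  assumes "field S \<xi>" "p \<in> S" "v \<in> tangent_space A p"
  shows "D p v (\<lambda>q. J (\<iota> q) (\<xi> q)) = J (\<iota> p) (D p v \<xi>)"
proof -
  obtain V \<psi> S' where *: "(V, \<psi>) \<in> B" "open S'" "p \<in> S'" "S' \<subseteq> S" "\<iota> ` S' \<subseteq> V"
    using chart_restrict[OF field_open[OF assms(1)] assms(2)] by metis
  show ?thesis
    using J_field_chart[OF *(1,5) field_subset[OF assms(1) *(2,4)]] *(3) assms(3) by blast
qed

lemma lcB: "levi_civita B g nablaB"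
  using kaehler unfolding kaehler_manifold_def by (elim conjE)

lemma lcB_torsion:
  assumes "vector_field B S X" "vector_field B S Y" "p \<in> S"
  shows "nablaB p (X p) Y - nablaB p (Y p) X = lie_bracket B X Y p"
  using lcB[unfolded levi_civita_def, THEN conjunct2, rule_format, OF conjI[OF assms(1,2)] assms(3)] by blast

lemma lcB_metric:
  assumes "vector_field B S X" "vector_field B S Y" "p \<in> S" "v \<in> tangent_space B p"
  shows "v (\<lambda>q. g q (X q) (Y q)) = g p (nablaB p v X) (Y p) + g p (X p) (nablaB p v Y)"
  using lcB[unfolded levi_civita_def, THEN conjunct2, rule_format, OF conjI[OF assms(1,2)] assms(3)] assms(4)
  by blast

lemma lcA_torsion:
  assumes "vector_field A S X" "vector_field A S Y" "p \<in> S"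
  shows "nablaA p (X p) Y - nablaA p (Y p) X = lie_bracket A X Y p"
  using lc[unfolded levi_civita_def, THEN conjunct2, rule_format, OF conjI[OF assms(1,2)] assms(3)] by blast

lemma lcA_metric:
  assumes "vector_field A S X" "vector_field A S Y" "p \<in> S" "v \<in> tangent_space A p"
  shows "v (\<lambda>q. gA q (X q) (Y q)) = gA p (nablaA p v X) (Y p) + gA p (X p) (nablaA p v Y)"
  using lc[unfolded levi_civita_def, THEN conjunct2, rule_format, OF conjI[OF assms(1,2)] assms(3)] assms(4)
  by blast

lemma g_smooth_B:
  assumes "vector_field B S X" "vector_field B S Y"
  shows "smooth_fun_on B S (\<lambda>p. g p (X p) (Y p))"
  using riem[unfolded riemannian_metric_def, THEN conjunct2, rule_format, OF conjI[OF assms]] .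

text \<open>Smoothness of the product is included because the sum and Leibniz rules for tangent
  vectors, used in the induction steps, concern functions smooth near the point.\<close>

definition metric_compatible :: "'a set \<Rightarrow> ('a \<Rightarrow> 'b tangent) \<Rightarrow> ('a \<Rightarrow> 'b tangent) \<Rightarrow> bool" where
  "metric_compatible S \<xi> \<eta> \<longleftrightarrow> smooth_fun_on A S (\<lambda>q. g (\<iota> q) (\<xi> q) (\<eta> q)) \<and>
    (\<forall>p\<in>S. \<forall>v\<in>tangent_space A p. v (\<lambda>q. g (\<iota> q) (\<xi> q) (\<eta> q))
      = g (\<iota> p) (D p v \<xi>) (\<eta> p) + g (\<iota> p) (\<xi> p) (D p v \<eta>))"

lemma metric_compatible_cong:
  assumes "field S \<xi>" "field S \<xi>'" "field S \<eta>" "metric_compatible S \<xi> \<eta>" "\<And>q. q \<in> S \<Longrightarrow> \<xi> q = \<xi>' q"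
  shows "metric_compatible S \<xi>' \<eta>"
proof -
  note oS = field_open[OF assms(1)]
  have eq: "g (\<iota> q) (\<xi> q) (\<eta> q) = g (\<iota> q) (\<xi>' q) (\<eta> q)" if "q \<in> S" for q
    using assms(5)[OF that] by simp
  have 1: "smooth_fun_on A S (\<lambda>q. g (\<iota> q) (\<xi> q) (\<eta> q))"
    using assms(4) by (simp add: metric_compatible_def)
  have "v (\<lambda>q. g (\<iota> q) (\<xi>' q) (\<eta> q)) = g (\<iota> p) (D p v \<xi>') (\<eta> p) + g (\<iota> p) (\<xi>' p) (D p v \<eta>)"
    if p: "p \<in> S" and v: "v \<in> tangent_space A p" for p v
  proof -
    have "v (\<lambda>q. g (\<iota> q) (\<xi>' q) (\<eta> q)) = v (\<lambda>q. g (\<iota> q) (\<xi> q) (\<eta> q))"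
      by (rule A.tangent_fun_cong[OF v oS p]) (simp add: eq)
    moreover have "D p v \<xi>' = D p v \<xi>"
      by (rule conn_cong[OF assms(2,1) p v]) (simp add: assms(5))
    ultimately show ?thesis
      using assms(4) p v by (simp add: metric_compatible_def assms(5))
  qed
  then show ?thesis
    using A.smooth_fun_on_cong[OF 1 eq] by (simp add: metric_compatible_def)
qed

lemma metric_compatible_sym:
  assumes "field S \<xi>" "field S \<eta>" "metric_compatible S \<xi> \<eta>"
  shows "metric_compatible S \<eta> \<xi>"
proof -
  note oS = field_open[OF assms(1)]
  have eq: "g (\<iota> q) (\<xi> q) (\<eta> q) = g (\<iota> q) (\<eta> q) (\<xi> q)" if "q \<in> S" for q
    by (rule GB.sym[OF field_tangent[OF assms(1) that] field_tangent[OF assms(2) that]])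
  have 1: "smooth_fun_on A S (\<lambda>q. g (\<iota> q) (\<xi> q) (\<eta> q))"
    using assms(3) by (simp add: metric_compatible_def)
  have "v (\<lambda>q. g (\<iota> q) (\<eta> q) (\<xi> q)) = g (\<iota> p) (D p v \<eta>) (\<xi> p) + g (\<iota> p) (\<eta> p) (D p v \<xi>)"
    if p: "p \<in> S" and v: "v \<in> tangent_space A p" for p v
  proof -
    have "v (\<lambda>q. g (\<iota> q) (\<eta> q) (\<xi> q)) = v (\<lambda>q. g (\<iota> q) (\<xi> q) (\<eta> q))"
      by (rule A.tangent_fun_cong[OF v oS p]) (simp add: eq)
    also have "\<dots> = g (\<iota> p) (D p v \<xi>) (\<eta> p) + g (\<iota> p) (\<xi> p) (D p v \<eta>)"
      using assms(3) p v by (simp add: metric_compatible_def)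
    also have "\<dots> = g (\<iota> p) (D p v \<eta>) (\<xi> p) + g (\<iota> p) (\<eta> p) (D p v \<xi>)"
      using GB.sym[OF conn_tangent[OF assms(1) p v] field_tangent[OF assms(2) p]]
        GB.sym[OF field_tangent[OF assms(1) p] conn_tangent[OF assms(2) p v]] by simp
    finally show ?thesis .
  qed
  then show ?thesis
    using A.smooth_fun_on_cong[OF 1 eq] by (simp add: metric_compatible_def)
qed

lemma metric_compatible_frame:
  assumes V: "(V, \<psi>) \<in> B" "\<iota> ` S \<subseteq> V" and oS: "open S"
  shows "metric_compatible S (\<lambda>q. B.chart_vec V \<psi> (\<iota> q) b) (\<lambda>q. B.chart_vec V \<psi> (\<iota> q) c)"
proof -
  let ?Y = "\<lambda>b x. B.chart_vec V \<psi> x b"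
  note Y = B.chart_vector_field[OF V(1)]
  let ?G = "\<lambda>x. g x (?Y b x) (?Y c x)"
  have G: "smooth_fun_on B V ?G" by (rule g_smooth_B[OF Y Y])
  have "smooth_fun_on A S (?G \<circ> \<iota>)"
    by (rule A.smooth_fun_on_subset[OF smooth_fun_on_compose[OF G] oS]) (use V(2) in auto)
  moreover have "v (?G \<circ> \<iota>) = g (\<iota> p) (D p v (\<lambda>q. ?Y b (\<iota> q))) (?Y c (\<iota> p))
      + g (\<iota> p) (?Y b (\<iota> p)) (D p v (\<lambda>q. ?Y c (\<iota> q)))"
    if p: "p \<in> S" and v: "v \<in> tangent_space A p" for p v
  proof -
    have \<iota>p: "\<iota> p \<in> V" using V(2) p by auto
    \<comment> \<open>Differentiating along the submanifold is applying the pushed vector to an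
      ambient function, where the metric property of \<open>nablaB\<close> is available.\<close>
    have "v (?G \<circ> \<iota>) = push B \<iota> p v ?G"
      using B.smooth_nearI[OF G \<iota>p] by (simp add: push_def)
    then show ?thesis
      using lcB_metric[OF Y Y \<iota>p push_tangent[OF v]] pullback[OF Y \<iota>p v] by simp
  qed
  ultimately show ?thesis by (simp add: metric_compatible_def o_def)
qed

text \<open>Reduces one argument to frame fields while the other is fixed. Two applications, linked
  by \<open>metric_compatible_sym\<close>, reduce the general case to pairs of frame fields.\<close>

lemma metric_compatible_left:
  assumes V: "(V, \<psi>) \<in> B" "\<iota> ` S \<subseteq> V" and \<xi>: "field S \<xi>" and \<eta>: "field S \<eta>"
    and frame: "\<And>b. metric_compatible S (\<lambda>q. B.chart_vec V \<psi> (\<iota> q) b) \<eta>"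
  shows "metric_compatible S \<xi> \<eta>"
proof (rule field_induct[OF V \<xi>])
  note oS = field_open[OF \<xi>]
  fix \<xi> \<xi>' assume \<xi>: "field S \<xi>" and P: "metric_compatible S \<xi> \<eta>" and eq: "\<And>q. q \<in> S \<Longrightarrow> \<xi> q = \<xi>' q"
  show "metric_compatible S \<xi>' \<eta>"
    by (rule metric_compatible_cong[OF \<xi> field_cong[OF \<xi> eq] \<eta> P eq])
next
  note oS = field_open[OF \<xi>]
  have z: "g (\<iota> q) 0 (\<eta> q) = 0" if "q \<in> S" for q
    by (rule GB.zero_left[OF field_tangent[OF \<eta> that]])
  have "smooth_fun_on A S (\<lambda>q. g (\<iota> q) 0 (\<eta> q))"
    by (rule A.smooth_fun_on_cong[OF A.smooth_fun_on_const[OF oS, of 0]]) (simp add: z)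
  moreover have "v (\<lambda>q. g (\<iota> q) 0 (\<eta> q)) = g (\<iota> p) (D p v (\<lambda>q. 0)) (\<eta> p) + g (\<iota> p) 0 (D p v \<eta>)"
    if p: "p \<in> S" and v: "v \<in> tangent_space A p" for p v
  proof -
    have "v (\<lambda>q. g (\<iota> q) 0 (\<eta> q)) = v (\<lambda>q. 0)"
      by (rule A.tangent_fun_cong[OF v oS p]) (simp add: z)
    then show ?thesis
      using A.tangent_fun_const[OF v] conn_zero[OF v] z[OF p] GB.zero_left[OF conn_tangent[OF \<eta> p v]] by simp
  qed
  ultimately show "metric_compatible S (\<lambda>q. 0) \<eta>" by (simp add: metric_compatible_def)
next
  show "metric_compatible S (\<lambda>q. B.chart_vec V \<psi> (\<iota> q) b) \<eta>" for b by (rule frame)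
next
  note oS = field_open[OF \<xi>]
  fix f \<xi> assume f: "smooth_fun_on A S f" and \<xi>: "field S \<xi>" and P: "metric_compatible S \<xi> \<eta>"
  let ?G = "\<lambda>q. g (\<iota> q) (\<xi> q) (\<eta> q)"
  have G: "smooth_fun_on A S ?G" using P by (simp add: metric_compatible_def)
  have eq: "f q * ?G q = g (\<iota> q) (f q *\<^sub>R \<xi> q) (\<eta> q)" if "q \<in> S" for q
    using GB.scale_left[OF field_tangent[OF \<xi> that] field_tangent[OF \<eta> that]] by simp
  have "v (\<lambda>q. g (\<iota> q) (f q *\<^sub>R \<xi> q) (\<eta> q)) = g (\<iota> p) (D p v (\<lambda>q. f q *\<^sub>R \<xi> q)) (\<eta> p)
      + g (\<iota> p) (f p *\<^sub>R \<xi> p) (D p v \<eta>)"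
    if p: "p \<in> S" and v: "v \<in> tangent_space A p" for p v
  proof -
    note t = field_tangent[OF \<xi> p] conn_tangent[OF \<xi> p v] field_tangent[OF \<eta> p] conn_tangent[OF \<eta> p v]
    have "v (\<lambda>q. g (\<iota> q) (f q *\<^sub>R \<xi> q) (\<eta> q)) = v (\<lambda>q. f q * ?G q)"
      by (rule A.tangent_fun_cong[OF v oS p]) (simp add: eq)
    also have "\<dots> = v f * ?G p + f p * v ?G"
      by (rule A.tangent_fun_mult[OF v A.smooth_nearI[OF f p] A.smooth_nearI[OF G p]])
    also have "\<dots> = v f * ?G p + f p * (g (\<iota> p) (D p v \<xi>) (\<eta> p) + g (\<iota> p) (\<xi> p) (D p v \<eta>))"
      using P p v by (simp add: metric_compatible_def)
    also have "\<dots> = g (\<iota> p) (D p v (\<lambda>q. f q *\<^sub>R \<xi> q)) (\<eta> p) + g (\<iota> p) (f p *\<^sub>R \<xi> p) (D p v \<eta>)"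
      unfolding conn_scale[OF \<xi> f p v] GB.lincomb[OF t(1,2,3)] GB.scale_left[OF t(1,4)]
      by (simp add: algebra_simps)
    finally show ?thesis .
  qed
  then show "metric_compatible S (\<lambda>q. f q *\<^sub>R \<xi> q) \<eta>"
    using A.smooth_fun_on_cong[OF A.smooth_fun_on_mult[OF f G] eq] by (simp add: metric_compatible_def)
next
  note oS = field_open[OF \<xi>]
  fix \<xi> \<xi>' assume \<xi>: "field S \<xi>" "field S \<xi>'" and P: "metric_compatible S \<xi> \<eta>" "metric_compatible S \<xi>' \<eta>"
  let ?G = "\<lambda>\<xi> q. g (\<iota> q) (\<xi> q) (\<eta> q)"
  have G: "smooth_fun_on A S (?G \<xi>)" "smooth_fun_on A S (?G \<xi>')" using P by (simp_all add: metric_compatible_def)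
  have eq: "?G \<xi> q + ?G \<xi>' q = g (\<iota> q) (\<xi> q + \<xi>' q) (\<eta> q)" if "q \<in> S" for q
    using GB.add_left[OF \<xi>[THEN field_tangent, OF that] field_tangent[OF \<eta> that]] by simp
  have "v (\<lambda>q. g (\<iota> q) (\<xi> q + \<xi>' q) (\<eta> q)) = g (\<iota> p) (D p v (\<lambda>q. \<xi> q + \<xi>' q)) (\<eta> p)
      + g (\<iota> p) (\<xi> p + \<xi>' p) (D p v \<eta>)"
    if p: "p \<in> S" and v: "v \<in> tangent_space A p" for p v
  proof -
    note t = field_tangent[OF \<xi>(1) p] field_tangent[OF \<xi>(2) p] conn_tangent[OF \<xi>(1) p v] conn_tangent[OF \<xi>(2) p v]
      field_tangent[OF \<eta> p] conn_tangent[OF \<eta> p v]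
    have "v (\<lambda>q. g (\<iota> q) (\<xi> q + \<xi>' q) (\<eta> q)) = v (\<lambda>q. ?G \<xi> q + ?G \<xi>' q)"
      by (rule A.tangent_fun_cong[OF v oS p]) (simp add: eq)
    also have "\<dots> = v (?G \<xi>) + v (?G \<xi>')"
      by (rule A.tangent_fun_add[OF v A.smooth_nearI[OF G(1) p] A.smooth_nearI[OF G(2) p]])
    also have "\<dots> = (g (\<iota> p) (D p v \<xi>) (\<eta> p) + g (\<iota> p) (\<xi> p) (D p v \<eta>))
        + (g (\<iota> p) (D p v \<xi>') (\<eta> p) + g (\<iota> p) (\<xi>' p) (D p v \<eta>))"
      using P p v by (simp add: metric_compatible_def)
    also have "\<dots> = g (\<iota> p) (D p v (\<lambda>q. \<xi> q + \<xi>' q)) (\<eta> p) + g (\<iota> p) (\<xi> p + \<xi>' p) (D p v \<eta>)"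
      unfolding conn_add[OF \<xi> p v] GB.add_left[OF t(3,4,5)] GB.add_left[OF t(1,2,6)] by simp
    finally show ?thesis .
  qed
  then show "metric_compatible S (\<lambda>q. \<xi> q + \<xi>' q) \<eta>"
    using A.smooth_fun_on_cong[OF A.smooth_fun_on_add[OF G] eq] by (simp add: metric_compatible_def)
qed

lemma metric_compatible_chart:
  assumes V: "(V, \<psi>) \<in> B" "\<iota> ` S \<subseteq> V" and \<xi>: "field S \<xi>" and \<eta>: "field S \<eta>"
  shows "metric_compatible S \<xi> \<eta>"
proof (rule metric_compatible_left[OF V \<xi> \<eta>])
  note oS = field_open[OF \<xi>]
  note e = chart_field_along[OF V(1) oS V(2)]
  fix b
  have "metric_compatible S \<eta> (\<lambda>q. B.chart_vec V \<psi> (\<iota> q) b)"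
    by (rule metric_compatible_left[OF V \<eta> e metric_compatible_frame[OF V oS]])
  then show "metric_compatible S (\<lambda>q. B.chart_vec V \<psi> (\<iota> q) b) \<eta>"
    by (rule metric_compatible_sym[OF \<eta> e])
qed

lemma g_smooth:
  assumes "field S \<xi>" "field S \<eta>"
  shows "smooth_fun_on A S (\<lambda>q. g (\<iota> q) (\<xi> q) (\<eta> q))"
proof (rule A.smooth_fun_on_local[OF field_open[OF assms(1)]])
  fix p assume "p \<in> S"
  then obtain V \<psi> S' where *: "(V, \<psi>) \<in> B" "open S'" "p \<in> S'" "S' \<subseteq> S" "\<iota> ` S' \<subseteq> V"
    using chart_restrict[OF field_open[OF assms(1)]] by metis
  show "\<exists>N. p \<in> N \<and> smooth_fun_on A N (\<lambda>q. g (\<iota> q) (\<xi> q) (\<eta> q))"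
    using metric_compatible_chart[OF *(1,5) assms[THEN field_subset, OF *(2,4)]] *(3)
    by (intro exI[of _ S']) (simp add: metric_compatible_def)
qed

lemma conn_metric:
  assumes "field S \<xi>" "field S \<eta>" "p \<in> S" "v \<in> tangent_space A p"
  shows "v (\<lambda>q. g (\<iota> q) (\<xi> q) (\<eta> q)) = g (\<iota> p) (D p v \<xi>) (\<eta> p) + g (\<iota> p) (\<xi> p) (D p v \<eta>)"
proof -
  obtain V \<psi> S' where *: "(V, \<psi>) \<in> B" "open S'" "p \<in> S'" "S' \<subseteq> S" "\<iota> ` S' \<subseteq> V"
    using chart_restrict[OF field_open[OF assms(1)] assms(3)] by metis
  show ?thesis
    using metric_compatible_chart[OF *(1,5) assms(1,2)[THEN field_subset, OF *(2,4)]] *(3) assms(4)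
    by (simp add: metric_compatible_def)
qed

section \<open>The second fundamental form\<close>

lemma vf_open: "vector_field A S X \<Longrightarrow> open S"
  unfolding vector_field_eq by (rule M.field_open)

lemma vf_tangent: "vector_field A S X \<Longrightarrow> p \<in> S \<Longrightarrow> X p \<in> tangent_space A p"
  unfolding vector_field_eq by (rule M.field_tangent)

lemma vf_subset: "vector_field A S X \<Longrightarrow> open T \<Longrightarrow> T \<subseteq> S \<Longrightarrow> vector_field A T X"
  unfolding vector_field_eq by (rule M.field_subset)

lemma vf_smooth:
  assumes "vector_field A S X" "smooth_fun_on A T h"
  shows "smooth_fun_on A (S \<inter> T) (\<lambda>p. X p h)"
  using M.field_smooth[OF assms(1)[unfolded vector_field_eq] assms(2)] by (simp add: vimage_def)

lemma nabla_vf: "vector_field A S X \<Longrightarrow> vector_field A S Y \<Longrightarrow> vector_field A S (\<lambda>p. nablaA p (X p) Y)"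
  using M.conn_field by (simp add: vector_field_eq)

lemma nabla_tangent:
  "vector_field A S Y \<Longrightarrow> p \<in> S \<Longrightarrow> v \<in> tangent_space A p \<Longrightarrow> nablaA p v Y \<in> tangent_space A p"
  using M.conn_tangent by (simp add: vector_field_eq)

text \<open>Since the connection is torsion-free, the bracket is a difference of two covariant
  derivatives and inherits their smoothness.\<close>

lemma bracket_vf:
  assumes "vector_field A S X" "vector_field A S Y"
  shows "vector_field A S (lie_bracket A X Y)"
  unfolding vector_field_eq
  by (rule M.field_cong[OF M.field_diff[OF nabla_vf[OF assms, unfolded vector_field_eq]
      nabla_vf[OF assms(2,1), unfolded vector_field_eq]]])
     (rule lcA_torsion[OF assms])

lemma bracket_tangent:
  "vector_field A S X \<Longrightarrow> vector_field A S Y \<Longrightarrow> p \<in> S \<Longrightarrow> lie_bracket A X Y p \<in> tangent_space A p"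
  by (rule vf_tangent[OF bracket_vf])

text \<open>Coordinate fields commute: each has constant components, so their bracket annihilates
  all coordinate functions.\<close>

lemma chart_frame_torsion_free:
  assumes V: "(V, \<psi>) \<in> B" "x \<in> V"
  shows "nablaB x (B.chart_vec V \<psi> x b) (\<lambda>y. B.chart_vec V \<psi> y c)
    = nablaB x (B.chart_vec V \<psi> x c) (\<lambda>y. B.chart_vec V \<psi> y b)"
proof -
  let ?Y = "\<lambda>b y. B.chart_vec V \<psi> y b"
  note Y = B.chart_vector_field[OF V(1)]
  let ?L = "lie_bracket B (?Y b) (?Y c) x"
  note tor = lcB_torsion[OF Y[of b] Y[of c] V(2)]
  note t = B.chart_vec_in_tangent_space[OF V]
  have "nablaB x (?Y b x) (?Y c) \<in> tangent_space B x" for b c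
    by (rule N.conn_tangent[OF Y[unfolded vector_field_B_eq] V(2) t])
  \<comment> \<open>Tangency of the bracket comes from the torsion identity; only then may it be
    expanded in coordinates.\<close>
  then have L: "?L \<in> tangent_space B x"
    unfolding tor[symmetric] by (intro B.tangent_diff)
  have z: "?Y b x (\<lambda>y. ?Y c y (\<lambda>z. \<psi> z \<bullet> d)) = 0" for b c d
  proof -
    have "?Y b x (\<lambda>y. ?Y c y (\<lambda>z. \<psi> z \<bullet> d)) = ?Y b x (\<lambda>y. c \<bullet> d)"
      by (rule B.tangent_fun_cong[OF t B.chart_props(1)[OF V(1)] V(2)]) (rule B.chart_vec_coord[OF V(1)])
    then show ?thesis by (simp add: B.tangent_fun_const[OF t])
  qed
  have "?L (\<lambda>z. \<psi> z \<bullet> d) = 0" for d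
    using B.smooth_nearI[OF B.smooth_fun_on_coord[OF V(1)] V(2)] by (simp add: lie_bracket_def z)
  then have "?L = 0" using B.tangent_chart_expansion[OF V L] by simp
  then show ?thesis using tor by simp
qed

text \<open>The classical coordinate formula. The \<open>c b\<close> are the components of
  \<open>\<iota>\<close> in the chart; the first sum differentiates the components of the pushed
  field, the second contains the Christoffel terms, bilinear in \<open>Y p\<close> and
  \<open>v\<close>.\<close>

lemma conn_push_chart:
  assumes V: "(V, \<psi>) \<in> B" "\<iota> ` S \<subseteq> V" and Y: "vector_field A S Y" and p: "p \<in> S" and v: "v \<in> tangent_space A p"
  defines "e \<equiv> \<lambda>b q. B.chart_vec V \<psi> (\<iota> q) b"
    and "c \<equiv> \<lambda>b. (\<lambda>x. \<psi> x \<bullet> b) \<circ> \<iota>"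
  shows "D p v (\<lambda>q. push B \<iota> q (Y q)) = (\<Sum>b\<in>Basis. v (\<lambda>q. Y q (c b)) *\<^sub>R e b p)
    + (\<Sum>b\<in>Basis. \<Sum>a\<in>Basis. (Y p (c b) * v (c a)) *\<^sub>R nablaB (\<iota> p) (e a p) (\<lambda>x. B.chart_vec V \<psi> x b))"
proof -
  note oS = vf_open[OF Y]
  have e: "field S (e b)" for b unfolding e_def by (rule chart_field_along[OF V(1) oS V(2)])
  have c: "smooth_fun_on A (\<iota> -` V) (c b)" for b
    unfolding c_def by (rule smooth_fun_on_compose[OF B.smooth_fun_on_coord[OF V(1)]])
  have y: "smooth_fun_on A S (\<lambda>q. Y q (c b))" for b
    by (rule A.smooth_fun_on_subset[OF vf_smooth[OF Y c] oS]) (use V(2) in auto)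
  have expand: "push B \<iota> q w = (\<Sum>b\<in>Basis. w (c b) *\<^sub>R e b q)" if "q \<in> S" "w \<in> tangent_space A q" for q w
  proof -
    have \<iota>q: "\<iota> q \<in> V" using V(2) that by auto
    have "push B \<iota> q w (\<lambda>x. \<psi> x \<bullet> b) = w (c b)" for b
      using B.smooth_nearI[OF B.smooth_fun_on_coord[OF V(1)] \<iota>q] by (simp add: push_def c_def)
    then show ?thesis
      using B.tangent_chart_expansion[OF V(1) \<iota>q push_tangent[OF that(2)]] by (simp add: e_def)
  qed
  have \<iota>p: "\<iota> p \<in> V" using V(2) p by auto
  have De: "D p v (e b) = (\<Sum>a\<in>Basis. v (c a) *\<^sub>R nablaB (\<iota> p) (e a p) (\<lambda>x. B.chart_vec V \<psi> x b))" for b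
  proof -
    have "D p v (e b) = nablaB (\<iota> p) (push B \<iota> p v) (\<lambda>x. B.chart_vec V \<psi> x b)"
      unfolding e_def by (rule pullback[OF B.chart_vector_field[OF V(1)] \<iota>p v])
    also have "\<dots> = (\<Sum>a\<in>Basis. v (c a) *\<^sub>R nablaB (\<iota> p) (e a p) (\<lambda>x. B.chart_vec V \<psi> x b))"
      unfolding expand[OF p v]
      by (rule N.conn_vec_sum[OF B.chart_vector_field[OF V(1), unfolded vector_field_B_eq] \<iota>p])
         (simp add: e_def B.chart_vec_in_tangent_space[OF V(1) \<iota>p])
    finally show ?thesis .
  qed
  have "D p v (\<lambda>q. push B \<iota> q (Y q)) = D p v (\<lambda>q. \<Sum>b\<in>Basis. Y q (c b) *\<^sub>R e b q)"
    by (rule conn_cong[OF push_field[OF Y] field_sum[OF oS field_scale[OF y e]] p v])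
       (rule expand[OF _ vf_tangent[OF Y]])
  also have "\<dots> = (\<Sum>b\<in>Basis. D p v (\<lambda>q. Y q (c b) *\<^sub>R e b q))"
    by (rule conn_sum[OF oS field_scale[OF y e] p v])
  also have "\<dots> = (\<Sum>b\<in>Basis. v (\<lambda>q. Y q (c b)) *\<^sub>R e b p + Y p (c b) *\<^sub>R D p v (e b))"
    by (rule sum.cong[OF refl]) (rule conn_scale[OF e y p v])
  finally show ?thesis
    unfolding De by (simp add: sum.distrib scaleR_sum_right)
qed

text \<open>In the difference of the two coordinate formulas the Christoffel terms cancel by their
  symmetry in the frame indices, and the derivative terms are the components of the pushed
  bracket.\<close>

lemma pullback_torsion:
  assumes X: "vector_field A S X" and Y: "vector_field A S Y" and p: "p \<in> S"
  shows "D p (X p) (\<lambda>q. push B \<iota> q (Y q)) - D p (Y p) (\<lambda>q. push B \<iota> q (X q))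
    = push B \<iota> p (lie_bracket A X Y p)"
proof -
  obtain V \<psi> S' where *: "(V, \<psi>) \<in> B" "open S'" "p \<in> S'" "S' \<subseteq> S" "\<iota> ` S' \<subseteq> V"
    using chart_restrict[OF vf_open[OF X] p] by metis
  note X' = vf_subset[OF X *(2,4)] and Y' = vf_subset[OF Y *(2,4)]
  have \<iota>p: "\<iota> p \<in> V" using * by auto
  let ?e = "\<lambda>b. B.chart_vec V \<psi> (\<iota> p) b"
  let ?c = "\<lambda>b. (\<lambda>x. \<psi> x \<bullet> b) \<circ> \<iota>"
  let ?\<Gamma> = "\<lambda>a b. nablaB (\<iota> p) (?e a) (\<lambda>x. B.chart_vec V \<psi> x b)"
  have "(\<Sum>b\<in>Basis. \<Sum>a\<in>Basis. (Y p (?c b) * X p (?c a)) *\<^sub>R ?\<Gamma> a b)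
      = (\<Sum>a\<in>Basis. \<Sum>b\<in>Basis. (Y p (?c b) * X p (?c a)) *\<^sub>R ?\<Gamma> a b)" by (rule sum.swap)
  also have "\<dots> = (\<Sum>b\<in>Basis. \<Sum>a\<in>Basis. (X p (?c b) * Y p (?c a)) *\<^sub>R ?\<Gamma> a b)"
    using chart_frame_torsion_free[OF *(1) \<iota>p] by (simp add: mult.commute)
  finally have eq: "(\<Sum>b\<in>Basis. \<Sum>a\<in>Basis. (Y p (?c b) * X p (?c a)) *\<^sub>R ?\<Gamma> a b)
      = (\<Sum>b\<in>Basis. \<Sum>a\<in>Basis. (X p (?c b) * Y p (?c a)) *\<^sub>R ?\<Gamma> a b)" .
  have br: "lie_bracket A X Y p \<in> tangent_space A p" by (rule bracket_tangent[OF X Y p])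
  have sm: "smooth_near B (\<iota> p) (\<lambda>x. \<psi> x \<bullet> b)" for b
    by (rule B.smooth_nearI[OF B.smooth_fun_on_coord[OF *(1)] \<iota>p])
  have "push B \<iota> p (lie_bracket A X Y p) (\<lambda>x. \<psi> x \<bullet> b) = X p (\<lambda>q. Y q (?c b)) - Y p (\<lambda>q. X q (?c b))" for b
    using sm smooth_near_compose[OF sm] by (simp add: push_def lie_bracket_def)
  then have "push B \<iota> p (lie_bracket A X Y p)
      = (\<Sum>b\<in>Basis. (X p (\<lambda>q. Y q (?c b)) - Y p (\<lambda>q. X q (?c b))) *\<^sub>R ?e b)"
    using B.tangent_chart_expansion[OF *(1) \<iota>p push_tangent[OF br]] by simp
  moreover note conn_push_chart[OF *(1,5) Y' *(3) vf_tangent[OF X p]]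
    conn_push_chart[OF *(1,5) X' *(3) vf_tangent[OF Y p]]
  ultimately show ?thesis
    using eq by (simp add: scaleR_diff_left sum_subtractf)
qed

abbreviation sff :: "('a \<Rightarrow> 'a tangent) \<Rightarrow> ('a \<Rightarrow> 'a tangent) \<Rightarrow> 'a \<Rightarrow> 'b tangent" where
  "sff \<equiv> second_fundamental_form B \<iota> nablaA D"

lemma push_diff: "push B \<iota> p (u - v) = push B \<iota> p u - push B \<iota> p v"
  by (rule linear_diff[OF push_linear])

lemma push_neg: "push B \<iota> p (- v) = - push B \<iota> p v"
  by (rule linear_neg[OF push_linear])

lemma push_zero: "push B \<iota> p 0 = 0"
  by (rule linear_0[OF push_linear])

lemma sff_field:
  assumes "vector_field A S X" "vector_field A S Y"
  shows "field S (sff X Y)"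
  unfolding second_fundamental_form_def
  by (intro field_diff conn_field push_field assms nabla_vf)

lemma sff_sym:
  assumes "vector_field A S X" "vector_field A S Y" "p \<in> S"
  shows "sff X Y p = sff Y X p"
  using pullback_torsion[OF assms] push_diff[of p "nablaA p (X p) Y" "nablaA p (Y p) X"]
  unfolding second_fundamental_form_def lcA_torsion[OF assms] by (simp add: algebra_simps)

text \<open>The extension has constant coordinates. It turns identities for fields into identities
  for single vectors, at the price of a smaller domain.\<close>

lemma vf_extension:
  assumes "open S" "p \<in> S" "w \<in> tangent_space A p"
  obtains S' X where "open S'" "p \<in> S'" "S' \<subseteq> S" "vector_field A S' X" "X p = w"
proof -
  obtain U \<phi> where c: "(U, \<phi>) \<in> A" "p \<in> U" by (rule A.chart_at)
  obtain w' where w': "w = A.chart_vec U \<phi> p w'" using assms(3) A.tangent_space_eq[OF c] by blast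
  show ?thesis
    by (rule that[of "S \<inter> U" "\<lambda>q. A.chart_vec U \<phi> q w'"])
       (use assms(1,2) c A.chart_props(1)[OF c(1)] vf_subset[OF A.chart_vector_field[OF c(1)], of "S \<inter> U"] w'
        in \<open>simp_all add: open_Int\<close>)
qed

text \<open>The derivative of <Y, Z> in direction X is computed with \<open>D\<close> and with
  \<open>nablaA\<close>; both are metric, and the difference of the two results is this sum.\<close>

lemma sff_skew:
  assumes "vector_field A S X" "vector_field A S Y" "vector_field A S Z" "p \<in> S"
  shows "g (\<iota> p) (sff X Y p) (push B \<iota> p (Z p)) + g (\<iota> p) (sff X Z p) (push B \<iota> p (Y p)) = 0"
proof -
  let ?i = "\<lambda>Y q. push B \<iota> q (Y q)"
  note v = vf_tangent[OF assms(1,4)]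
  note F = push_field[OF assms(2)] push_field[OF assms(3)]
  note t = F[THEN field_tangent, OF assms(4)] F[THEN conn_tangent, OF assms(4) v]
    assms(2,3)[THEN nabla_tangent, OF assms(4) v, THEN push_tangent]
  have "g (\<iota> p) (D p (X p) (?i Y)) (?i Z p) + g (\<iota> p) (?i Y p) (D p (X p) (?i Z))
      = gA p (nablaA p (X p) Y) (Z p) + gA p (Y p) (nablaA p (X p) Z)"
    using conn_metric[OF F assms(4) v] lcA_metric[OF assms(2-4) v] by (simp add: induced_metric_def)
  then show ?thesis
    using GB.sym[OF t(1,4)] GB.sym[OF t(1,6)]
    by (simp add: second_fundamental_form_def GB.diff_left t induced_metric_def)
qed

text \<open>A trilinear form symmetric in the first two and skew in the last two arguments vanishes.\<close>

lemma sff_normal_fields: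
  assumes "vector_field A S X" "vector_field A S Y" "vector_field A S Z" "p \<in> S"
  shows "g (\<iota> p) (sff X Y p) (push B \<iota> p (Z p)) = 0"
  using sff_skew[OF assms(1,2,3,4)] sff_skew[OF assms(3,1,2,4)] sff_skew[OF assms(2,3,1,4)]
    sff_sym[OF assms(1,2,4)] sff_sym[OF assms(1,3,4)] sff_sym[OF assms(2,3,4)] by simp

lemma sff_normal:
  assumes "vector_field A S X" "vector_field A S Y" "p \<in> S"
  shows "sff X Y p \<in> normal_space A B \<iota> g p"
proof -
  have "g (\<iota> p) (sff X Y p) (push B \<iota> p w) = 0" if w: "w \<in> tangent_space A p" for w
  proof -
    obtain S' Z where *: "open S'" "p \<in> S'" "S' \<subseteq> S" "vector_field A S' Z" "Z p = w"
      using vf_extension[OF vf_open[OF assms(1)] assms(3) w] by metis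
    show ?thesis
      using sff_normal_fields[OF assms(1,2)[THEN vf_subset, OF *(1,3)] *(4,2)] *(5) by simp
  qed
  then show ?thesis
    using field_tangent[OF sff_field[OF assms(1,2)] assms(3)] by (simp add: normal_space_def)
qed

section \<open>Orthogonal frames and normal projection\<close>

lemma gA_smooth:
  assumes "vector_field A S X" "vector_field A S Y"
  shows "smooth_fun_on A S (\<lambda>q. gA q (X q) (Y q))"
  using g_smooth[OF assms[THEN push_field]] by (simp add: induced_metric_def)

text \<open>Coordinates make \<open>chart_vec\<close> injective, so the independence of
  \<open>Basis\<close> carries over. This prevents a Gram-Schmidt step from producing a zero
  vector.\<close>

lemma chart_vec_notin_span:
  assumes c: "(U, \<phi>) \<in> A" "q \<in> U" and b: "b \<in> Basis" "b \<notin> I" and I: "I \<subseteq> Basis"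
  shows "A.chart_vec U \<phi> q b \<notin> span (A.chart_vec U \<phi> q ` I)"
proof
  assume "A.chart_vec U \<phi> q b \<in> span (A.chart_vec U \<phi> q ` I)"
  then have "A.chart_vec U \<phi> q b \<in> A.chart_vec U \<phi> q ` span I"
    by (simp only: linear_span_image[OF A.chart_vec_linear[OF c]])
  then obtain w where w: "A.chart_vec U \<phi> q b = A.chart_vec U \<phi> q w" "w \<in> span I"
    by (rule imageE)
  have "b \<bullet> d = w \<bullet> d" for d
    using A.chart_vec_coord[OF c, of b d] A.chart_vec_coord[OF c, of w d] unfolding w(1) by (rule trans[OF sym])
  then have "b = w" by (metis euclidean_eqI)
  moreover have "span I \<subseteq> span (Basis - {b})" using b I by (intro span_mono) auto
  ultimately have "b \<in> span (Basis - {b})" using w(2) by auto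
  then show False using independent_Basis b(1) unfolding dependent_def by blast
qed

text \<open>The fields are orthogonal but not normalized: projection coefficients are then quotients
  of smooth functions, and no square roots arise.\<close>

definition orthogonal_frame :: "'a set \<Rightarrow> ('a \<Rightarrow> 'a tangent) set \<Rightarrow> bool" where
  "orthogonal_frame U L \<longleftrightarrow> finite L \<and> (\<forall>E\<in>L. vector_field A U E) \<and> (\<forall>q\<in>U. (\<forall>E\<in>L. E q \<noteq> 0) \<and>
    (\<forall>E\<in>L. \<forall>F\<in>L. E \<noteq> F \<longrightarrow> gA q (E q) (F q) = 0))"

lemma orthogonal_frameD:
  assumes "orthogonal_frame U L"
  shows "finite L" "\<And>E. E \<in> L \<Longrightarrow> vector_field A U E"
    "\<And>q E. q \<in> U \<Longrightarrow> E \<in> L \<Longrightarrow> E q \<noteq> 0"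
    "\<And>q E F. q \<in> U \<Longrightarrow> E \<in> L \<Longrightarrow> F \<in> L \<Longrightarrow> E \<noteq> F \<Longrightarrow> gA q (E q) (F q) = 0"
  using assms by (simp_all add: orthogonal_frame_def)

text \<open>Keeping the span equal to that of coordinate vectors at every point of \<open>U\<close>
  is the invariant that makes each new field nowhere zero on \<open>U\<close>.\<close>

lemma gram_schmidt:
  assumes c: "(U, \<phi>) \<in> A" and I: "finite I" "I \<subseteq> Basis"
  shows "\<exists>L. orthogonal_frame U L \<and> (\<forall>q\<in>U. span ((\<lambda>E. E q) ` L) = span (A.chart_vec U \<phi> q ` I))"
  using I
proof (induction I rule: finite_induct)
  case empty
  show ?case by (rule exI[of _ "{}"]) (simp add: orthogonal_frame_def)
next
  case (insert b I)
  then have "\<exists>L. orthogonal_frame U L \<and> (\<forall>q\<in>U. span ((\<lambda>E. E q) ` L) = span (A.chart_vec U \<phi> q ` I))"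
    by simp
  then obtain L where frame: "orthogonal_frame U L"
    and spanL: "\<forall>q\<in>U. span ((\<lambda>E. E q) ` L) = span (A.chart_vec U \<phi> q ` I)"
    by (elim exE conjE)
  note L = orthogonal_frameD[OF frame] bspec[OF spanL]
  note oU = A.chart_props(1)[OF c]
  note Lt = vf_tangent[OF L(2)]
  define X where "X = (\<lambda>q. A.chart_vec U \<phi> q b)"
  \<comment> \<open>Pointwise orthogonal projection of \<open>X\<close> onto the span of the fields
    found so far.\<close>
  define l where "l = (\<lambda>q. \<Sum>E\<in>L. (gA q (X q) (E q) / gA q (E q) (E q)) *\<^sub>R E q)"
  define F where "F = (\<lambda>q. X q - l q)"
  have X: "vector_field A U X" unfolding X_def by (rule A.chart_vector_field[OF c])
  have nz: "gA q (E q) (E q) \<noteq> 0" if "E \<in> L" "q \<in> U" for E q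
    using GA.pos[OF Lt[OF that] L(3)[OF that(2,1)]] by simp
  have l: "vector_field A U l"
    unfolding l_def vector_field_eq
    by (intro M.field_sum[OF oU] M.field_scale A.smooth_fun_on_divide gA_smooth X L(2) nz
        L(2)[unfolded vector_field_eq])
  have F: "vector_field A U F"
    using M.field_diff X l by (simp add: F_def vector_field_eq)
  have lspan: "l q \<in> span ((\<lambda>E. E q) ` L)" for q
    unfolding l_def by (intro span_sum span_scale span_base) auto
  have Fnz: "F q \<noteq> 0" if q: "q \<in> U" for q
    using chart_vec_notin_span[OF c q _ insert.hyps(2)] insert.prems lspan[of q]
    unfolding L(5)[OF q] by (auto simp: F_def X_def)
  have orth: "gA q (F q) (E q) = 0" if q: "q \<in> U" and E: "E \<in> L" for q E
  proof -
    have "gA q (l q) (E q) = gA q (X q) (E q)"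
      unfolding l_def by (rule GA.orthogonal_coeff[OF L(1) _ _ _ E]) (use Lt q L(3,4)[OF q] in auto)
    then show ?thesis
      by (simp add: F_def GA.diff_left vf_tangent[OF X q] vf_tangent[OF l q] Lt[OF E q])
  qed
  have orth': "gA q (E q) (F q) = 0" if q: "q \<in> U" and E: "E \<in> L" for q E
    using orth[OF that] GA.sym[OF vf_tangent[OF F q] Lt[OF E q]] by simp
  have span: "span ((\<lambda>E. E q) ` insert F L) = span (A.chart_vec U \<phi> q ` insert b I)" if q: "q \<in> U" for q
  proof -
    have "F q - X q \<in> span ((\<lambda>E. E q) ` L)" using span_neg[OF lspan[of q]] by (simp add: F_def)
    then have "span (insert (F q) ((\<lambda>E. E q) ` L)) = span (insert (X q) ((\<lambda>E. E q) ` L))"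
      by (rule eq_span_insert_eq)
    also have "\<dots> = span (insert (X q) (A.chart_vec U \<phi> q ` I))"
      using L(5)[OF q] by (simp add: span_insert)
    finally show ?thesis by (simp add: X_def)
  qed
  have "orthogonal_frame U (insert F L)"
    unfolding orthogonal_frame_def
  proof (intro conjI ballI)
    show "finite (insert F L)" using L(1) by simp
    show "vector_field A U E" if "E \<in> insert F L" for E using that F L(2)[of E] by auto
    fix q assume q: "q \<in> U"
    show "E q \<noteq> 0" if "E \<in> insert F L" for E using that Fnz[OF q] L(3)[OF q, of E] by auto
    show "E \<noteq> G \<longrightarrow> gA q (E q) (G q) = 0" if "E \<in> insert F L" "G \<in> insert F L" for E G
      using that orth[OF q, of G] orth'[OF q, of E] L(4)[OF q, of E G] by auto
  qed
  then show ?case using span by (intro exI[of _ "insert F L"]) simp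
qed

lemma ex_orthogonal_frame:
  obtains U L where "open U" "p \<in> U" "orthogonal_frame U L"
    "\<forall>q\<in>U. tangent_space A q \<subseteq> span ((\<lambda>E. E q) ` L)"
proof -
  obtain U \<phi> where c: "(U, \<phi>) \<in> A" "p \<in> U" by (rule A.chart_at)
  obtain L where L: "orthogonal_frame U L" and
    span: "\<forall>q\<in>U. span ((\<lambda>E. E q) ` L) = span (A.chart_vec U \<phi> q ` Basis)"
    using gram_schmidt[OF c(1) finite_Basis subset_refl] by (elim exE conjE)
  have "tangent_space A q \<subseteq> span ((\<lambda>E. E q) ` L)" if q: "q \<in> U" for q
    unfolding bspec[OF span q]
  proof
    fix w assume "w \<in> tangent_space A q"
    note e = A.tangent_chart_expansion[OF c(1) q this]
    have "(\<Sum>b\<in>Basis. w (\<lambda>x. \<phi> x \<bullet> b) *\<^sub>R A.chart_vec U \<phi> q b) \<in> span (A.chart_vec U \<phi> q ` Basis)"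
      by (intro span_sum span_scale span_base imageI)
    then show "w \<in> span (A.chart_vec U \<phi> q ` Basis)"
      by (rule subst[where P = "\<lambda>x. x \<in> span (A.chart_vec U \<phi> q ` Basis)", OF sym[OF e]])
  qed
  then show ?thesis
    by (intro that[OF A.chart_props(1)[OF c(1)] c(2) L] ballI)
qed

section \<open>Tangential and normal parts\<close>

abbreviation NS :: "'a \<Rightarrow> 'b tangent set" where "NS \<equiv> normal_space A B \<iota> g"

abbreviation np :: "'a \<Rightarrow> 'b tangent \<Rightarrow> 'b tangent" where "np \<equiv> normal_part A B \<iota> g"

lemma NS_tangent: "\<nu> \<in> NS p \<Longrightarrow> \<nu> \<in> tangent_space B (\<iota> p)"
  by (simp add: normal_space_def)

lemma NS_orth: "\<nu> \<in> NS p \<Longrightarrow> u \<in> tangent_space A p \<Longrightarrow> g (\<iota> p) \<nu> (push B \<iota> p u) = 0"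
  by (simp add: normal_space_def)

lemma NS_zero: "0 \<in> NS p"
  by (simp add: normal_space_def B.tangent_0 GB.zero_left push_tangent)

lemma NS_add: "\<mu> \<in> NS p \<Longrightarrow> \<nu> \<in> NS p \<Longrightarrow> \<mu> + \<nu> \<in> NS p"
  by (simp add: normal_space_def B.tangent_add GB.add_left push_tangent)

lemma NS_neg: "\<nu> \<in> NS p \<Longrightarrow> - \<nu> \<in> NS p"
  by (simp add: normal_space_def B.tangent_neg GB.neg_left push_tangent)

lemma NS_push_eq_0:
  assumes "push B \<iota> p u \<in> NS p" "u \<in> tangent_space A p"
  shows "push B \<iota> p u = 0"
  using NS_orth[OF assms] GB.eq_0I[OF push_tangent[OF assms(2)]] by simp

text \<open>\<open>normal_part\<close> is a definite description. Uniqueness holds because a vector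
  that is both tangential and normal is orthogonal to itself.\<close>

lemma normal_part_eqI:
  assumes "\<nu> \<in> NS p" "u \<in> tangent_space A p" "w = push B \<iota> p u + \<nu>"
  shows "np p w = \<nu>"
  unfolding normal_part_def
proof (rule the_equality)
  show "\<nu> \<in> NS p \<and> w - \<nu> \<in> push B \<iota> p ` tangent_space A p" using assms by auto
  fix \<mu> assume \<mu>: "\<mu> \<in> NS p \<and> w - \<mu> \<in> push B \<iota> p ` tangent_space A p"
  then obtain u' where u': "u' \<in> tangent_space A p" "w - \<mu> = push B \<iota> p u'" by blast
  have eq: "push B \<iota> p (u' - u) = \<nu> + (- \<mu>)" unfolding push_diff using u'(2) assms(3) by (simp add: algebra_simps)
  have "push B \<iota> p (u' - u) \<in> NS p"
    unfolding eq by (rule NS_add[OF assms(1) NS_neg]) (use \<mu> in simp)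
  then have "\<nu> + (- \<mu>) = 0"
    using NS_push_eq_0[of p "u' - u"] A.tangent_diff[OF u'(1) assms(2)] eq by simp
  then show "\<mu> = \<nu>" by simp
qed

text \<open>The tangential part is the orthogonal projection, written in a frame evaluated at
  \<open>p\<close>.\<close>

lemma normal_decomposition:
  assumes w: "w \<in> tangent_space B (\<iota> p)"
  obtains u \<nu> where "u \<in> tangent_space A p" "\<nu> \<in> NS p" "w = push B \<iota> p u + \<nu>"
proof -
  obtain U L where p: "p \<in> U" and frame: "orthogonal_frame U L"
    and spanL: "\<forall>q\<in>U. tangent_space A q \<subseteq> span ((\<lambda>E. E q) ` L)"
    by (rule ex_orthogonal_frame[of p])
  note L = orthogonal_frameD[OF frame] subsetD[OF bspec[OF spanL]]
  note Lt = vf_tangent[OF L(2) p]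
  define u where "u = (\<Sum>E\<in>L. (g (\<iota> p) w (push B \<iota> p (E p)) / gA p (E p) (E p)) *\<^sub>R E p)"
  have u: "u \<in> tangent_space A p"
    unfolding u_def by (intro subspace_sum[OF A.tangent_subspace] A.tangent_scale Lt)
  have 0: "g (\<iota> p) (w - push B \<iota> p u) (push B \<iota> p (E p)) = 0" if E: "E \<in> L" for E
  proof -
    have "gA p u (E p) = g (\<iota> p) w (push B \<iota> p (E p))"
      unfolding u_def by (rule GA.orthogonal_coeff[OF L(1) _ _ _ E]) (use Lt L(3,4)[OF p] in auto)
    then show ?thesis
      by (simp add: GB.diff_left w push_tangent u Lt[OF E] induced_metric_def)
  qed
  have "g (\<iota> p) (w - push B \<iota> p u) (push B \<iota> p v) = 0" if v: "v \<in> tangent_space A p" for v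
  proof (rule GB.orthogonal_span)
    show "w - push B \<iota> p u \<in> tangent_space B (\<iota> p)" by (intro B.tangent_diff w push_tangent u)
    show "push B \<iota> p v \<in> span (push B \<iota> p ` (\<lambda>E. E p) ` L)"
      unfolding linear_span_image[OF push_linear] by (rule imageI[OF L(5)[OF p v]])
    fix x assume "x \<in> push B \<iota> p ` (\<lambda>E. E p) ` L"
    then obtain E where E: "E \<in> L" "x = push B \<iota> p (E p)" by auto
    show "x \<in> tangent_space B (\<iota> p)" unfolding E(2) by (rule push_tangent[OF Lt[OF E(1)]])
    show "g (\<iota> p) (w - push B \<iota> p u) x = 0" unfolding E(2) by (rule 0[OF E(1)])
  qed
  then have "w - push B \<iota> p u \<in> NS p"
    using B.tangent_diff[OF w push_tangent[OF u]] by (simp add: normal_space_def)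
  then show ?thesis using that[OF u] by simp
qed

text \<open>A smooth field along \<open>\<iota>\<close> with values in the image of \<open>push\<close> comes from a smooth field:
  its coefficients in an orthogonal frame are smooth.\<close>

lemma tangent_field:
  assumes \<xi>: "field S \<xi>" and tan: "\<And>q. q \<in> S \<Longrightarrow> \<xi> q \<in> push B \<iota> q ` tangent_space A q"
  shows "vector_field A S (\<lambda>q. inv_into (tangent_space A q) (push B \<iota> q) (\<xi> q))"
    (is "vector_field A S ?V")
  unfolding vector_field_eq
proof (rule M.field_local[OF field_open[OF \<xi>]])
  have V: "?V q \<in> tangent_space A q" "push B \<iota> q (?V q) = \<xi> q" if "q \<in> S" for q
    using tan[OF that] by (simp_all add: inv_into_into f_inv_into_f)
  fix p assume p: "p \<in> S"
  obtain U L where oU: "open U" "p \<in> U" and frame: "orthogonal_frame U L"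
    and spanL: "\<forall>q\<in>U. tangent_space A q \<subseteq> span ((\<lambda>E. E q) ` L)"
    by (rule ex_orthogonal_frame[of p])
  note L = orthogonal_frameD[OF frame] subsetD[OF bspec[OF spanL]]
  let ?N = "S \<inter> U"
  have oN: "open ?N" using field_open[OF \<xi>] oU(1) by (rule open_Int)
  have LN: "vector_field A ?N E" if "E \<in> L" for E by (rule vf_subset[OF L(2)[OF that] oN]) simp
  have \<xi>N: "field ?N \<xi>" by (rule field_subset[OF \<xi> oN]) simp
  let ?V' = "\<lambda>q. \<Sum>E\<in>L. (g (\<iota> q) (\<xi> q) (push B \<iota> q (E q)) / gA q (E q) (E q)) *\<^sub>R E q"
  have nz: "gA q (E q) (E q) \<noteq> 0" if "E \<in> L" "q \<in> ?N" for E q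
    using GA.pos[OF vf_tangent[OF LN[OF that(1)] that(2)]] L(3)[of q E] that by force
  have V': "vector_field A ?N ?V'"
    unfolding vector_field_eq
    by (intro M.field_sum[OF oN] M.field_scale A.smooth_fun_on_divide gA_smooth g_smooth \<xi>N push_field LN nz
        LN[unfolded vector_field_eq])
  \<comment> \<open>The difference of the two vectors is orthogonal to a frame whose span contains
    it, hence to itself.\<close>
  have eq: "?V' q = ?V q" if q: "q \<in> ?N" for q
  proof -
    note t = vf_tangent[OF V' q] V(1)[of q] vf_tangent[OF LN q]
    have qS: "q \<in> S" "q \<in> U" using q by auto
    have d: "?V' q - ?V q \<in> tangent_space A q" by (rule A.tangent_diff[OF t(1) t(2)[OF qS(1)]])
    have "gA q (?V' q - ?V q) x = 0" if x: "x \<in> (\<lambda>E. E q) ` L" for x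
    proof -
      obtain E where E: "E \<in> L" "x = E q" using x by auto
      have "gA q (?V' q) (E q) = g (\<iota> q) (\<xi> q) (push B \<iota> q (E q))"
        by (rule GA.orthogonal_coeff[OF L(1) _ _ _ E(1)]) (use t(3) L(3,4)[OF qS(2)] in auto)
      moreover have "gA q (?V q) (E q) = g (\<iota> q) (\<xi> q) (push B \<iota> q (E q))"
        unfolding induced_metric_def V(2)[OF qS(1)] ..
      ultimately show ?thesis
        unfolding E(2) using GA.diff_left[OF t(1) t(2)[OF qS(1)] t(3)[OF E(1)]] by simp
    qed
    moreover have "x \<in> tangent_space A q" if "x \<in> (\<lambda>E. E q) ` L" for x using that t(3) by blast
    ultimately have "gA q (?V' q - ?V q) (?V' q - ?V q) = 0"
      by (intro GA.orthogonal_span[OF d _ _ L(5)[OF qS(2) d]])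
    then show ?thesis using GA.eq_0I[OF d] by simp
  qed
  have "M.field ?N ?V"
    by (rule M.field_cong[OF V'[unfolded vector_field_eq] eq])
  then show "\<exists>N. p \<in> N \<and> M.field N ?V" using p oU(2) by (intro exI[of _ ?N]) simp
qed

end

section \<open>Totally real submanifolds with parallel f-structure\<close>

locale totally_real_submanifold = kaehler_submanifold A B \<iota> D g J nablaB nablaA
  for A :: "('a::{t2_space,second_countable_topology}, 'e::euclidean_space) chart set"
    and B :: "('b::{t2_space,second_countable_topology}, 'f::euclidean_space) chart set"
    and \<iota> :: "'a \<Rightarrow> 'b" and D :: "('a, 'b) derivation_op"
    and g :: "'b metric_field" and J :: "'b endo_field" and nablaB :: "('b, 'b) derivation_op"
    and nablaA :: "('a, 'a) derivation_op" +
  assumes treal: "totally_real A B \<iota> g J"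
    and parallel: "parallel_f_structure A B \<iota> g J D"
begin

lemma J_push_NS: "u \<in> tangent_space A p \<Longrightarrow> J (\<iota> p) (push B \<iota> p u) \<in> NS p"
  using treal by (simp add: totally_real_def)

lemma J_push_field: "vector_field A S Y \<Longrightarrow> field S (\<lambda>q. J (\<iota> q) (push B \<iota> q (Y q)))"
  by (intro J_field push_field)

lemma conn_J_push:
  assumes "vector_field A S X" "vector_field A S Y" "p \<in> S"
  shows "D p (X p) (\<lambda>q. J (\<iota> q) (push B \<iota> q (Y q)))
    = J (\<iota> p) (sff X Y p) + J (\<iota> p) (push B \<iota> p (nablaA p (X p) Y))"
proof -
  note v = vf_tangent[OF assms(1,3)]
  have "D p (X p) (\<lambda>q. push B \<iota> q (Y q)) = sff X Y p + push B \<iota> p (nablaA p (X p) Y)"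
    by (simp add: second_fundamental_form_def)
  then show ?thesis
    using conn_J[OF push_field[OF assms(2)] assms(3) v]
      J_add[OF field_tangent[OF sff_field[OF assms(1,2)] assms(3)] push_tangent[OF nabla_tangent[OF assms(2,3) v]]]
    by simp
qed

text \<open>Writing \<open>J \<sigma> = P \<sigma> + f \<sigma>\<close>, parallelism of \<open>f\<close> applied to \<open>J Y\<close>, where \<open>f J Y = 0\<close>, gives
  \<open>f\<^sup>2 \<sigma> = 0\<close>, hence \<open>f \<sigma> = 0\<close> as \<open>f\<close> is skew.\<close>

lemma J_sff_tangent:
  assumes X: "vector_field A S X" and Y: "vector_field A S Y" and p: "p \<in> S"
  shows "J (\<iota> p) (sff X Y p) \<in> push B \<iota> p ` tangent_space A p"
proof -
  let ?\<xi> = "\<lambda>q. J (\<iota> q) (push B \<iota> q (Y q))"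
  note oS = vf_open[OF X] and v = vf_tangent[OF X p]
  have n: "nablaA p (X p) Y \<in> tangent_space A p" by (rule nabla_tangent[OF Y p v])
  have nf: "normal_field A B \<iota> g S ?\<xi>"
    unfolding normal_field_def using J_push_field[OF Y] J_push_NS[OF vf_tangent[OF Y]] by simp
  \<comment> \<open>\<open>J\<close> applied to \<open>J Y\<close> is \<open>- Y\<close>, which has
    no normal part.\<close>
  have f0: "f_structure A B \<iota> g J q (?\<xi> q) = 0" if q: "q \<in> S" for q
  proof -
    have "J (\<iota> q) (?\<xi> q) = push B \<iota> q (- Y q) + 0"
      using J_J[OF push_tangent[OF vf_tangent[OF Y q]]] by (simp add: push_neg)
    then show ?thesis
      unfolding f_structure_def by (intro normal_part_eqI[OF NS_zero A.tangent_neg[OF vf_tangent[OF Y q]]])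
  qed
  have "D p (X p) (\<lambda>q. f_structure A B \<iota> g J q (?\<xi> q)) = 0"
  proof -
    have "field S (\<lambda>q. f_structure A B \<iota> g J q (?\<xi> q))"
      by (rule field_cong[OF field_zero[OF oS]]) (simp add: f0)
    from conn_cong[OF this field_zero[OF oS] p v] show ?thesis
      using f0 conn_zero[OF v] by simp
  qed
  moreover have "np p 0 = 0"
    by (rule normal_part_eqI[OF NS_zero A.tangent_0]) (simp add: push_zero)
  moreover have "normal_connection A B \<iota> g D p (X p) (\<lambda>q. f_structure A B \<iota> g J q (?\<xi> q)) -
      f_structure A B \<iota> g J p (normal_connection A B \<iota> g D p (X p) ?\<xi>) = 0"
    using parallel[unfolded parallel_f_structure_def, rule_format, OF conjI[OF X nf] p] .
  ultimately have *: "np p (J (\<iota> p) (np p (D p (X p) ?\<xi>))) = 0"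
    by (simp add: normal_connection_def f_structure_def)
  note \<sigma> = sff_normal[OF X Y p]
  have J\<sigma>: "J (\<iota> p) (sff X Y p) \<in> tangent_space B (\<iota> p)" by (rule J_tangent[OF NS_tangent[OF \<sigma>]])
  \<comment> \<open>Here \<open>\<nu>\<close> is f sigma, so the normal part of the derivative of
    \<open>J Y\<close> below is \<open>\<nu>\<close> plus \<open>J\<close> of the intrinsic
    derivative of \<open>Y\<close>.\<close>
  obtain u \<nu> where u: "u \<in> tangent_space A p" and \<nu>: "\<nu> \<in> NS p" and eq: "J (\<iota> p) (sff X Y p) = push B \<iota> p u + \<nu>"
    by (rule normal_decomposition[OF J\<sigma>])
  let ?n = "nablaA p (X p) Y"
  have "np p (D p (X p) ?\<xi>) = \<nu> + J (\<iota> p) (push B \<iota> p ?n)"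
    by (rule normal_part_eqI[OF NS_add[OF \<nu> J_push_NS[OF n]] u])
       (simp add: conn_J_push[OF X Y p] eq algebra_simps)
  then have "J (\<iota> p) (np p (D p (X p) ?\<xi>)) = J (\<iota> p) \<nu> - push B \<iota> p ?n"
    using J_add[OF NS_tangent[OF \<nu>] J_tangent[OF push_tangent[OF n]]] J_J[OF push_tangent[OF n]] by simp
  with * have **: "np p (J (\<iota> p) \<nu> - push B \<iota> p ?n) = 0" by simp
  note J\<nu> = J_tangent[OF NS_tangent[OF \<nu>]]
  \<comment> \<open>Here \<open>\<mu>\<close> is f^2 sigma. Once it vanishes, \<open>J \<nu>\<close>
    is tangential.\<close>
  obtain a \<mu> where a: "a \<in> tangent_space A p" and \<mu>: "\<mu> \<in> NS p" and J\<nu>_eq: "J (\<iota> p) \<nu> = push B \<iota> p a + \<mu>"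
    by (rule normal_decomposition[OF J\<nu>])
  have "np p (J (\<iota> p) \<nu> - push B \<iota> p ?n) = \<mu>"
    by (rule normal_part_eqI[OF \<mu> A.tangent_diff[OF a n]]) (simp add: J\<nu>_eq push_diff algebra_simps)
  with ** J\<nu>_eq have J\<nu>_tan: "J (\<iota> p) \<nu> = push B \<iota> p a" by simp
  \<comment> \<open>Only the normal component of J sigma pairs with \<open>\<nu>\<close>; shifting
    \<open>J\<close> by skewness then pairs sigma with the tangential
    \<open>J \<nu>\<close>.\<close>
  have "g (\<iota> p) \<nu> \<nu> = g (\<iota> p) (J (\<iota> p) (sff X Y p)) \<nu>"
    unfolding eq using GB.add_left[OF push_tangent[OF u] NS_tangent[OF \<nu>] NS_tangent[OF \<nu>]]
      GB.sym[OF push_tangent[OF u] NS_tangent[OF \<nu>]] NS_orth[OF \<nu> u] by simp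
  also have "\<dots> = 0"
    using J_skew[OF NS_tangent[OF \<sigma>] NS_tangent[OF \<nu>]] NS_orth[OF \<sigma> a] by (simp add: J\<nu>_tan)
  finally have "\<nu> = 0" using GB.eq_0I[OF NS_tangent[OF \<nu>]] by simp
  then show ?thesis using eq u by simp
qed

text \<open>This is the tensor h with sigma = J h. By the total symmetry of the cubic form it is
  also \<open>A_{JY} X\<close>, the shape operator of the normal vector \<open>J Y\<close>.
  \<open>inv_into\<close> picks the unique tangent vector with the given push-forward.\<close>

definition shape :: "('a \<Rightarrow> 'a tangent) \<Rightarrow> ('a \<Rightarrow> 'a tangent) \<Rightarrow> 'a \<Rightarrow> 'a tangent" where
  "shape X Y q = inv_into (tangent_space A q) (push B \<iota> q) (- J (\<iota> q) (sff X Y q))"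

lemma neg_J_sff_tangent:
  assumes "vector_field A S X" "vector_field A S Y" "p \<in> S"
  shows "- J (\<iota> p) (sff X Y p) \<in> push B \<iota> p ` tangent_space A p"
proof -
  obtain u where "u \<in> tangent_space A p" "J (\<iota> p) (sff X Y p) = push B \<iota> p u"
    using J_sff_tangent[OF assms] by blast
  then show ?thesis using A.tangent_neg[of u p] by (intro image_eqI[of _ _ "- u"]) (simp_all add: push_neg)
qed

lemma shape_vf:
  assumes "vector_field A S X" "vector_field A S Y"
  shows "vector_field A S (shape X Y)"
proof -
  have "shape X Y = (\<lambda>q. inv_into (tangent_space A q) (push B \<iota> q) (- J (\<iota> q) (sff X Y q)))"
    by (rule ext) (simp add: shape_def)
  then show ?thesis
    using tangent_field[OF field_neg[OF J_field[OF sff_field[OF assms]]] neg_J_sff_tangent[OF assms]] by simp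
qed

lemma push_shape:
  assumes "vector_field A S X" "vector_field A S Y" "p \<in> S"
  shows "push B \<iota> p (shape X Y p) = - J (\<iota> p) (sff X Y p)"
  unfolding shape_def by (rule f_inv_into_f[OF neg_J_sff_tangent[OF assms]])

lemma sff_shape:
  assumes "vector_field A S X" "vector_field A S Y" "p \<in> S"
  shows "sff X Y p = J (\<iota> p) (push B \<iota> p (shape X Y p))"
proof -
  note \<sigma> = NS_tangent[OF sff_normal[OF assms]]
  show ?thesis unfolding push_shape[OF assms] J_neg[OF J_tangent[OF \<sigma>]] J_J[OF \<sigma>] by simp
qed

text \<open>The derivative of \<open>J V\<close> splits into J sigma, which is tangential by
  \<open>J_sff_tangent\<close>, and \<open>J\<close> of the intrinsic derivative. Agreement of
  \<open>\<xi>\<close> with \<open>J V\<close> is asked on \<open>S\<close> only, because sigma = J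
  h is known only there.\<close>

lemma normal_connection_J_push:
  assumes V: "vector_field A S V" and p: "p \<in> S" and v: "v \<in> tangent_space A p"
    and \<xi>: "field S \<xi>" "\<And>q. q \<in> S \<Longrightarrow> \<xi> q = J (\<iota> q) (push B \<iota> q (V q))"
  shows "normal_connection A B \<iota> g D p v \<xi> = J (\<iota> p) (push B \<iota> p (nablaA p v V))"
proof -
  \<comment> \<open>The second fundamental form takes fields, so the vector \<open>v\<close> has to
    be extended.\<close>
  obtain S' X where S': "open S'" "p \<in> S'" "S' \<subseteq> S" and X: "vector_field A S' X" "X p = v"
    by (rule vf_extension[OF vf_open[OF V] p v])
  note V' = vf_subset[OF V S'(1,3)]
  obtain u where u: "u \<in> tangent_space A p" "J (\<iota> p) (sff X V p) = push B \<iota> p u"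
    using J_sff_tangent[OF X(1) V' S'(2)] by blast
  have "D p v \<xi> = D p v (\<lambda>q. J (\<iota> q) (push B \<iota> q (V q)))"
    by (rule conn_cong[OF \<xi>(1) J_push_field[OF V] p v \<xi>(2)])
  also have "\<dots> = push B \<iota> p u + J (\<iota> p) (push B \<iota> p (nablaA p v V))"
    using conn_J_push[OF X(1) V' S'(2)] unfolding X(2) u(2) .
  finally show ?thesis
    unfolding normal_connection_def
    by (rule normal_part_eqI[OF J_push_NS[OF nabla_tangent[OF V p v]] u(1)])
qed

text \<open>\<open>J\<close> composed with \<open>push\<close> intertwines \<open>nablaA\<close>
  with the normal connection, hence also their curvatures.\<close>

lemma normal_curvature:
  assumes X: "vector_field A S X" and Y: "vector_field A S Y" and V: "vector_field A S V" and p: "p \<in> S"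
    and \<xi>: "field S \<xi>" "\<And>q. q \<in> S \<Longrightarrow> \<xi> q = J (\<iota> q) (push B \<iota> q (V q))"
  shows "curvature A (normal_connection A B \<iota> g D) X Y \<xi> p = J (\<iota> p) (push B \<iota> p (curvature A nablaA X Y V p))"
proof -
  let ?nc = "normal_connection A B \<iota> g D"
  have first: "?nc q (Z q) \<xi> = J (\<iota> q) (push B \<iota> q (nablaA q (Z q) V))" if "vector_field A S Z" "q \<in> S" for Z q
    by (rule normal_connection_J_push[OF V that(2) vf_tangent[OF that] \<xi>])
  \<comment> \<open>A first normal derivative of \<open>\<xi>\<close> is again \<open>J\<close> of a
    pushed field on \<open>S\<close>, so the first-order rule can be iterated.\<close>
  have second: "?nc p (W p) (\<lambda>q. ?nc q (Z q) \<xi>) = J (\<iota> p) (push B \<iota> p (nablaA p (W p) (\<lambda>q. nablaA q (Z q) V)))"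
    if Z: "vector_field A S Z" and W: "vector_field A S W" for Z W
  proof (rule normal_connection_J_push[OF nabla_vf[OF Z V] p vf_tangent[OF W p]])
    show "field S (\<lambda>q. ?nc q (Z q) \<xi>)"
      by (rule field_cong[OF J_push_field[OF nabla_vf[OF Z V]]]) (simp add: first[OF Z])
    show "?nc q (Z q) \<xi> = J (\<iota> q) (push B \<iota> q (nablaA q (Z q) V))" if "q \<in> S" for q
      by (rule first[OF Z that])
  qed
  note b = bracket_tangent[OF X Y p]
  have third: "?nc p (lie_bracket A X Y p) \<xi> = J (\<iota> p) (push B \<iota> p (nablaA p (lie_bracket A X Y p) V))"
    by (rule normal_connection_J_push[OF V p b \<xi>])
  note t = nabla_tangent[OF nabla_vf[OF Y V] p vf_tangent[OF X p]]
    nabla_tangent[OF nabla_vf[OF X V] p vf_tangent[OF Y p]] nabla_tangent[OF V p b]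
  show ?thesis
    unfolding curvature_def second[OF Y X] second[OF X Y] third
    by (simp add: push_diff J_diff push_tangent B.tangent_diff t)
qed

end

section \<open>Curvature of the submanifold\<close>

context kaehler_submanifold
begin

abbreviation R :: "('a \<Rightarrow> 'a tangent) \<Rightarrow> ('a \<Rightarrow> 'a tangent) \<Rightarrow> ('a \<Rightarrow> 'a tangent) \<Rightarrow> 'a \<Rightarrow> 'a tangent" where
  "R \<equiv> curvature A nablaA"

lemma vf_add: "vector_field A S X \<Longrightarrow> vector_field A S Y \<Longrightarrow> vector_field A S (\<lambda>q. X q + Y q)"
  unfolding vector_field_eq by (rule M.field_add)

lemma vf_neg: "vector_field A S X \<Longrightarrow> vector_field A S (\<lambda>q. - X q)"
  unfolding vector_field_eq by (rule M.field_neg)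

lemma R_vf:
  assumes "vector_field A S X" "vector_field A S Y" "vector_field A S Z"
  shows "vector_field A S (R X Y Z)"
proof -
  have "R X Y Z = (\<lambda>p. nablaA p (X p) (\<lambda>q. nablaA q (Y q) Z) - nablaA p (Y p) (\<lambda>q. nablaA q (X q) Z)
      - nablaA p (lie_bracket A X Y p) Z)"
    by (rule ext) (simp add: curvature_def)
  then show ?thesis
    using M.field_diff nabla_vf bracket_vf assms by (simp add: vector_field_eq)
qed

lemma bracket_skew: "lie_bracket A Y X p = - lie_bracket A X Y p"
  by (rule ext) (simp add: lie_bracket_def uminus_apply)

lemma R_skew:
  assumes "vector_field A S X" "vector_field A S Y" "vector_field A S Z" "p \<in> S"
  shows "R Y X Z p = - R X Y Z p"
  unfolding curvature_def bracket_skew[of Y X]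
  using M.conn_vec_neg[OF assms(3)[unfolded vector_field_eq] assms(4) bracket_tangent[OF assms(1,2,4)]]
  by simp

text \<open>The operator XY - YX - [X, Y] annihilates the function <Z, W>. Expanded by the metric
  property it gives the two curvature terms; the mixed products of first derivatives cancel.\<close>

lemma R_metric_skew:
  assumes X: "vector_field A S X" and Y: "vector_field A S Y" and Z: "vector_field A S Z"
    and W: "vector_field A S W" and p: "p \<in> S"
  shows "gA p (R X Y Z p) (W p) = - gA p (Z p) (R X Y W p)"
proof -
  note oS = vf_open[OF X]
  let ?f = "\<lambda>q. gA q (Z q) (W q)"
  have f: "smooth_near A p ?f" by (rule A.smooth_nearI[OF gA_smooth[OF Z W] p])
  have second: "V p (\<lambda>q. U q ?f) = gA p (nablaA p (V p) (\<lambda>q. nablaA q (U q) Z)) (W p)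
      + gA p (nablaA p (U p) Z) (nablaA p (V p) W)
      + gA p (nablaA p (V p) Z) (nablaA p (U p) W) + gA p (Z p) (nablaA p (V p) (\<lambda>q. nablaA q (U q) W))"
    if U: "vector_field A S U" and V: "vector_field A S V" for U V
  proof -
    note v = vf_tangent[OF V p]
    let ?a = "\<lambda>q. gA q (nablaA q (U q) Z) (W q)" and ?b = "\<lambda>q. gA q (Z q) (nablaA q (U q) W)"
    have "V p (\<lambda>q. U q ?f) = V p (\<lambda>q. ?a q + ?b q)"
      by (rule A.tangent_fun_cong[OF v oS p]) (rule lcA_metric[OF Z W _ vf_tangent[OF U]])
    also have "\<dots> = V p ?a + V p ?b"
      by (rule A.tangent_fun_add[OF v])
         (intro A.smooth_nearI[OF _ p] gA_smooth nabla_vf U Z W)+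
    finally show ?thesis
      using lcA_metric[OF nabla_vf[OF U Z] W p v] lcA_metric[OF Z nabla_vf[OF U W] p v] by simp
  qed
  have "lie_bracket A X Y p ?f = X p (\<lambda>q. Y q ?f) - Y p (\<lambda>q. X q ?f)"
    using f by (simp add: lie_bracket_def)
  moreover note lcA_metric[OF Z W p bracket_tangent[OF X Y p]]
  moreover note second[OF Y X] second[OF X Y]
  moreover note xy = vf_tangent[OF X p] vf_tangent[OF Y p] bracket_tangent[OF X Y p]
  note t = nabla_tangent[OF nabla_vf[OF Y Z] p xy(1)] nabla_tangent[OF nabla_vf[OF X Z] p xy(2)]
    nabla_tangent[OF Z p xy(3)] vf_tangent[OF W p] vf_tangent[OF Z p]
    nabla_tangent[OF nabla_vf[OF Y W] p xy(1)] nabla_tangent[OF nabla_vf[OF X W] p xy(2)]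
    nabla_tangent[OF W p xy(3)]
  ultimately show ?thesis
    unfolding curvature_def by (simp add: GA.diff_left GA.diff_right A.tangent_diff t)
qed

text \<open>Writes the double bracket as iterated derivatives of a function \<open>h\<close> smooth
  on \<open>T\<close>, where the inner bracket is given by its formula.\<close>

lemma bracket_bracket:
  assumes X: "vector_field A S X" and Y: "vector_field A S Y" and Z: "vector_field A S Z" and p: "p \<in> S"
    and T: "smooth_fun_on A T h" "p \<in> T"
  shows "lie_bracket A X (lie_bracket A Y Z) p h =
    X p (\<lambda>q. Y q (\<lambda>r. Z r h)) - X p (\<lambda>q. Z q (\<lambda>r. Y r h)) - Y p (\<lambda>q. Z q (\<lambda>r. X r h)) + Z p (\<lambda>q. Y q (\<lambda>r. X r h))"
proof -
  note x = vf_tangent[OF X p]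
  have T1: "smooth_fun_on A (S \<inter> T) (\<lambda>r. V r h)" if "vector_field A S V" for V
    by (rule vf_smooth[OF that T(1)])
  have T2: "smooth_fun_on A (S \<inter> (S \<inter> T)) (\<lambda>q. U q (\<lambda>r. V r h))" if "vector_field A S U" "vector_field A S V" for U V
    by (rule vf_smooth[OF that(1) T1[OF that(2)]])
  have near: "smooth_near A q (\<lambda>r. V r h)" if "vector_field A S V" "q \<in> S \<inter> T" for V q
    by (rule A.smooth_nearI[OF T1[OF that(1)] that(2)])
  have near2: "smooth_near A p (\<lambda>q. U q (\<lambda>r. V r h))" if "vector_field A S U" "vector_field A S V" for U V
    by (rule A.smooth_nearI[OF T2[OF that]]) (use p T in simp)
  have b: "lie_bracket A Y Z q h = Y q (\<lambda>r. Z r h) - Z q (\<lambda>r. Y r h)" if "q \<in> T" for q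
    using A.smooth_nearI[OF T(1) that] by (simp add: lie_bracket_def)
  have "X p (\<lambda>q. lie_bracket A Y Z q h) = X p (\<lambda>q. Y q (\<lambda>r. Z r h) + (- 1) * Z q (\<lambda>r. Y r h))"
    by (rule A.tangent_fun_cong[OF x A.smooth_fun_on_open[OF T(1)] T(2)]) (simp add: b)
  also have "\<dots> = X p (\<lambda>q. Y q (\<lambda>r. Z r h)) + X p (\<lambda>q. (- 1) * Z q (\<lambda>r. Y r h))"
    by (rule A.tangent_fun_add[OF x near2[OF Y Z] A.smooth_near_mult[OF A.smooth_near_const near2[OF Z Y]]])
  also have "X p (\<lambda>q. (- 1) * Z q (\<lambda>r. Y r h)) = - X p (\<lambda>q. Z q (\<lambda>r. Y r h))"
    using A.tangent_fun_mult[OF x A.smooth_near_const[of p "- 1"] near2[OF Z Y]] A.tangent_fun_const[OF x]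
    by simp
  finally have "X p (\<lambda>q. lie_bracket A Y Z q h) = X p (\<lambda>q. Y q (\<lambda>r. Z r h)) - X p (\<lambda>q. Z q (\<lambda>r. Y r h))"
    by simp
  moreover have "lie_bracket A Y Z p (\<lambda>r. X r h) = Y p (\<lambda>q. Z q (\<lambda>r. X r h)) - Z p (\<lambda>q. Y q (\<lambda>r. X r h))"
    using near[OF X, of p] p T(2) by (simp add: lie_bracket_def)
  ultimately show ?thesis
    using A.smooth_nearI[OF T] by (simp add: lie_bracket_def[of A X "lie_bracket A Y Z"])
qed

text \<open>On functions smooth near \<open>p\<close> the twelve iterated derivatives cancel in
  pairs; on all others every bracket is 0 by convention.\<close>

lemma jacobi:
  assumes X: "vector_field A S X" and Y: "vector_field A S Y" and Z: "vector_field A S Z" and p: "p \<in> S"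
  shows "lie_bracket A X (lie_bracket A Y Z) p + lie_bracket A Y (lie_bracket A Z X) p
    + lie_bracket A Z (lie_bracket A X Y) p = 0"
proof (rule ext)
  fix h
  show "(lie_bracket A X (lie_bracket A Y Z) p + lie_bracket A Y (lie_bracket A Z X) p
    + lie_bracket A Z (lie_bracket A X Y) p) h = 0 h"
  proof (cases "smooth_near A p h")
    case True
    then obtain T where T: "p \<in> T" "smooth_fun_on A T h" unfolding smooth_near_def by (elim exE conjE)
    show ?thesis
      using bracket_bracket[OF X Y Z p T(2,1)] bracket_bracket[OF Y Z X p T(2,1)] bracket_bracket[OF Z X Y p T(2,1)]
      by (simp add: plus_fun_apply zero_fun_apply)
  next
    case False
    then show ?thesis by (simp add: plus_fun_apply zero_fun_apply lie_bracket_def)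
  qed
qed

text \<open>Regrouped by the outer derivative, the cyclic sum of curvatures becomes, by vanishing
  torsion used twice, the cyclic sum of double brackets.\<close>

lemma bianchi:
  assumes X: "vector_field A S X" and Y: "vector_field A S Y" and Z: "vector_field A S Z" and p: "p \<in> S"
  shows "R X Y Z p + R Y Z X p + R Z X Y p = 0"
proof -
  have *: "nablaA p (U p) (\<lambda>q. nablaA q (V q) W) - nablaA p (U p) (\<lambda>q. nablaA q (W q) V)
      - nablaA p (lie_bracket A V W p) U = lie_bracket A U (lie_bracket A V W) p"
    if U: "vector_field A S U" and V: "vector_field A S V" and W: "vector_field A S W" for U V W
  proof -
    note u = vf_tangent[OF U p]
    note N = nabla_vf[OF V W] nabla_vf[OF W V]
    have "nablaA p (U p) (lie_bracket A V W) = nablaA p (U p) (\<lambda>q. nablaA q (V q) W - nablaA q (W q) V)"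
      by (rule M.conn_cong[OF bracket_vf[OF V W, unfolded vector_field_eq]
          M.field_diff[OF N[unfolded vector_field_eq]] p u])
         (rule lcA_torsion[OF V W, symmetric])
    also have "\<dots> = nablaA p (U p) (\<lambda>q. nablaA q (V q) W) - nablaA p (U p) (\<lambda>q. nablaA q (W q) V)"
      by (rule M.conn_diff[OF N[unfolded vector_field_eq] p u])
    finally show ?thesis
      using lcA_torsion[OF U bracket_vf[OF V W] p] by simp
  qed
  show ?thesis
    using jacobi[OF X Y Z p] unfolding *[OF X Y Z, symmetric] *[OF Y Z X, symmetric] *[OF Z X Y, symmetric]
    by (simp add: curvature_def algebra_simps)
qed

text \<open>Serves the polarization in \<open>R_constant_curvature\<close>. Additivity of the
  bracket is obtained from the torsion identity and the linearity of the connection.\<close>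

lemma R_add:
  assumes X: "vector_field A S X" and W: "vector_field A S W" and Y: "vector_field A S Y"
    and Z: "vector_field A S Z" and p: "p \<in> S"
  shows "R (\<lambda>q. X q + W q) Y Z p = R X Y Z p + R W Y Z p"
proof -
  note XW = vf_add[OF X W]
  note F = X[unfolded vector_field_eq] W[unfolded vector_field_eq] Y[unfolded vector_field_eq] Z[unfolded vector_field_eq]
  note x = vf_tangent[OF X p] and w = vf_tangent[OF W p] and y = vf_tangent[OF Y p]
  note bX = bracket_tangent[OF X Y p] and bW = bracket_tangent[OF W Y p]
  have b: "lie_bracket A (\<lambda>q. X q + W q) Y p = lie_bracket A X Y p + lie_bracket A W Y p"
    unfolding lcA_torsion[OF XW Y p, symmetric] lcA_torsion[OF X Y p, symmetric] lcA_torsion[OF W Y p, symmetric]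
      M.conn_vec_add[OF F(3) p x w] M.conn_add[OF F(1,2) p y]
    by (simp add: algebra_simps)
  have "nablaA p (Y p) (\<lambda>q. nablaA q (X q + W q) Z) = nablaA p (Y p) (\<lambda>q. nablaA q (X q) Z + nablaA q (W q) Z)"
    by (rule M.conn_cong[OF nabla_vf[OF XW Z, unfolded vector_field_eq]
        vf_add[OF nabla_vf[OF X Z] nabla_vf[OF W Z], unfolded vector_field_eq] p y])
       (rule M.conn_vec_add[OF F(4) _ vf_tangent[OF X] vf_tangent[OF W]])
  also have "\<dots> = nablaA p (Y p) (\<lambda>q. nablaA q (X q) Z) + nablaA p (Y p) (\<lambda>q. nablaA q (W q) Z)"
    by (rule M.conn_add[OF nabla_vf[OF X Z, unfolded vector_field_eq] nabla_vf[OF W Z, unfolded vector_field_eq] p y])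
  finally show ?thesis
    unfolding curvature_def b M.conn_vec_add[OF F(4) p bX bW]
      M.conn_vec_add[OF nabla_vf[OF Y Z, unfolded vector_field_eq] p x w]
    by (simp add: algebra_simps)
qed

text \<open>The usual octahedron argument: four cyclic Bianchi identities combined with skewness in
  the first and in the last pair.\<close>

lemma R_pair_sym:
  assumes X: "vector_field A S X" and Y: "vector_field A S Y" and Z: "vector_field A S Z"
    and W: "vector_field A S W" and p: "p \<in> S"
  shows "gA p (R X Y Z p) (W p) = gA p (R Z W X p) (Y p)"
proof -
  define Q where "Q = (\<lambda>X Y Z W. gA p (R X Y Z p) (W p))"
  have s1: "Q V U Z W = - Q U V Z W"
    if "vector_field A S U" "vector_field A S V" "vector_field A S Z" "vector_field A S W" for U V Z W
    unfolding Q_def R_skew[OF that(1-3) p]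
    by (rule GA.neg_left[OF vf_tangent[OF R_vf[OF that(1-3)] p] vf_tangent[OF that(4) p]])
  have s2: "Q U V W Z = - Q U V Z W"
    if "vector_field A S U" "vector_field A S V" "vector_field A S Z" "vector_field A S W" for U V Z W
    unfolding Q_def R_metric_skew[OF that p]
    using GA.sym[OF vf_tangent[OF R_vf[OF that(1,2,4)] p] vf_tangent[OF that(3) p]] by simp
  have bi: "Q U V Z W + Q V Z U W + Q Z U V W = 0"
    if "vector_field A S U" "vector_field A S V" "vector_field A S Z" "vector_field A S W" for U V Z W
  proof -
    note r = R_vf[OF that(1-3), THEN vf_tangent, OF p] R_vf[OF that(2,3,1), THEN vf_tangent, OF p]
      R_vf[OF that(3,1,2), THEN vf_tangent, OF p] and w = vf_tangent[OF that(4) p]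
    have "Q U V Z W + Q V Z U W + Q Z U V W = gA p (R U V Z p + R V Z U p + R Z U V p) (W p)"
      by (simp add: Q_def GA.add_left A.tangent_add r w)
    then show ?thesis by (simp add: bianchi[OF that(1-3) p] GA.zero_left[OF w])
  qed
  have "Q X Y Z W = Q Z W X Y"
    using bi[OF X Y Z W] bi[OF Y Z W X] bi[OF Z W X Y] bi[OF W X Y Z]
      s1[OF X Y Z W] s1[OF X Y W Z] s1[OF X Z Y W] s1[OF X Z W Y] s1[OF X W Y Z] s1[OF X W Z Y]
      s1[OF Y Z X W] s1[OF Y Z W X] s1[OF Y W X Z] s1[OF Y W Z X] s1[OF Z W X Y] s1[OF Z W Y X]
      s2[OF X Y Z W] s2[OF X Z Y W] s2[OF X W Y Z] s2[OF Y Z X W] s2[OF Y W X Z] s2[OF Z W X Y]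
    by linarith
  then show ?thesis by (simp add: Q_def)
qed

section \<open>Constant sectional curvature\<close>

text \<open>Clears the denominator, the Gram determinant, which is positive for independent vectors.
  If \<open>X p\<close> is a multiple of \<open>Y p\<close>, the right side is 0, and so is the left
  by skewness in the last two arguments, whatever field \<open>X\<close> is.\<close>

lemma R_sectional:
  assumes cc: "constant_sectional_curvature A gA nablaA c"
    and X: "vector_field A S X" and Y: "vector_field A S Y" and p: "p \<in> S" and nz: "Y p \<noteq> 0"
  shows "gA p (R X Y Y p) (X p) = c * (gA p (X p) (X p) * gA p (Y p) (Y p) - (gA p (X p) (Y p))\<^sup>2)"
proof -
  note x = vf_tangent[OF X p] and y = vf_tangent[OF Y p] and r = vf_tangent[OF R_vf[OF X Y Y] p]
  show ?thesis
  proof (cases "\<exists>a. X p = a *\<^sub>R Y p")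
    case True
    then obtain a where a: "X p = a *\<^sub>R Y p" ..
    have "gA p (R X Y Y p) (Y p) = 0"
      using R_metric_skew[OF X Y Y Y p] GA.sym[OF r y] by simp
    then show ?thesis
      using y r by (simp add: a GA.scale_left GA.scale_right A.tangent_scale power2_eq_square)
  next
    case False
    then have ne: "X p \<noteq> Y p" by (metis scaleR_one)
    have "X p \<notin> span {Y p}" using False by (auto simp: span_singleton)
    then have ind: "independent {X p, Y p}" using ne nz by (simp add: independent_insert)
    have "sectional_curvature A gA nablaA X Y p = c"
      using cc X Y p ne ind unfolding constant_sectional_curvature_def by blast
    moreover have "gA p (X p) (X p) * gA p (Y p) (Y p) - (gA p (X p) (Y p))\<^sup>2 > 0"
    proof -
      \<comment> \<open>\<open>?w\<close> is the component of \<open>X p\<close> orthogonal to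
        \<open>Y p\<close>; its squared norm times that of \<open>Y p\<close> is the Gram
        determinant.\<close>
      let ?a = "gA p (X p) (Y p) / gA p (Y p) (Y p)"
      let ?w = "X p - ?a *\<^sub>R Y p"
      have yy: "gA p (Y p) (Y p) > 0" by (rule GA.pos[OF y nz])
      have w: "?w \<in> tangent_space A p" by (intro A.tangent_diff A.tangent_scale x y)
      have "?w \<noteq> 0" using False by auto
      then have "0 < gA p ?w ?w" by (rule GA.pos[OF w])
      also have "gA p ?w ?w = gA p (X p) (X p) - ?a * gA p (X p) (Y p)"
        using yy GA.sym[OF x y]
        by (simp add: GA.diff_left GA.diff_right GA.scale_left GA.scale_right A.tangent_diff A.tangent_scale x y)
      finally show ?thesis using yy by (simp add: field_simps power2_eq_square)
    qed
    ultimately show ?thesis by (simp add: sectional_curvature_def field_simps)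
  qed
qed

text \<open>Polarization: by pair symmetry <R(X, Y) Y, W> is symmetric in X and W, so it is
  determined by its values for X = W, which \<open>R_sectional\<close> provides. It is applied to
  \<open>X\<close>, \<open>W\<close> and \<open>X + W\<close>.\<close>

lemma R_constant_curvature:
  assumes cc: "constant_sectional_curvature A gA nablaA c"
    and X: "vector_field A S X" and Y: "vector_field A S Y" and W: "vector_field A S W"
    and p: "p \<in> S" and nz: "Y p \<noteq> 0"
  shows "gA p (R X Y Y p) (W p) = c * (gA p (X p) (W p) * gA p (Y p) (Y p) - gA p (X p) (Y p) * gA p (W p) (Y p))"
proof -
  note x = vf_tangent[OF X p] and y = vf_tangent[OF Y p] and w = vf_tangent[OF W p]
  note rx = vf_tangent[OF R_vf[OF X Y Y] p] and rw = vf_tangent[OF R_vf[OF W Y Y] p]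
  have "gA p (R W Y Y p) (X p) = gA p (R Y X W p) (Y p)" by (rule R_pair_sym[OF W Y Y X p])
  also have "\<dots> = gA p (R X Y Y p) (W p)"
    unfolding R_skew[OF X Y W p]
    using R_metric_skew[OF X Y Y W p] GA.sym[OF vf_tangent[OF R_vf[OF X Y W] p] y]
      GA.neg_left[OF vf_tangent[OF R_vf[OF X Y W] p] y] by simp
  finally have sym: "gA p (R W Y Y p) (X p) = gA p (R X Y Y p) (W p)" .
  have "gA p (R X Y Y p + R W Y Y p) (X p + W p)
      = c * (gA p (X p + W p) (X p + W p) * gA p (Y p) (Y p) - (gA p (X p + W p) (Y p))\<^sup>2)"
    using R_sectional[OF cc vf_add[OF X W] Y p nz] unfolding R_add[OF X W Y Y p] .
  then have "gA p (R X Y Y p) (X p) + gA p (R W Y Y p) (W p) + 2 * gA p (R X Y Y p) (W p)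
      = c * ((gA p (X p) (X p) + 2 * gA p (X p) (W p) + gA p (W p) (W p)) * gA p (Y p) (Y p)
        - (gA p (X p) (Y p) + gA p (W p) (Y p))\<^sup>2)"
    using sym GA.sym[OF x w]
    by (simp add: GA.add_left GA.add_right A.tangent_add x y w rx rw algebra_simps)
  then show ?thesis
    using R_sectional[OF cc X Y p nz] R_sectional[OF cc W Y p nz]
    by (simp add: power2_eq_square algebra_simps)
qed

text \<open>Here n > 1 enters: two distinct coordinate vectors cannot both be multiples of
  \<open>x\<close>, and Gram-Schmidt turns a vector that is not a multiple into an orthogonal
  one.\<close>

lemma ex_orthogonal_vector:
  assumes dim: "DIM('e) > 1" and x: "x \<in> tangent_space A p" "x \<noteq> 0"
  obtains y where "y \<in> tangent_space A p" "y \<noteq> 0" "gA p x y = 0"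
proof -
  obtain U \<phi> where c: "(U, \<phi>) \<in> A" "p \<in> U" by (rule A.chart_at)
  have "\<exists>w\<in>tangent_space A p. \<forall>a. w \<noteq> a *\<^sub>R x"
  proof (rule ccontr)
    assume "\<not> ?thesis"
    then have all: "\<exists>a. w = a *\<^sub>R x" if "w \<in> tangent_space A p" for w using that by blast
    obtain b :: 'e where b: "b \<in> Basis" using nonempty_Basis by blast
    have "Basis \<noteq> {b}" using dim by (metis card_1_singleton_iff less_irrefl One_nat_def)
    then obtain d where d: "d \<in> Basis" "d \<noteq> b" using b by blast
    obtain s t where st: "A.chart_vec U \<phi> p b = s *\<^sub>R x" "A.chart_vec U \<phi> p d = t *\<^sub>R x"
      using all[OF A.chart_vec_in_tangent_space[OF c, of b]] all[OF A.chart_vec_in_tangent_space[OF c, of d]] by blast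
    \<comment> \<open>These coefficients cancel the multiples of \<open>x\<close>, which contradicts
      independence of the coordinate vectors.\<close>
    have "A.chart_vec U \<phi> p (t *\<^sub>R b + (- s) *\<^sub>R d) = 0"
      unfolding A.chart_vec_lincomb[OF c] st by simp
    then have "(t *\<^sub>R b + (- s) *\<^sub>R d) \<bullet> e = 0" for e
      using A.chart_vec_coord[OF c, of "t *\<^sub>R b + (- s) *\<^sub>R d" e] by (simp add: zero_fun_apply)
    from this[of b] have "t = 0" using b d by (simp add: inner_diff_left inner_add_left inner_Basis)
    then have "A.chart_vec U \<phi> p d = 0" using st by simp
    then show False using A.chart_vec_coord[OF c, of d d] d by (simp add: zero_fun_apply)
  qed
  then obtain w where w: "w \<in> tangent_space A p" "\<And>a. w \<noteq> a *\<^sub>R x" by blast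
  let ?y = "w - (gA p x w / gA p x x) *\<^sub>R x"
  show ?thesis
  proof (rule that[of ?y])
    show "?y \<in> tangent_space A p" by (intro A.tangent_diff A.tangent_scale w x)
    show "?y \<noteq> 0" using w(2) by simp
    show "gA p x ?y = 0"
      using GA.pos[OF x] by (simp add: GA.diff_right GA.scale_right A.tangent_scale w x)
  qed
qed

end

section \<open>The cubic form of a semiparallel submanifold\<close>

context totally_real_submanifold
begin

lemma shape_sym:
  assumes "vector_field A S X" "vector_field A S Y" "p \<in> S"
  shows "shape X Y p = shape Y X p"
  using sff_sym[OF assms] by (simp add: shape_def)

text \<open>Expresses the cubic form as <sigma(X, Y), J Z>, where sigma can be replaced by a
  derivative with \<open>D\<close>.\<close>

lemma cubic_sff:
  assumes "vector_field A S X" "vector_field A S Y" "vector_field A S Z" "p \<in> S"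
  shows "gA p (shape X Y p) (Z p) = g (\<iota> p) (sff X Y p) (J (\<iota> p) (push B \<iota> p (Z p)))"
proof -
  note \<sigma> = NS_tangent[OF sff_normal[OF assms(1,2,4)]] and z = push_tangent[OF vf_tangent[OF assms(3,4)]]
  show ?thesis
    unfolding induced_metric_def push_shape[OF assms(1,2,4)] GB.neg_left[OF J_tangent[OF \<sigma>] z] J_skew[OF \<sigma> z]
    by simp
qed

text \<open>Both sides are \<open>\<langle>D\<^sub>X Y, J Z\<rangle>\<close>, since \<open>\<langle>Y, J Z\<rangle> = 0\<close>.\<close>

lemma cubic_sym:
  assumes X: "vector_field A S X" and Y: "vector_field A S Y" and Z: "vector_field A S Z" and p: "p \<in> S"
  shows "gA p (shape X Y p) (Z p) = gA p (shape X Z p) (Y p)"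
proof -
  note oS = vf_open[OF X] and v = vf_tangent[OF X p]
  let ?y = "\<lambda>q. push B \<iota> q (Y q)" and ?z = "\<lambda>q. push B \<iota> q (Z q)"
  note F = push_field[OF Y] push_field[OF Z]
  note t = F[THEN field_tangent, OF p] F[THEN conn_tangent, OF p v]
  \<comment> \<open>The intrinsic derivative is tangential and \<open>J\<close> of a tangential
    vector is normal, so sigma and \<open>D\<close> have the same product with it.\<close>
  have sff: "g (\<iota> p) (sff X V p) (J (\<iota> p) (push B \<iota> p w)) = g (\<iota> p) (D p (X p) (\<lambda>q. push B \<iota> q (V q))) (J (\<iota> p) (push B \<iota> p w))"
    if V: "vector_field A S V" and w: "w \<in> tangent_space A p" for V w
  proof -
    note n = nabla_tangent[OF V p v]
    have "g (\<iota> p) (push B \<iota> p (nablaA p (X p) V)) (J (\<iota> p) (push B \<iota> p w)) = 0"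
      using NS_orth[OF J_push_NS[OF w] n] GB.sym[OF push_tangent[OF n] J_tangent[OF push_tangent[OF w]]] by simp
    then show ?thesis
      using GB.diff_left[OF conn_tangent[OF push_field[OF V] p v] push_tangent[OF n] J_tangent[OF push_tangent[OF w]]]
      by (simp add: second_fundamental_form_def)
  qed
  have "X p (\<lambda>q. g (\<iota> q) (?y q) (J (\<iota> q) (?z q))) = X p (\<lambda>q. 0)"
  proof (rule A.tangent_fun_cong[OF v oS p])
    fix q assume q: "q \<in> S"
    note yq = vf_tangent[OF Y q] and zq = vf_tangent[OF Z q]
    show "g (\<iota> q) (?y q) (J (\<iota> q) (?z q)) = 0"
      using NS_orth[OF J_push_NS[OF zq] yq] GB.sym[OF push_tangent[OF yq] J_tangent[OF push_tangent[OF zq]]] by simp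
  qed
  then have "g (\<iota> p) (D p (X p) ?y) (J (\<iota> p) (?z p)) + g (\<iota> p) (?y p) (J (\<iota> p) (D p (X p) ?z)) = 0"
    using conn_metric[OF F(1) J_field[OF F(2)] p v] conn_J[OF F(2) p v] A.tangent_fun_const[OF v] by simp
  then have "g (\<iota> p) (D p (X p) ?y) (J (\<iota> p) (?z p)) = g (\<iota> p) (D p (X p) ?z) (J (\<iota> p) (?y p))"
    using J_skew[OF t(1,4)] GB.sym[OF J_tangent[OF t(1)] t(4)] by simp
  then show ?thesis
    unfolding cubic_sff[OF X Y Z p] cubic_sff[OF X Z Y p]
    using sff[OF Y vf_tangent[OF Z p]] sff[OF Z vf_tangent[OF Y p]] by simp
qed

text \<open>Semiparallelism with sigma replaced by J h. All three terms are \<open>J\<close> of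
  pushed vectors, and both maps are injective on tangent vectors. The curvature operator acts as a
  derivation of h.\<close>

lemma shape_curvature:
  assumes sp: "semiparallel A B \<iota> g nablaA D"
    and X: "vector_field A S X" and Y: "vector_field A S Y" and Z: "vector_field A S Z"
    and U: "vector_field A S U" and p: "p \<in> S"
  shows "R X Y (shape Z U) p = shape (R X Y Z) U p + shape Z (R X Y U) p"
proof -
  note RZ = R_vf[OF X Y Z] and RU = R_vf[OF X Y U] and H = shape_vf[OF Z U]
  note t = vf_tangent[OF R_vf[OF X Y H] p] vf_tangent[OF shape_vf[OF RZ U] p] vf_tangent[OF shape_vf[OF Z RU] p]
  let ?d = "R X Y (shape Z U) p - shape (R X Y Z) U p - shape Z (R X Y U) p"
  have d: "?d \<in> tangent_space A p" by (intro A.tangent_diff t)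
  have "curvature A (normal_connection A B \<iota> g D) X Y (sff Z U) p - sff (R X Y Z) U p - sff Z (R X Y U) p = 0"
    using sp X Y Z U p unfolding semiparallel_def by blast
  then have "J (\<iota> p) (push B \<iota> p ?d) = 0"
    unfolding normal_curvature[OF X Y H p sff_field[OF Z U] sff_shape[OF Z U], simplified]
      sff_shape[OF RZ U p] sff_shape[OF Z RU p]
    by (simp add: push_diff J_diff push_tangent B.tangent_diff t)
  then have "push B \<iota> p ?d = 0" using J_J[OF push_tangent[OF d]] J_zero by simp
  then have "?d = 0" by (rule push_eq_0[OF d])
  then show ?thesis by (simp add: algebra_simps)
qed

lemma cubic_eq_0_orthogonal:
  assumes sp: "semiparallel A B \<iota> g nablaA D"
    and cc: "constant_sectional_curvature A gA nablaA c" and c: "c \<noteq> 0"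
    and X: "vector_field A S X" and Y: "vector_field A S Y" and p: "p \<in> S"
    and nz: "X p \<noteq> 0" "Y p \<noteq> 0" and orth: "gA p (X p) (Y p) = 0"
  shows "gA p (shape Y Y p) (Y p) = 0"
proof -
  note x = vf_tangent[OF X p] and y = vf_tangent[OF Y p]
  have xx: "gA p (X p) (X p) > 0" by (rule GA.pos[OF x nz(1)])
  have yx: "gA p (Y p) (X p) = 0" using GA.sym[OF x y] orth by simp
  note RX = R_vf[OF X Y X] and RY = R_vf[OF X Y Y]
  \<comment> \<open>The equation R(X, Y) X = -c |X|^2 Y, tested against a field
    \<open>H\<close>.\<close>
  have inner_RX: "gA p (H p) (R X Y X p) = - c * gA p (X p) (X p) * gA p (H p) (Y p)"
    if H: "vector_field A S H" for H
  proof -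
    note h = vf_tangent[OF H p] and r = vf_tangent[OF R_vf[OF Y X X] p]
    have "gA p (H p) (R X Y X p) = - gA p (R Y X X p) (H p)"
      unfolding R_skew[OF Y X X p] using GA.neg_right[OF r h] GA.sym[OF r h] by simp
    also have "\<dots> = - c * gA p (X p) (X p) * gA p (H p) (Y p)"
      using R_constant_curvature[OF cc Y X H p nz(1)] yx GA.sym[OF y h] by simp
    finally show ?thesis .
  qed
  \<comment> \<open>R(X, Y) is skew and is shifted from \<open>H\<close> to
    \<open>X\<close>.\<close>
  have inner_R: "gA p (R X Y H p) (X p) = c * gA p (X p) (X p) * gA p (H p) (Y p)"
    if H: "vector_field A S H" for H
    using R_metric_skew[OF X Y H X p] inner_RX[OF H] by simp
  \<comment> \<open>The derivation rule for two equal slots gives R(X, Y) h(Z, Z) = 2 h(Z, R(X, Y)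
    Z); symmetry of the cubic form then moves \<open>X\<close> into h.\<close>
  have double: "gA p (R X Y (shape Z Z) p) (X p) = 2 * gA p (shape Z X p) (R X Y Z p)"
    if Z: "vector_field A S Z" for Z
  proof -
    note RZ = R_vf[OF X Y Z]
    have "shape Z (R X Y Z) p = shape (R X Y Z) Z p" by (rule shape_sym[OF Z RZ p])
    then have "R X Y (shape Z Z) p = 2 *\<^sub>R shape Z (R X Y Z) p"
      using shape_curvature[OF sp X Y Z Z p] by (simp add: scaleR_2)
    then have "gA p (R X Y (shape Z Z) p) (X p) = 2 * gA p (shape Z (R X Y Z) p) (X p)"
      using GA.scale_left[OF vf_tangent[OF shape_vf[OF Z RZ] p] x] by simp
    then show ?thesis using cubic_sym[OF Z RZ X p] by simp
  qed
  have "c * gA p (X p) (X p) * gA p (shape X X p) (Y p) = 2 * (- c * gA p (X p) (X p) * gA p (shape X X p) (Y p))"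
    using double[OF X] inner_R[OF shape_vf[OF X X]] inner_RX[OF shape_vf[OF X X]] by simp
  then have xxy: "gA p (shape X X p) (Y p) = 0" using c xx by simp
  have h: "shape Y X p \<in> tangent_space A p" by (rule vf_tangent[OF shape_vf[OF Y X] p])
  \<comment> \<open>Here R(X, Y) Y = c |Y|^2 X, so the product is a multiple of C(Y, X, X) = C(X, X,
    Y), which was just shown to vanish.\<close>
  have "gA p (shape Y X p) (R X Y Y p) = c * (gA p (X p) (shape Y X p) * gA p (Y p) (Y p))"
    using R_constant_curvature[OF cc X Y shape_vf[OF Y X] p nz(2)] orth
      GA.sym[OF h vf_tangent[OF RY p]] by simp
  also have "gA p (X p) (shape Y X p) = gA p (shape X X p) (Y p)"
    using GA.sym[OF h x] shape_sym[OF Y X p] cubic_sym[OF X Y X p] by simp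
  finally have "gA p (shape Y X p) (R X Y Y p) = 0" using xxy by simp
  then show ?thesis
    using double[OF Y] inner_R[OF shape_vf[OF Y Y]] c xx by simp
qed

text \<open>A nonzero \<open>Y p\<close> has a nonzero orthogonal partner, extended to a field near
  \<open>p\<close>. Shrinking the domain is harmless, as the claim concerns \<open>p\<close>
  only.\<close>

lemma cubic_eq_0_diagonal:
  assumes sp: "semiparallel A B \<iota> g nablaA D"
    and cc: "constant_sectional_curvature A gA nablaA c" and c: "c \<noteq> 0" and dim: "DIM('e) > 1"
    and Y: "vector_field A S Y" and p: "p \<in> S"
  shows "gA p (shape Y Y p) (Y p) = 0"
proof (cases "Y p = 0")
  case True
  then show ?thesis using GA.zero_right[OF vf_tangent[OF shape_vf[OF Y Y] p]] by simp
next
  case False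
  note y = vf_tangent[OF Y p]
  obtain x where x: "x \<in> tangent_space A p" "x \<noteq> 0" "gA p (Y p) x = 0"
    by (rule ex_orthogonal_vector[OF dim y False])
  obtain S' X where S': "open S'" "p \<in> S'" "S' \<subseteq> S" and X: "vector_field A S' X" "X p = x"
    by (rule vf_extension[OF vf_open[OF Y] p x(1)])
  show ?thesis
    by (rule cubic_eq_0_orthogonal[OF sp cc c X(1) vf_subset[OF Y S'(1,3)] S'(2)])
       (use X(2) x False GA.sym[OF x(1) y] in simp_all)
qed

text \<open>Polarization of a symmetric cubic form whose diagonal vanishes. The arguments are
  fields; linearity is taken from the metric in the last slot and carried to the others by
  symmetry.\<close>

lemma shape_eq_0:
  assumes sp: "semiparallel A B \<iota> g nablaA D"
    and cc: "constant_sectional_curvature A gA nablaA c" and c: "c \<noteq> 0" and dim: "DIM('e) > 1"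
    and X: "vector_field A S X" and Z: "vector_field A S Z" and p: "p \<in> S"
  shows "shape X Z p = 0"
proof -
  define C where "C = (\<lambda>X Y Z. gA p (shape X Y p) (Z p))"
  have s12: "C X Y Z = C Y X Z" if "vector_field A S X" "vector_field A S Y" for X Y Z
    using shape_sym[OF that p] by (simp add: C_def)
  have s23: "C X Y Z = C X Z Y" if "vector_field A S X" "vector_field A S Y" "vector_field A S Z" for X Y Z
    using cubic_sym[OF that p] by (simp add: C_def)
  have add3: "C X Y (\<lambda>q. Z q + W q) = C X Y Z + C X Y W"
    if "vector_field A S X" "vector_field A S Y" "vector_field A S Z" "vector_field A S W" for X Y Z W
    using GA.add_right[OF vf_tangent[OF that(3) p] vf_tangent[OF that(4) p] vf_tangent[OF shape_vf[OF that(1,2)] p]]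
    by (simp add: C_def)
  have neg3: "C X Y (\<lambda>q. - Z q) = - C X Y Z"
    if "vector_field A S X" "vector_field A S Y" "vector_field A S Z" for X Y Z
    using GA.neg_right[OF vf_tangent[OF that(3) p] vf_tangent[OF shape_vf[OF that(1,2)] p]]
    by (simp add: C_def)
  have square: "C (\<lambda>q. X q + W q) (\<lambda>q. X q + W q) Y = C X X Y + 2 * C X W Y + C W W Y"
    if X: "vector_field A S X" and W: "vector_field A S W" and Y: "vector_field A S Y" for X W Y
  proof -
    note XW = vf_add[OF X W]
    have "C (\<lambda>q. X q + W q) (\<lambda>q. X q + W q) Y = C Y (\<lambda>q. X q + W q) X + C Y (\<lambda>q. X q + W q) W"
      using s23[OF XW XW Y] s12[OF XW Y, of "\<lambda>q. X q + W q"] add3[OF Y XW X W] by simp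
    also have "\<dots> = (C Y X X + C Y X W) + (C Y W X + C Y W W)"
      using s23[OF Y XW X] s23[OF Y XW W] add3[OF Y X X W] add3[OF Y W X W] by simp
    finally show ?thesis
      using s12[OF Y X] s12[OF Y W] s23[OF X Y X] s23[OF X Y W] s23[OF W Y X] s23[OF W Y W] s12[OF X W, of Y] by simp
  qed
  have diag: "C Y Y Y = 0" if "vector_field A S Y" for Y
    unfolding C_def by (rule cubic_eq_0_diagonal[OF sp cc c dim that p])
  \<comment> \<open>The expansion of C on X + Y is 3 (C(X, X, Y) + C(X, Y, Y)), the diagonal terms
    being 0.\<close>
  have cube: "C X X Y + C X Y Y = 0" if X: "vector_field A S X" and Y: "vector_field A S Y" for X Y
  proof -
    have "C (\<lambda>q. X q + Y q) (\<lambda>q. X q + Y q) (\<lambda>q. X q + Y q) = C X X X + C X X Y + 2 * (C X Y X + C X Y Y) + C Y Y X + C Y Y Y"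
      using square[OF X Y vf_add[OF X Y]] add3[OF X X X Y] add3[OF X Y X Y] add3[OF Y Y X Y] by simp
    then show ?thesis
      using diag[OF X] diag[OF Y] diag[OF vf_add[OF X Y]] s23[OF X Y X] s12[OF X Y, of Y] s23[OF Y Y X] by simp
  qed
  \<comment> \<open>Replacing \<open>Y\<close> by \<open>- Y\<close> changes the sign of C(X, X, Y)
    but not of C(X, Y, Y), so both vanish.\<close>
  have xxy: "C X X Y = 0" if X: "vector_field A S X" and Y: "vector_field A S Y" for X Y
  proof -
    note nY = vf_neg[OF Y]
    have "C X (\<lambda>q. - Y q) (\<lambda>q. - Y q) = C X Y Y"
      using neg3[OF X nY Y] s23[OF X nY Y] neg3[OF X Y Y] by simp
    then show ?thesis using cube[OF X Y] cube[OF X nY] neg3[OF X X Y] by simp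
  qed
  have "C X Z Y = 0" if Y: "vector_field A S Y" for Y
    using square[OF X Z Y] xxy[OF vf_add[OF X Z] Y] xxy[OF X Y] xxy[OF Z Y] by simp
  \<comment> \<open>The last argument is h(X, Z) itself, which makes the value its squared
    norm.\<close>
  from this[OF shape_vf[OF X Z]] show ?thesis
    using GA.eq_0I[OF vf_tangent[OF shape_vf[OF X Z] p]] by (simp add: C_def)
qed

end

theorem theorem1:
  fixes B :: "('b::{t2_space,second_countable_topology}, 'f::euclidean_space) chart set"
    and g :: "'b metric_field" and J :: "'b endo_field" and nablaB :: "('b, 'b) derivation_op"
    and A :: "('a::{t2_space,second_countable_topology}, 'e::euclidean_space) chart set"
    and \<iota> :: "'a \<Rightarrow> 'b" and nablaA :: "('a, 'a) derivation_op" and D :: "('a, 'b) derivation_op"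
    and m n :: nat and c :: real
  assumes "kaehler_manifold B g J nablaB" and "DIM('f) = 2 * m"
    and "smooth_manifold A" and "DIM('e) = n" and "n > 1"
    and "immersion A B \<iota>"
    and "levi_civita A (induced_metric B \<iota> g) nablaA"
    and "pullback_connection A B \<iota> nablaB D"
    and "totally_real A B \<iota> g J"
    and "semiparallel A B \<iota> g nablaA D"
    and "parallel_f_structure A B \<iota> g J D"
    and "constant_sectional_curvature A (induced_metric B \<iota> g) nablaA c"
  shows "c = 0 \<or> totally_geodesic A B \<iota> nablaA D"
proof (cases "c = 0")
  case False
  interpret totally_real_submanifold A B \<iota> D g J nablaB nablaA
    using assms
    by unfold_locales (auto simp: kaehler_manifold_def immersion_def pullback_connection_def)
  have dim: "DIM('e) > 1" using assms(4,5) by simp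
  have "second_fundamental_form B \<iota> nablaA D X Y p = 0"
    if "vector_field A S X" "vector_field A S Y" "p \<in> S" for S X Y p
    using sff_shape[OF that] shape_eq_0[OF assms(10,12) False dim that] by (simp add: push_zero J_zero)
  then show ?thesis unfolding totally_geodesic_def by blast
qed simp

end
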